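(* Let $X$ be a locally compact Hausdorff space and $\kappa$ a kernel on $X$ satisfying the energy, consistency, and domination principles. For any $\mu\in\mathcal E$ and $A\subset X$, \[\kappa(\mu^A,\nu)=\kappa(\mu,\nu^A)\quad\text{for all }\nu\in\mathcal E.\] Furthermore, this symmetry relation determines the inner balayage $\mu^A$ uniquely within $\mathcal E$; that is, if for some $\xi\in\mathcal E$, $\kappa(\xi,\nu)=\kappa(\mu,\nu^A)$ for all $\nu\in\mathcal E$, then $\xi=\mu^A$.
   Context: **Measures.** $X$ is a locally compact Hausdorff space. $C_0(X)$ is the space of continuous functions $f:X\to\mathbb R$ of compact support. $\mathfrak M$ is the linear space of (signed, real-valued) Radon measures on $X$ (differences of positive Radon measures, understood as functionals on $C_0(X)$), with the vague topology of pointwise convergence on $C_0(X)$. $\mathfrak M^+$ is the cone of positive measures; $\mu=\mu^+-\mu^-$ is the Hahn–Jordan decomposition. **Kernels.** A kernel is a symmetric lower semicontinuous function $\kappa:X\times X\to[0,\infty]$. Put $\kappa\mu(x):=\int\kappa(x,y)\,d\mu(y)$ (potential) and $\kappa(\mu,\nu):=\int\kappa\,d(\mu\otimes\nu)$ (mutual energy; $\kappa(\mu,\mu)$ is the energy of $\mu$), whenever well defined as a finite number or $\pm\infty$. $\mathcal E$ is the set of $\mu\in\mathfrak M$ of finite energy, $\mathcal E^+:=\mathcal E\cap\mathfrak M^+$. - Energy principle: $\kappa(\mu,\mu)\geqslant0$ for all $\mu\in\mathfrak M$ for which the energy is defined, and $\kappa(\mu,\mu)=0$ implies $\mu=0$.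 Then $\mathcal E$ is a pre-Hilbert space with inner product $\kappa(\mu,\nu)$ and norm $\|\mu\|=\sqrt{\kappa(\mu,\mu)}$; the norm topology is called strong. - Consistency principle: every strong Cauchy net in $\mathcal E^+$ converges strongly to any of its vague limit (cluster) points. - Domination principle: if $\mu,\nu\in\mathcal E^+$ and $\kappa\mu\leqslant\kappa\nu$ $\mu$-a.e., then $\kappa\mu\leqslant\kappa\nu$ on all of $X$. **Capacity.** $\mathcal E^+_A$ is the set of $\mu\in\mathcal E^+$ concentrated on $A$, i.e. such that $X\setminus A$ is locally $\mu$-negligible ($(X\setminus A)\cap K$ is $\mu$-negligible for every compact $K$). Inner capacity: $c_*(A):=\bigl[\inf\{\kappa(\mu,\mu):\mu\in\mathcal E^+_A,\ \mu(X)=1\}\bigr]^{-1}$ ($\inf\varnothing=+\infty$). "N.e. on $A$" means: everywhere on $A$ except for a subset of $A$ of inner capacity zero. **Balayage.** For $\mu\in\mathcal E^+$ and $A\subset X$, let $\Lambda_{A,\mu}$ be the set of $\nu\in\mathcal E^+$ with $\kappa\nu\geqslant\kappa\mu$ n.e. on $A$. The inner balayage $\mu^A$ is the unique measure in $\Lambda_{A,\mu}$ with $\kappa\mu^A=\min_{\nu\in\Lambda_{A,\mu}}\kappa\nu$ everywhere on $X$ (under the three principles it is known to exist and be unique). For signed $\mu\in\mathcal E$ (then $\mu^\pm\in\mathcal E^+$), $\mu^A:=(\mu^+)^A-(\mu^-)^A$. *)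

theory Defs
  imports "HOL-Analysis.Analysis"
begin

section \<open>Radon measures as functionals\<close>

text \<open>
  \<open>Cc\<close> is the space \<open>C\<^sub>0(X)\<close> of continuous real functions of compact support; the space \<open>X\<close>
  is the universe of a type.
\<close>

definition Cc :: "('a::topological_space \<Rightarrow> real) set" where
  "Cc = {f. continuous_on UNIV f \<and> compact (closure {x. f x \<noteq> 0})}"

definition positive_functional :: "(('a::topological_space \<Rightarrow> real) \<Rightarrow> real) \<Rightarrow> bool" where
  "positive_functional I \<longleftrightarrow>
     (\<forall>f\<in>Cc. \<forall>g\<in>Cc. I (\<lambda>x. f x + g x) = I f + I g) \<and>
     (\<forall>f\<in>Cc. \<forall>c. I (\<lambda>x. c * f x) = c * I f) \<and>
     (\<forall>f\<in>Cc. (\<forall>x. 0 \<le> f x) \<longrightarrow> 0 \<le> I f)"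

text \<open>
  A signed Radon measure is a difference of two positive functionals on \<open>Cc\<close>.  (It need not be
  a signed set function: both parts may have infinite mass.)  Outside \<open>Cc\<close> the functional is
  given the dummy value \<open>0\<close>, so that equality of measures is equality as functionals on \<open>Cc\<close>.
\<close>

typedef (overloaded) 'a radon =
  "{I :: ('a::topological_space \<Rightarrow> real) \<Rightarrow> real.
      (\<exists>P Q. positive_functional P \<and> positive_functional Q \<and> (\<forall>f\<in>Cc. I f = P f - Q f)) \<and>
      (\<forall>f. f \<notin> Cc \<longrightarrow> I f = 0)}"
  morphisms integ Abs_radon
proof
  show "(\<lambda>_. 0) \<in> {I :: ('a \<Rightarrow> real) \<Rightarrow> real.
      (\<exists>P Q. positive_functional P \<and> positive_functional Q \<and> (\<forall>f\<in>Cc. I f = P f - Q f)) \<and>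
      (\<forall>f. f \<notin> Cc \<longrightarrow> I f = 0)}"
    by (auto simp: positive_functional_def intro!: exI[of _ "\<lambda>_. 0"])
qed

setup_lifting type_definition_radon

lemma positive_functional_zero: "positive_functional (\<lambda>_. 0)"
  by (simp add: positive_functional_def)

lemma positive_functional_add:
  "positive_functional P \<Longrightarrow> positive_functional Q \<Longrightarrow> positive_functional (\<lambda>f. P f + Q f)"
  unfolding positive_functional_def by (simp add: algebra_simps)

lemma positive_functional_scale:
  "positive_functional P \<Longrightarrow> 0 \<le> c \<Longrightarrow> positive_functional (\<lambda>f. c * P f)"
  unfolding positive_functional_def by (simp add: algebra_simps)

lemma positive_difference_add:
  assumes "\<exists>P Q. positive_functional P \<and> positive_functional Q \<and> (\<forall>f\<in>Cc. I f = P f - Q f)"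
    and "\<exists>P Q. positive_functional P \<and> positive_functional Q \<and> (\<forall>f\<in>Cc. J f = P f - Q f)"
  shows "\<exists>P Q. positive_functional P \<and> positive_functional Q \<and> (\<forall>f\<in>Cc. I f + J f = P f - Q f)"
proof -
  obtain P Q P' Q' where "positive_functional P" "positive_functional Q"
    "positive_functional P'" "positive_functional Q'"
    and "\<forall>f\<in>Cc. I f = P f - Q f" "\<forall>f\<in>Cc. J f = P' f - Q' f"
    using assms by blast
  then show ?thesis
    by (intro exI[of _ "\<lambda>f. P f + P' f"] exI[of _ "\<lambda>f. Q f + Q' f"])
      (simp add: positive_functional_add)
qed

lemma positive_difference_scale:
  fixes c :: real
  assumes "\<exists>P Q. positive_functional P \<and> positive_functional Q \<and> (\<forall>f\<in>Cc. I f = P f - Q f)"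
  shows "\<exists>P Q. positive_functional P \<and> positive_functional Q \<and> (\<forall>f\<in>Cc. c * I f = P f - Q f)"
proof -
  obtain P Q where *: "positive_functional P" "positive_functional Q"
    and I: "\<forall>f\<in>Cc. I f = P f - Q f"
    using assms by blast
  show ?thesis
  proof (cases "0 \<le> c")
    case True
    have "\<forall>f\<in>Cc. c * I f = c * P f - c * Q f"
      using I by (simp add: right_diff_distrib)
    then show ?thesis
      using positive_functional_scale[OF *(1) True] positive_functional_scale[OF *(2) True] by blast
  next
    case False
    then have c: "0 \<le> - c" by simp
    have "\<forall>f\<in>Cc. c * I f = (- c) * Q f - (- c) * P f"
      using I by (simp add: right_diff_distrib)
    then show ?thesis
      using positive_functional_scale[OF *(1) c] positive_functional_scale[OF *(2) c] by blast
  qed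
qed

instantiation radon :: (topological_space) real_vector
begin

lift_definition zero_radon :: "'a radon" is "\<lambda>_. 0"
  by (auto intro!: exI[of _ "\<lambda>_. 0"] positive_functional_zero)

lift_definition plus_radon :: "'a radon \<Rightarrow> 'a radon \<Rightarrow> 'a radon" is "\<lambda>I J f. I f + J f"
  by (elim conjE, rule conjI, rule positive_difference_add, assumption+, simp)

lift_definition scaleR_radon :: "real \<Rightarrow> 'a radon \<Rightarrow> 'a radon" is "\<lambda>c I f. c * I f"
  by (elim conjE, rule conjI, rule positive_difference_scale, assumption, simp)

definition uminus_radon :: "'a radon \<Rightarrow> 'a radon" where
  "uminus_radon \<mu> = (-1) *\<^sub>R \<mu>"

definition minus_radon :: "'a radon \<Rightarrow> 'a radon \<Rightarrow> 'a radon" where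
  "minus_radon \<mu> \<nu> = \<mu> + (- \<nu>)"

instance
  by standard (unfold minus_radon_def uminus_radon_def, (transfer, simp add: algebra_simps)+)

end

definition positive_radon :: "'a::topological_space radon set" where
  "positive_radon = {\<mu>. \<forall>f\<in>Cc. (\<forall>x. 0 \<le> f x) \<longrightarrow> 0 \<le> integ \<mu> f}"

text \<open>
  Hahn--Jordan decomposition: \<open>\<mu>\<^sup>+(f) = sup {\<mu>(g) | 0 \<le> g \<le> f}\<close> for \<open>f \<ge> 0\<close>, and \<open>\<mu>\<^sup>- = (-\<mu>)\<^sup>+\<close>.
\<close>

definition pos_part :: "'a::topological_space radon \<Rightarrow> 'a radon" where
  "pos_part \<mu> = (THE \<rho>. \<forall>f\<in>Cc. (\<forall>x. 0 \<le> f x) \<longrightarrow>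
     integ \<rho> f = (SUP g\<in>{g\<in>Cc. \<forall>x. 0 \<le> g x \<and> g x \<le> f x}. integ \<mu> g))"

definition neg_part :: "'a::topological_space radon \<Rightarrow> 'a radon" where
  "neg_part \<mu> = pos_part (- \<mu>)"

definition vague_topology :: "'a::topological_space radon topology" where
  "vague_topology =
     pullback_topology UNIV (\<lambda>\<mu>. restrict (integ \<mu>) Cc) (product_topology (\<lambda>_. euclideanreal) Cc)"

definition product_radon ::
  "'a::topological_space radon \<Rightarrow> 'b::topological_space radon \<Rightarrow> ('a \<times> 'b) radon" where
  "product_radon \<mu> \<nu> =
     (THE \<rho>. \<forall>f\<in>Cc. \<forall>g\<in>Cc. integ \<rho> (\<lambda>(x, y). f x * g y) = integ \<mu> f * integ \<nu> g)"


section \<open>Integration\<close>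

text \<open>
  The integral of a lower semicontinuous \<open>f \<ge> 0\<close> with respect to a positive Radon measure is the
  supremum of the integrals of the minorants \<open>0 \<le> g \<le> f\<close> in \<open>Cc\<close>.  This is applied only to kernels,
  to constants and to indicators of open sets.
\<close>

definition lsc_integral :: "'a::topological_space radon \<Rightarrow> ('a \<Rightarrow> ennreal) \<Rightarrow> ennreal" where
  "lsc_integral \<mu> f =
     (SUP g\<in>{g\<in>Cc. \<forall>x. 0 \<le> g x \<and> ennreal (g x) \<le> f x}. ennreal (integ \<mu> g))"

text \<open>
  For signed measures the integral is defined unless it is of the form \<open>\<infinity> - \<infinity>\<close>; in that case
  \<open>signed_integral\<close> carries no meaning.
\<close>

definition signed_integral_defined :: "'a::topological_space radon \<Rightarrow> ('a \<Rightarrow> ennreal) \<Rightarrow> bool" where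
  "signed_integral_defined \<mu> f \<longleftrightarrow>
     lsc_integral (pos_part \<mu>) f < \<infinity> \<or> lsc_integral (neg_part \<mu>) f < \<infinity>"

definition signed_integral :: "'a::topological_space radon \<Rightarrow> ('a \<Rightarrow> ennreal) \<Rightarrow> ereal" where
  "signed_integral \<mu> f =
     enn2ereal (lsc_integral (pos_part \<mu>) f) - enn2ereal (lsc_integral (neg_part \<mu>) f)"

definition total_mass :: "'a::topological_space radon \<Rightarrow> ennreal" where
  "total_mass \<mu> = lsc_integral \<mu> (\<lambda>_. 1)"

text \<open>Outer measure zero, for a positive measure.\<close>

definition negligible_for :: "'a::topological_space radon \<Rightarrow> 'a set \<Rightarrow> bool" where
  "negligible_for \<mu> N \<longleftrightarrow> (INF U\<in>{U. open U \<and> N \<subseteq> U}. lsc_integral \<mu> (indicator U)) = 0"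

definition concentrated_on :: "'a::topological_space radon \<Rightarrow> 'a set \<Rightarrow> bool" where
  "concentrated_on \<mu> A \<longleftrightarrow> (\<forall>K. compact K \<longrightarrow> negligible_for \<mu> ((- A) \<inter> K))"


section \<open>Kernels and energy\<close>

definition is_kernel :: "('a::topological_space \<Rightarrow> 'a \<Rightarrow> ennreal) \<Rightarrow> bool" where
  "is_kernel \<kappa> \<longleftrightarrow> (\<forall>x y. \<kappa> x y = \<kappa> y x) \<and> (\<forall>a. open {p. a < \<kappa> (fst p) (snd p)})"

definition potential :: "('a::topological_space \<Rightarrow> 'a \<Rightarrow> ennreal) \<Rightarrow> 'a radon \<Rightarrow> 'a \<Rightarrow> ereal" where
  "potential \<kappa> \<mu> x = signed_integral \<mu> (\<lambda>y. \<kappa> x y)"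

definition energy_defined ::
  "('a::topological_space \<Rightarrow> 'a \<Rightarrow> ennreal) \<Rightarrow> 'a radon \<Rightarrow> 'a radon \<Rightarrow> bool" where
  "energy_defined \<kappa> \<mu> \<nu> \<longleftrightarrow> signed_integral_defined (product_radon \<mu> \<nu>) (\<lambda>(x, y). \<kappa> x y)"

definition energy ::
  "('a::topological_space \<Rightarrow> 'a \<Rightarrow> ennreal) \<Rightarrow> 'a radon \<Rightarrow> 'a radon \<Rightarrow> ereal" where
  "energy \<kappa> \<mu> \<nu> = signed_integral (product_radon \<mu> \<nu>) (\<lambda>(x, y). \<kappa> x y)"

definition finite_energy :: "('a::topological_space \<Rightarrow> 'a \<Rightarrow> ennreal) \<Rightarrow> 'a radon set" where
  "finite_energy \<kappa> = {\<mu>. energy_defined \<kappa> \<mu> \<mu> \<and> \<bar>energy \<kappa> \<mu> \<mu>\<bar> < \<infinity>}"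

definition finite_energy_pos :: "('a::topological_space \<Rightarrow> 'a \<Rightarrow> ennreal) \<Rightarrow> 'a radon set" where
  "finite_energy_pos \<kappa> = finite_energy \<kappa> \<inter> positive_radon"

definition energy_norm :: "('a::topological_space \<Rightarrow> 'a \<Rightarrow> ennreal) \<Rightarrow> 'a radon \<Rightarrow> real" where
  "energy_norm \<kappa> \<mu> = sqrt (real_of_ereal (energy \<kappa> \<mu> \<mu>))"

definition energy_principle :: "('a::topological_space \<Rightarrow> 'a \<Rightarrow> ennreal) \<Rightarrow> bool" where
  "energy_principle \<kappa> \<longleftrightarrow>
     (\<forall>\<mu>. energy_defined \<kappa> \<mu> \<mu> \<longrightarrow> 0 \<le> energy \<kappa> \<mu> \<mu> \<and> (energy \<kappa> \<mu> \<mu> = 0 \<longrightarrow> \<mu> = 0))"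

text \<open>
  Nets are represented by proper filters on the space of measures: a net corresponds to the filter
  generated by its tails, and every proper filter arises in this way.
\<close>

definition strong_Cauchy ::
  "('a::topological_space \<Rightarrow> 'a \<Rightarrow> ennreal) \<Rightarrow> 'a radon filter \<Rightarrow> bool" where
  "strong_Cauchy \<kappa> F \<longleftrightarrow>
     (\<forall>e>0. eventually (\<lambda>(\<mu>, \<nu>). energy_norm \<kappa> (\<mu> - \<nu>) < e) (F \<times>\<^sub>F F))"

definition vague_cluster_point :: "'a::topological_space radon filter \<Rightarrow> 'a radon \<Rightarrow> bool" where
  "vague_cluster_point F \<mu> \<longleftrightarrow>
     (\<forall>U. openin vague_topology U \<and> \<mu> \<in> U \<longrightarrow> frequently (\<lambda>\<nu>. \<nu> \<in> U) F)"

definition consistency_principle :: "('a::topological_space \<Rightarrow> 'a \<Rightarrow> ennreal) \<Rightarrow> bool" where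
  "consistency_principle \<kappa> \<longleftrightarrow>
     (\<forall>F \<mu>. F \<noteq> bot \<and> eventually (\<lambda>\<nu>. \<nu> \<in> finite_energy_pos \<kappa>) F \<and> strong_Cauchy \<kappa> F \<and>
        vague_cluster_point F \<mu> \<longrightarrow>
        \<mu> \<in> finite_energy \<kappa> \<and> ((\<lambda>\<nu>. energy_norm \<kappa> (\<nu> - \<mu>)) \<longlongrightarrow> 0) F)"

definition domination_principle :: "('a::topological_space \<Rightarrow> 'a \<Rightarrow> ennreal) \<Rightarrow> bool" where
  "domination_principle \<kappa> \<longleftrightarrow>
     (\<forall>\<mu>\<in>finite_energy_pos \<kappa>. \<forall>\<nu>\<in>finite_energy_pos \<kappa>.
        negligible_for \<mu> {x. \<not> potential \<kappa> \<mu> x \<le> potential \<kappa> \<nu> x} \<longrightarrow>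
        (\<forall>x. potential \<kappa> \<mu> x \<le> potential \<kappa> \<nu> x))"


section \<open>Inner capacity and inner balayage\<close>

text \<open>On \<open>ereal\<close>: \<open>inverse 0 = \<infinity>\<close>, \<open>inverse \<infinity> = 0\<close>, and the infimum of the empty set is \<open>\<infinity>\<close>.\<close>

definition inner_capacity ::
  "('a::topological_space \<Rightarrow> 'a \<Rightarrow> ennreal) \<Rightarrow> 'a set \<Rightarrow> ereal" where
  "inner_capacity \<kappa> A =
     inverse (INF \<mu>\<in>{\<mu>\<in>finite_energy_pos \<kappa>. concentrated_on \<mu> A \<and> total_mass \<mu> = 1}. energy \<kappa> \<mu> \<mu>)"

definition nearly_everywhere_on ::
  "('a::topological_space \<Rightarrow> 'a \<Rightarrow> ennreal) \<Rightarrow> 'a set \<Rightarrow> ('a \<Rightarrow> bool) \<Rightarrow> bool" where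
  "nearly_everywhere_on \<kappa> A P \<longleftrightarrow> (\<exists>E\<subseteq>A. inner_capacity \<kappa> E = 0 \<and> (\<forall>x\<in>A - E. P x))"

definition balayage_class ::
  "('a::topological_space \<Rightarrow> 'a \<Rightarrow> ennreal) \<Rightarrow> 'a set \<Rightarrow> 'a radon \<Rightarrow> 'a radon set" where
  "balayage_class \<kappa> A \<mu> =
     {\<nu>\<in>finite_energy_pos \<kappa>. nearly_everywhere_on \<kappa> A (\<lambda>x. potential \<kappa> \<nu> x \<ge> potential \<kappa> \<mu> x)}"

definition inner_balayage_pos ::
  "('a::topological_space \<Rightarrow> 'a \<Rightarrow> ennreal) \<Rightarrow> 'a set \<Rightarrow> 'a radon \<Rightarrow> 'a radon" where
  "inner_balayage_pos \<kappa> A \<mu> =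
     (THE \<beta>. \<beta> \<in> balayage_class \<kappa> A \<mu> \<and>
        (\<forall>\<nu>\<in>balayage_class \<kappa> A \<mu>. \<forall>x. potential \<kappa> \<beta> x \<le> potential \<kappa> \<nu> x))"

definition inner_balayage ::
  "('a::topological_space \<Rightarrow> 'a \<Rightarrow> ennreal) \<Rightarrow> 'a set \<Rightarrow> 'a radon \<Rightarrow> 'a radon" where
  "inner_balayage \<kappa> A \<mu> =
     inner_balayage_pos \<kappa> A (pos_part \<mu>) - inner_balayage_pos \<kappa> A (neg_part \<mu>)"

end

theory Submission
  imports Defs
begin

text \<open>
  The inner balayage \<open>\<mu>\<^sup>A\<close> of a positive \<open>\<mu>\<close> is an orthogonal projection, and the symmetry relation is
  the self-adjointness of that projection. The work lies in setting up the geometry.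

  \<^bold>\<open>Geometry.\<close> The energy principle makes mutual energies of measures of finite energy finite
  (\<open>mutual_finite\<close>) and turns \<open>\<E>\<close> into a pre-Hilbert space. Since the kernel is bounded away from zero near
  each point of the diagonal, strongly bounded sets of positive measures are vaguely bounded,
  hence vaguely relatively compact by Tychonoff's theorem, and the consistency principle makes \<open>\<E>\<^sup>+\<close>
  strongly complete (\<open>Epos_complete\<close>). So \<open>\<mu>\<close> has a projection \<open>P\<close> onto the strong closure of the convex
  cone of those measures in \<open>\<E>\<^sup>+\<close> that are carried by compact subsets of \<open>A\<close> (\<open>cone_minimizing\<close>).

  \<^bold>\<open>The projection is the balayage.\<close> The variational inequality \<open>\<kappa>(\<mu> - P, \<tau>) \<le> 0\<close> on the cone
  says that \<open>\<kappa>P \<ge> \<kappa>\<mu>\<close> nearly everywhere on \<open>A\<close> (\<open>variational_imp_null\<close>). If \<open>\<nu>\<close> is a competitor and \<open>A\<close> is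
  compact, then orthogonality gives \<open>\<kappa>P = \<kappa>\<mu> \<le> \<kappa>\<nu>\<close> almost everywhere for \<open>P\<close>, and the domination
  principle gives \<open>\<kappa>P \<le> \<kappa>\<nu>\<close> everywhere (\<open>compact_projection_minimal\<close>). In general \<open>P\<close> is a strong and
  vague limit of the projections belonging to compact subsets of \<open>A\<close>, and the bound passes to the
  limit because integrals of lower semicontinuous functions are vaguely lower semicontinuous
  (\<open>balayage_exists\<close>).

  \<^bold>\<open>Symmetry.\<close> As \<open>\<mu>\<close> competes with \<open>\<mu>\<^sup>A\<close>, also \<open>\<kappa>\<mu>\<^sup>A \<le> \<kappa>\<mu>\<close>; so \<open>\<mu>\<^sup>A\<close> and \<open>\<mu>\<close> have the same mutual energy
  with every measure in the cone, and in the limit with \<open>\<nu>\<^sup>A\<close>. Hence \<open>\<kappa>(\<mu>\<^sup>A, \<nu>\<^sup>A) = \<kappa>(\<mu>, \<nu>\<^sup>A)\<close>, and the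
  left side is symmetric in \<open>\<mu>\<close> and \<open>\<nu>\<close>. The case of signed measures follows by bilinearity. Uniqueness:
  a \<open>\<xi>\<close> with the same mutual energies as \<open>\<mu>\<^sup>A\<close> satisfies \<open>\<kappa>(\<xi> - \<mu>\<^sup>A, \<xi> - \<mu>\<^sup>A) = 0\<close>.

  \<^bold>\<open>Foundations.\<close> Measures are functionals on a space that need not be \<open>\<sigma>\<close>-compact or second countable. Identities for
  lower semicontinuous integrands are derived from a Dini theorem for directed families
  (\<open>lsc_integral_le_SUP_directed\<close>), which in particular yields Tonelli's theorem for the kernel; almost
  everywhere arguments use the Borel measure that Caratheodory's construction attaches to a positive
  functional. Two facts link the signed measures in \<open>\<E>\<close> with their positive parts: a measure on the
  square is determined by its values on products \<open>f(x) g(y)\<close> (\<open>radon_prod_eqI\<close>), and the positive part of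
  \<open>\<mu> \<otimes> \<mu>\<close> dominates \<open>\<mu>\<^sup>+ \<otimes> \<mu>\<^sup>+ + \<mu>\<^sup>- \<otimes> \<mu>\<^sup>-\<close> (\<open>pos_part_product_ge\<close>).
\<close>

section \<open>Compactly supported continuous functions\<close>

lemma Hausdorff_euclidean: "Hausdorff_space (euclidean :: 'a::t2_space topology)"
  unfolding Hausdorff_space_def by (simp add: open_openin[symmetric] disjnt_def) (metis hausdorff)

lemma Cc_iff:
  fixes f :: "'a::t2_space \<Rightarrow> real"
  shows "f \<in> Cc \<longleftrightarrow> continuous_on UNIV f \<and> (\<exists>K. compact K \<and> (\<forall>x. x \<notin> K \<longrightarrow> f x = 0))"
proof
  assume "f \<in> Cc"
  then show "continuous_on UNIV f \<and> (\<exists>K. compact K \<and> (\<forall>x. x \<notin> K \<longrightarrow> f x = 0))"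
    unfolding Cc_def using closure_subset[of "{x. f x \<noteq> 0}"]
    by (auto intro!: exI[of _ "closure {x. f x \<noteq> 0}"])
next
  assume *: "continuous_on UNIV f \<and> (\<exists>K. compact K \<and> (\<forall>x. x \<notin> K \<longrightarrow> f x = 0))"
  then obtain K where K: "compact K" "\<forall>x. x \<notin> K \<longrightarrow> f x = 0" by blast
  have "closure {x. f x \<noteq> 0} \<subseteq> K"
    using K by (intro closure_minimal compact_imp_closed) auto
  then have "compact (closure {x. f x \<noteq> 0})"
    using K(1) by (metis closed_closure compact_Int_closed inf.absorb2)
  then show "f \<in> Cc" using * by (simp add: Cc_def)
qed

lemma Cc_cont: "f \<in> Cc \<Longrightarrow> continuous_on UNIV f"
  by (simp add: Cc_def)

lemma Cc_support:
  fixes f :: "'a::t2_space \<Rightarrow> real"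
  assumes "f \<in> Cc"
  obtains K where "compact K" "\<And>x. x \<notin> K \<Longrightarrow> f x = 0"
  using assms Cc_iff by blast

lemma Cc_comp2:
  fixes f g :: "'a::t2_space \<Rightarrow> real"
  assumes "f \<in> Cc" "g \<in> Cc" "continuous_on UNIV (\<lambda>x. h (f x) (g x))" "h 0 0 = 0"
  shows "(\<lambda>x. h (f x) (g x)) \<in> Cc"
proof -
  obtain K where K: "compact K" "\<And>x. x \<notin> K \<Longrightarrow> f x = 0" using Cc_support[OF assms(1)] by blast
  obtain L where L: "compact L" "\<And>x. x \<notin> L \<Longrightarrow> g x = 0" using Cc_support[OF assms(2)] by blast
  show ?thesis unfolding Cc_iff
    using assms K L by (intro conjI exI[of _ "K \<union> L"]) auto
qed

lemma Cc_zero [simp]: "(\<lambda>_. 0) \<in> Cc"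
  by (auto simp: Cc_def)

lemma Cc_add [simp]:
  fixes f g :: "'a::t2_space \<Rightarrow> real"
  shows "f \<in> Cc \<Longrightarrow> g \<in> Cc \<Longrightarrow> (\<lambda>x. f x + g x) \<in> Cc"
  by (rule Cc_comp2[where f=f and g=g and h="(+)"]) (auto intro!: continuous_intros dest: Cc_cont)

lemma Cc_diff [simp]:
  fixes f g :: "'a::t2_space \<Rightarrow> real"
  shows "f \<in> Cc \<Longrightarrow> g \<in> Cc \<Longrightarrow> (\<lambda>x. f x - g x) \<in> Cc"
  by (rule Cc_comp2[where f=f and g=g and h="(-)"]) (auto intro!: continuous_intros dest: Cc_cont)

lemma Cc_min [simp]:
  fixes f g :: "'a::t2_space \<Rightarrow> real"
  shows "f \<in> Cc \<Longrightarrow> g \<in> Cc \<Longrightarrow> (\<lambda>x. min (f x) (g x)) \<in> Cc"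
  by (rule Cc_comp2[where f=f and g=g and h="min"]) (auto intro!: continuous_intros dest: Cc_cont)

lemma Cc_max [simp]:
  fixes f g :: "'a::t2_space \<Rightarrow> real"
  shows "f \<in> Cc \<Longrightarrow> g \<in> Cc \<Longrightarrow> (\<lambda>x. max (f x) (g x)) \<in> Cc"
  by (rule Cc_comp2[where f=f and g=g and h="max"]) (auto intro!: continuous_intros dest: Cc_cont)

lemma Cc_mult [simp]:
  fixes f g :: "'a::t2_space \<Rightarrow> real"
  shows "f \<in> Cc \<Longrightarrow> g \<in> Cc \<Longrightarrow> (\<lambda>x. f x * g x) \<in> Cc"
  by (rule Cc_comp2[where f=f and g=g and h="(*)"]) (auto intro!: continuous_intros dest: Cc_cont)

lemma Cc_cmult [simp]:
  fixes f :: "'a::t2_space \<Rightarrow> real"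
  shows "f \<in> Cc \<Longrightarrow> (\<lambda>x. c * f x) \<in> Cc"
  by (rule Cc_comp2[where f=f and g=f and h="\<lambda>a b. c * a"]) (auto intro!: continuous_intros dest: Cc_cont)

lemma Cc_bounded:
  fixes f :: "'a::t2_space \<Rightarrow> real"
  assumes "f \<in> Cc"
  obtains B where "0 < B" "\<And>x. \<bar>f x\<bar> \<le> B"
proof -
  obtain K where K: "compact K" "\<And>x. x \<notin> K \<Longrightarrow> f x = 0" using Cc_support[OF assms] by blast
  have "bounded (f ` K)"
    using K(1) Cc_cont[OF assms]
    by (metis compact_imp_bounded compact_continuous_image continuous_on_subset subset_UNIV)
  then obtain B where B: "\<And>x. x \<in> K \<Longrightarrow> \<bar>f x\<bar> \<le> B" unfolding bounded_iff by auto
  show thesis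
  proof (rule that[of "max B 1"])
    show "\<bar>f x\<bar> \<le> max B 1" for x using B[of x] K(2)[of x] by (cases "x \<in> K") auto
  qed simp
qed

text \<open>
  The type argument of the locale allows its results to be used for the space itself and for its
  square.
\<close>

locale locally_compact_Hausdorff =
  fixes T :: "'a::t2_space itself"
  assumes lc: "locally_compact_space (euclidean :: 'a topology)"
begin

lemma compact_nbhd:
  fixes x :: 'a
  assumes "open U" "x \<in> U"
  obtains V C where "open V" "compact C" "x \<in> V" "V \<subseteq> C" "C \<subseteq> U"
proof -
  have "neighbourhood_base_of (compactin euclidean) (euclidean :: 'a topology)"
    using lc locally_compact_space_neighbourhood_base[of "euclidean :: 'a topology"]
    by (simp add: Hausdorff_euclidean)
  then have "\<exists>V C. open V \<and> compact C \<and> x \<in> V \<and> V \<subseteq> C \<and> C \<subseteq> U"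
    using assms unfolding neighbourhood_base_of by (simp add: open_openin[symmetric])
  then show thesis using that by blast
qed

text \<open>
  Urysohn's lemma in the form in which it is used throughout: the cutoff function not only vanishes
  off \<open>U\<close> but has its support inside \<open>U\<close>, which leaves room to work near the boundary of \<open>U\<close>.
\<close>

lemma Urysohn_Cc:
  fixes K U :: "'a set"
  assumes "compact K" "open U" "K \<subseteq> U"
  obtains g C where "g \<in> Cc" "\<And>x. 0 \<le> g x" "\<And>x. g x \<le> 1" "\<And>x. x \<in> K \<Longrightarrow> g x = 1"
    "compact C" "C \<subseteq> U" "\<And>x. x \<notin> C \<Longrightarrow> g x = 0"
proof -
  define \<V> where "\<V> = {V. open V \<and> (\<exists>C. compact C \<and> V \<subseteq> C \<and> C \<subseteq> U)}"
  have cov: "K \<subseteq> \<Union>\<V>"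
  proof
    fix x assume "x \<in> K"
    then have "x \<in> U" using assms(3) by blast
    obtain V C where "open V" "compact C" "x \<in> V" "V \<subseteq> C" "C \<subseteq> U"
      by (rule compact_nbhd[OF assms(2) \<open>x \<in> U\<close>])
    then show "x \<in> \<Union>\<V>" unfolding \<V>_def by blast
  qed
  obtain \<D> where D: "\<D> \<subseteq> \<V>" "finite \<D>" "K \<subseteq> \<Union>\<D>"
    using compactE[OF assms(1) cov] unfolding \<V>_def by blast
  have "\<exists>C. \<forall>V\<in>\<D>. compact (C V) \<and> V \<subseteq> C V \<and> C V \<subseteq> U"
    using D(1) unfolding \<V>_def by (intro bchoice) blast
  then obtain C where C': "\<And>V. V \<in> \<D> \<Longrightarrow> compact (C V) \<and> V \<subseteq> C V \<and> C V \<subseteq> U" by blast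
  let ?V = "\<Union>\<D>" and ?C = "\<Union>V\<in>\<D>. C V"
  have C: "compact ?C" "?C \<subseteq> U" using D(2) C' by (auto intro!: compact_UN)
  have V: "open ?V" "?V \<subseteq> ?C" using D(1) C' unfolding \<V>_def by (auto intro!: open_Union) blast
  have cr: "completely_regular_space (euclidean :: 'a topology)"
    by (rule locally_compact_regular_imp_completely_regular_space[OF lc]) (simp add: Hausdorff_euclidean)
  have 1: "closedin euclidean (- ?V)" "compactin euclidean K" "disjnt (- ?V) K"
    using V D assms by (auto simp: disjnt_def closed_closedin[symmetric])
  obtain g where g: "continuous_map euclidean (subtopology euclidean {-1..0::real}) g"
    "g ` K \<subseteq> {-1}" "g ` (- ?V) \<subseteq> {0}"
    by (rule Urysohn_completely_regular_closed_compact[OF _ cr 1, of "-1" 0]) auto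
  have g': "continuous_on UNIV g" "\<And>x. -1 \<le> g x \<and> g x \<le> 0"
    using g(1) by (auto simp: continuous_map_in_subtopology)
  have gz: "- g x = 0" if "x \<notin> ?C" for x
  proof -
    have "x \<in> - ?V" using that V(2) by blast
    then show ?thesis using g(3) by auto
  qed
  show thesis
  proof (rule that[of "\<lambda>x. - g x" ?C])
    show "(\<lambda>x. - g x) \<in> Cc"
      unfolding Cc_iff using g' C(1) gz by (intro conjI exI[of _ ?C]) (auto intro!: continuous_intros)
    show "- g x = 1" if "x \<in> K" for x using that g(2) by force
  qed (use g' C gz in \<open>auto simp: minus_le_iff\<close>)
qed

lemma cutoff:
  fixes K :: "'a set"
  assumes "compact K"
  obtains g where "g \<in> Cc" "\<And>x. 0 \<le> g x" "\<And>x. g x \<le> 1" "\<And>x. x \<in> K \<Longrightarrow> g x = 1"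
  using Urysohn_Cc[OF assms open_UNIV subset_UNIV] that by metis

lemma Cc_cutoff:
  fixes f :: "'a \<Rightarrow> real"
  assumes "f \<in> Cc"
  obtains g where "g \<in> Cc" "\<And>x. 0 \<le> g x" "\<And>x. g x \<le> 1" "\<And>x. f x \<noteq> 0 \<Longrightarrow> g x = 1"
  using Cc_support[OF assms] cutoff by metis

end

section \<open>Radon measures and the Hahn--Jordan decomposition\<close>

lemma integ_add: "f \<in> Cc \<Longrightarrow> g \<in> Cc \<Longrightarrow> integ \<mu> (\<lambda>x. f x + g x) = integ \<mu> f + integ \<mu> g"
  and integ_cmult: "f \<in> Cc \<Longrightarrow> integ \<mu> (\<lambda>x. c * f x) = c * integ \<mu> f"
  for \<mu> :: "'a::t2_space radon"
proof -
  have "\<exists>P Q. positive_functional P \<and> positive_functional Q \<and> (\<forall>f\<in>Cc. integ \<mu> f = P f - Q f)"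
    using integ[of \<mu>] by blast
  then obtain P Q where PQ: "positive_functional P" "positive_functional Q" "\<forall>f\<in>Cc. integ \<mu> f = P f - Q f"
    by blast
  show "integ \<mu> (\<lambda>x. f x + g x) = integ \<mu> f + integ \<mu> g" if "f \<in> Cc" "g \<in> Cc"
    using PQ that by (simp add: positive_functional_def)
  show "integ \<mu> (\<lambda>x. c * f x) = c * integ \<mu> f" if "f \<in> Cc"
    using PQ that by (simp add: positive_functional_def right_diff_distrib)
qed

lemma integ_diff: 
  fixes \<mu> :: "'a::t2_space radon"
  assumes "f \<in> Cc" "g \<in> Cc"
  shows "integ \<mu> (\<lambda>x. f x - g x) = integ \<mu> f - integ \<mu> g"
  using integ_add[of f "\<lambda>x. -1 * g x" \<mu>] integ_cmult[of g \<mu> "-1"] assms Cc_cmult[of g "-1"] by simp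

lemma integ_outside: "f \<notin> Cc \<Longrightarrow> integ \<mu> f = 0"
  using integ[of \<mu>] by blast

lemma integ_zero_fun [simp]: "integ (\<mu> :: 'a::t2_space radon) (\<lambda>_. 0) = 0"
  using integ_cmult[of "\<lambda>_. 0" \<mu> 0] by simp

lemma integ_zero [simp]: "integ 0 f = 0"
  by transfer simp

lemma integ_plus [simp]: "integ (\<mu> + \<nu>) f = integ \<mu> f + integ \<nu> f"
  by transfer simp

lemma integ_scale [simp]: "integ (c *\<^sub>R \<mu>) f = c * integ \<mu> f"
  by transfer simp

lemma integ_uminus [simp]: "integ (- \<mu>) f = - integ \<mu> f"
  unfolding uminus_radon_def by (rule trans[OF integ_scale]) simp

lemma integ_minus [simp]: "integ (\<mu> - \<nu>) f = integ \<mu> f - integ \<nu> f"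
  unfolding minus_radon_def by (rule trans[OF integ_plus]) simp

lemma radon_eqI:
  fixes \<mu> \<nu> :: "'a::t2_space radon"
  assumes "\<And>f. f \<in> Cc \<Longrightarrow> (\<And>x. 0 \<le> f x) \<Longrightarrow> integ \<mu> f = integ \<nu> f"
  shows "\<mu> = \<nu>"
proof -
  have "integ \<mu> f = integ \<nu> f" for f
  proof (cases "f \<in> Cc")
    case True
    let ?p = "\<lambda>x. max (f x) 0" and ?n = "\<lambda>x. max (-1 * f x) 0"
    have C: "?p \<in> Cc" "?n \<in> Cc"
      using True by (intro Cc_max Cc_cmult Cc_zero; assumption)+
    have "integ \<rho> f = integ \<rho> ?p - integ \<rho> ?n" for \<rho> :: "'a radon"
    proof -
      have "f = (\<lambda>x. ?p x - ?n x)" by (auto simp: fun_eq_iff max_def)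
      then show ?thesis using integ_diff[OF C] by metis
    qed
    moreover have "integ \<mu> ?p = integ \<nu> ?p" "integ \<mu> ?n = integ \<nu> ?n"
      using C by (intro assms; simp)+
    ultimately show ?thesis by simp
  qed (simp add: integ_outside)
  then show ?thesis by (metis ext integ_inject)
qed

lemma positive_radonD: "\<mu> \<in> positive_radon \<Longrightarrow> f \<in> Cc \<Longrightarrow> (\<And>x. 0 \<le> f x) \<Longrightarrow> 0 \<le> integ \<mu> f"
  by (auto simp: positive_radon_def)

lemma positive_radonI: "(\<And>f. f \<in> Cc \<Longrightarrow> (\<And>x. 0 \<le> f x) \<Longrightarrow> 0 \<le> integ \<mu> f) \<Longrightarrow> \<mu> \<in> positive_radon"
  by (auto simp: positive_radon_def)

lemma positive_radon_zero [simp]: "0 \<in> positive_radon"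
  and positive_radon_add [simp]: "\<mu> \<in> positive_radon \<Longrightarrow> \<nu> \<in> positive_radon \<Longrightarrow> \<mu> + \<nu> \<in> positive_radon"
  and positive_radon_scale [simp]: "0 \<le> c \<Longrightarrow> \<mu> \<in> positive_radon \<Longrightarrow> c *\<^sub>R \<mu> \<in> positive_radon"
  by (auto simp: positive_radon_def)

lemma integ_mono:
  fixes \<mu> :: "'a::t2_space radon"
  assumes "\<mu> \<in> positive_radon" "f \<in> Cc" "g \<in> Cc" "\<And>x. f x \<le> g x"
  shows "integ \<mu> f \<le> integ \<mu> g"
  using positive_radonD[OF assms(1), of "\<lambda>x. g x - f x"] assms by (simp add: integ_diff)

lemma integ_abs_le:
  fixes \<mu> :: "'a::t2_space radon"
  assumes "\<mu> \<in> positive_radon" "f \<in> Cc" "g \<in> Cc" "\<And>x. \<bar>f x\<bar> \<le> g x"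
  shows "\<bar>integ \<mu> f\<bar> \<le> integ \<mu> g"
proof -
  have "integ \<mu> f \<le> integ \<mu> g" using assms by (intro integ_mono) (auto intro: order_trans[OF abs_ge_self])
  moreover have "integ \<mu> (\<lambda>x. -1 * f x) \<le> integ \<mu> g"
    using assms Cc_cmult[OF assms(2), of "-1"] by (intro integ_mono) (auto simp: abs_le_iff)
  ultimately show ?thesis using assms integ_cmult[of f \<mu> "-1"] by simp
qed

lemma radon_of_functional:
  assumes "positive_functional I"
  obtains \<rho> :: "'a::t2_space radon" where "\<rho> \<in> positive_radon" "\<And>f. f \<in> Cc \<Longrightarrow> integ \<rho> f = I f"
proof -
  let ?J = "\<lambda>f. if f \<in> Cc then I f else 0"
  have *: "integ (Abs_radon ?J) = ?J"
  proof (rule Abs_radon_inverse, clarsimp, intro exI conjI)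
    show "positive_functional I" "positive_functional (\<lambda>_. 0)"
      using assms positive_functional_zero by auto
  qed simp
  show thesis
  proof (rule that[of "Abs_radon ?J"])
    show "Abs_radon ?J \<in> positive_radon"
      using assms unfolding positive_radon_def by (auto simp: * positive_functional_def)
  qed (simp add: *)
qed

text \<open>
  An additive and positively homogeneous map on the cone of nonnegative functions extends to a
  positive functional: put \<open>I f = \<phi> f\<^sup>+ - \<phi> f\<^sup>-\<close>; additivity of \<open>I\<close> follows from
  \<open>(f + g)\<^sup>+ + f\<^sup>- + g\<^sup>- = (f + g)\<^sup>- + f\<^sup>+ + g\<^sup>+\<close>.
\<close>

lemma radon_of_cone:
  fixes \<phi> :: "('a::t2_space \<Rightarrow> real) \<Rightarrow> real"
  assumes add: "\<And>f g. f \<in> Cc \<Longrightarrow> g \<in> Cc \<Longrightarrow> (\<And>x. 0 \<le> f x) \<Longrightarrow> (\<And>x. 0 \<le> g x) \<Longrightarrow>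
      \<phi> (\<lambda>x. f x + g x) = \<phi> f + \<phi> g"
    and scale: "\<And>f c. f \<in> Cc \<Longrightarrow> (\<And>x. 0 \<le> f x) \<Longrightarrow> 0 \<le> c \<Longrightarrow> \<phi> (\<lambda>x. c * f x) = c * \<phi> f"
    and pos: "\<And>f. f \<in> Cc \<Longrightarrow> (\<And>x. 0 \<le> f x) \<Longrightarrow> 0 \<le> \<phi> f"
  obtains \<rho> where "\<rho> \<in> positive_radon" "\<And>f. f \<in> Cc \<Longrightarrow> (\<And>x. 0 \<le> f x) \<Longrightarrow> integ \<rho> f = \<phi> f"
proof -
  define I where "I f = \<phi> (\<lambda>x. max (f x) 0) - \<phi> (\<lambda>x. max (- f x) 0)" for f
  have C: "(\<lambda>x. max (f x) 0) \<in> Cc" "(\<lambda>x. max (- f x) 0) \<in> Cc" if "f \<in> Cc" for f :: "'a \<Rightarrow> real"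
    using that Cc_cmult[OF that, of "-1"] by simp_all
  have \<phi>0: "\<phi> (\<lambda>_. 0) = 0" using scale[of "\<lambda>_. 0" 0] by simp
  have add3: "\<phi> (\<lambda>x. a x + b x + c x) = \<phi> a + \<phi> b + \<phi> c"
    if "a \<in> Cc" "b \<in> Cc" "c \<in> Cc" "\<And>x. 0 \<le> a x" "\<And>x. 0 \<le> b x" "\<And>x. 0 \<le> c x" for a b c
    using that add[of "\<lambda>x. a x + b x" c] add[of a b] by simp
  have I\<phi>: "I f = \<phi> f" if "f \<in> Cc" "\<And>x. 0 \<le> f x" for f
    unfolding I_def using that \<phi>0 by (simp add: max_absorb1 max_absorb2)
  have "positive_functional I"
    unfolding positive_functional_def
  proof (intro conjI ballI impI allI)
    fix f g :: "'a \<Rightarrow> real" assume fg: "f \<in> Cc" "g \<in> Cc"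
    let ?h = "\<lambda>x. f x + g x"
    note C3 = C[OF fg(1)] C[OF fg(2)] C[OF Cc_add[OF fg]]
    have "\<phi> (\<lambda>x. (max (?h x) 0 + max (- f x) 0) + max (- g x) 0) =
        \<phi> (\<lambda>x. (max (- ?h x) 0 + max (f x) 0) + max (g x) 0)"
      by (rule arg_cong[where f=\<phi>]) (auto simp: fun_eq_iff max_def)
    then have "\<phi> (\<lambda>x. max (?h x) 0) + \<phi> (\<lambda>x. max (- f x) 0) + \<phi> (\<lambda>x. max (- g x) 0) =
        \<phi> (\<lambda>x. max (- ?h x) 0) + \<phi> (\<lambda>x. max (f x) 0) + \<phi> (\<lambda>x. max (g x) 0)"
      using C3 by (subst (asm) (1 2) add3) auto
    then show "I ?h = I f + I g" unfolding I_def by simp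
  next
    fix f :: "'a \<Rightarrow> real" and c :: real assume f: "f \<in> Cc"
    show "I (\<lambda>x. c * f x) = c * I f"
    proof (cases "0 \<le> c")
      case True
      have "(\<lambda>x. max (c * f x) 0) = (\<lambda>x. c * max (f x) 0)"
        "(\<lambda>x. max (- (c * f x)) 0) = (\<lambda>x. c * max (- f x) 0)"
        using True by (auto simp: fun_eq_iff max_mult_distrib_left)
      then show ?thesis unfolding I_def
        using True C[OF f] by (simp add: scale right_diff_distrib)
    next
      case False
      have "(\<lambda>x. max (c * f x) 0) = (\<lambda>x. (-c) * max (- f x) 0)"
        "(\<lambda>x. max (- (c * f x)) 0) = (\<lambda>x. (-c) * max (f x) 0)"
        using False by (auto simp: fun_eq_iff max_mult_distrib_left)
      then show ?thesis unfolding I_def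
        using False C[OF f] by (simp only:) (subst (1 2) scale, auto simp: algebra_simps)
    qed
  qed (use I\<phi> pos in auto)
  then obtain \<rho> :: "'a radon" where "\<rho> \<in> positive_radon" "\<And>f. f \<in> Cc \<Longrightarrow> integ \<rho> f = I f"
    using radon_of_functional by blast
  then show thesis using that[of \<rho>] I\<phi> by simp
qed

lemma radon_split:
  fixes \<mu> :: "'a::t2_space radon"
  obtains P Q where "P \<in> positive_radon" "Q \<in> positive_radon" "\<mu> = P - Q"
proof -
  have "\<exists>P Q. positive_functional P \<and> positive_functional Q \<and> (\<forall>f\<in>Cc. integ \<mu> f = P f - Q f)"
    using integ[of \<mu>] by blast
  then obtain P Q where PQ: "positive_functional P" "positive_functional Q" "\<forall>f\<in>Cc. integ \<mu> f = P f - Q f"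
    by blast
  obtain P' Q' :: "'a radon" where P': "P' \<in> positive_radon" "\<And>f. f \<in> Cc \<Longrightarrow> integ P' f = P f"
    and Q': "Q' \<in> positive_radon" "\<And>f. f \<in> Cc \<Longrightarrow> integ Q' f = Q f"
    using radon_of_functional[OF PQ(1)] radon_of_functional[OF PQ(2)] by metis
  have "\<mu> = P' - Q'" using PQ(3) P' Q' by (intro radon_eqI) simp
  then show thesis using that P' Q' by blast
qed

text \<open>
  The Riesz decomposition property makes the supremum defining \<open>\<mu>\<^sup>+\<close> additive: a minorant \<open>g\<close> of
  \<open>f\<^sub>1 + f\<^sub>2\<close> splits as \<open>min g f\<^sub>1\<close>, a minorant of \<open>f\<^sub>1\<close>, plus a remainder below \<open>f\<^sub>2\<close>.
\<close>

lemma pos_part_integ: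
  fixes \<mu> :: "'a::t2_space radon"
  shows pos_part_positive: "pos_part \<mu> \<in> positive_radon"
    and pos_part_SUP: "f \<in> Cc \<Longrightarrow> (\<And>x. 0 \<le> f x) \<Longrightarrow>
      integ (pos_part \<mu>) f = (SUP g\<in>{g\<in>Cc. \<forall>x. 0 \<le> g x \<and> g x \<le> f x}. integ \<mu> g)"
    and pos_part_bdd: "f \<in> Cc \<Longrightarrow> bdd_above (integ \<mu> ` {g\<in>Cc. \<forall>x. 0 \<le> g x \<and> g x \<le> f x})"
proof -
  obtain P Q where PQ: "P \<in> positive_radon" "Q \<in> positive_radon" "\<mu> = P - Q" by (rule radon_split)
  define S where "S f = {g\<in>Cc. \<forall>x. 0 \<le> g x \<and> g x \<le> f x}" for f :: "'a \<Rightarrow> real"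
  define \<phi> where "\<phi> f = (SUP g\<in>S f. integ \<mu> g)" for f
  have le: "integ \<mu> g \<le> integ P f" if "g \<in> S f" "f \<in> Cc" for f g
  proof -
    have "integ \<mu> g \<le> integ P g" using that PQ by (auto simp: S_def intro!: positive_radonD)
    also have "\<dots> \<le> integ P f" using that PQ by (auto simp: S_def intro!: integ_mono)
    finally show ?thesis .
  qed
  have bdd: "bdd_above (integ \<mu> ` S f)" if "f \<in> Cc" for f
    using le that by (auto simp: bdd_above_def)
  have z: "(\<lambda>_. 0) \<in> S f" if "\<And>x. 0 \<le> f x" for f using that by (auto simp: S_def)
  have up: "integ \<mu> g \<le> \<phi> f" if "g \<in> S f" "f \<in> Cc" for f g
    unfolding \<phi>_def using bdd that by (intro cSUP_upper)
  have least: "\<phi> f \<le> b" if "\<And>x. 0 \<le> f x" "\<And>g. g \<in> S f \<Longrightarrow> integ \<mu> g \<le> b" for f b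
    unfolding \<phi>_def using that z[of f] by (intro cSUP_least) blast+
  obtain \<rho> where \<rho>: "\<rho> \<in> positive_radon" "\<And>f. f \<in> Cc \<Longrightarrow> (\<And>x. 0 \<le> f x) \<Longrightarrow> integ \<rho> f = \<phi> f"
  proof (rule radon_of_cone[of \<phi>])
    fix f g :: "'a \<Rightarrow> real" assume fg: "f \<in> Cc" "g \<in> Cc" "\<And>x. 0 \<le> f x" "\<And>x. 0 \<le> g x"
    show "\<phi> (\<lambda>x. f x + g x) = \<phi> f + \<phi> g"
    proof (rule antisym)
      show "\<phi> (\<lambda>x. f x + g x) \<le> \<phi> f + \<phi> g"
      proof (rule least)
        fix h assume h: "h \<in> S (\<lambda>x. f x + g x)"
        have hC: "h \<in> Cc" "\<And>x. 0 \<le> h x" "\<And>x. h x \<le> f x + g x" using h by (auto simp: S_def)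
        let ?a = "\<lambda>x. min (h x) (f x)"
        have "?a \<in> S f" "(\<lambda>x. h x - ?a x) \<in> S g"
          using hC fg unfolding S_def by (auto simp: min_def algebra_simps intro!: Cc_diff Cc_min[unfolded min_def])
        from up[OF this(1)] up[OF this(2)] show "integ \<mu> h \<le> \<phi> f + \<phi> g"
          using fg hC by (simp add: integ_diff)
      qed (use fg in auto)
      have "\<phi> f \<le> \<phi> (\<lambda>x. f x + g x) - \<phi> g"
      proof (rule least)
        fix h assume h: "h \<in> S f"
        have "\<phi> g \<le> \<phi> (\<lambda>x. f x + g x) - integ \<mu> h"
        proof (rule least)
          fix k assume k: "k \<in> S g"
          have "(\<lambda>x. h x + k x) \<in> S (\<lambda>x. f x + g x)"
            using h k fg by (auto simp: S_def intro!: add_mono)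
          from up[OF this] show "integ \<mu> k \<le> \<phi> (\<lambda>x. f x + g x) - integ \<mu> h"
            using h k fg by (auto simp: S_def integ_add)
        qed (use fg in auto)
        then show "integ \<mu> h \<le> \<phi> (\<lambda>x. f x + g x) - \<phi> g" by simp
      qed (use fg in auto)
      then show "\<phi> f + \<phi> g \<le> \<phi> (\<lambda>x. f x + g x)" by simp
    qed
  next
    fix f :: "'a \<Rightarrow> real" and c :: real assume f: "f \<in> Cc" "\<And>x. 0 \<le> f x" and c: "0 \<le> c"
    have 1: "c * \<phi> f \<le> \<phi> (\<lambda>x. c * f x)" if c: "0 < c" and f: "f \<in> Cc" "\<And>x. 0 \<le> f x" for c f
    proof -
      have "\<phi> f \<le> \<phi> (\<lambda>x. c * f x) / c"
      proof (rule least)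
        fix g assume g: "g \<in> S f"
        then have "(\<lambda>x. c * g x) \<in> S (\<lambda>x. c * f x)" using c by (auto simp: S_def)
        from up[OF this] show "integ \<mu> g \<le> \<phi> (\<lambda>x. c * f x) / c"
          using g c f by (auto simp: S_def integ_cmult field_simps)
      qed (use f in auto)
      then show ?thesis using c by (simp add: field_simps)
    qed
    show "\<phi> (\<lambda>x. c * f x) = c * \<phi> f"
    proof (cases "c = 0")
      case True
      have "S (\<lambda>_. 0) = {\<lambda>_. 0}" by (auto simp: S_def fun_eq_iff intro: antisym)
      then show ?thesis using True by (simp add: \<phi>_def)
    next
      case False
      then have c: "0 < c" using \<open>0 \<le> c\<close> by simp
      have "inverse c * \<phi> (\<lambda>x. c * f x) \<le> \<phi> (\<lambda>x. inverse c * (c * f x))"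
        using c f by (intro 1) auto
      moreover have "(\<lambda>x. inverse c * (c * f x)) = f" using c by (auto simp: fun_eq_iff)
      ultimately have "\<phi> (\<lambda>x. c * f x) \<le> c * \<phi> f" using c by (simp add: field_simps)
      with 1[OF c f] show ?thesis by simp
    qed
  next
    fix f :: "'a \<Rightarrow> real" assume f: "f \<in> Cc" "\<And>x. 0 \<le> f x"
    show "0 \<le> \<phi> f" using up[OF z f(1)] f(2) by simp
  qed blast
  have "pos_part \<mu> = \<rho>"
    unfolding pos_part_def
  proof (rule the_equality)
    show "\<forall>f\<in>Cc. (\<forall>x. 0 \<le> f x) \<longrightarrow> integ \<rho> f = (SUP g\<in>{g \<in> Cc. \<forall>x. 0 \<le> g x \<and> g x \<le> f x}. integ \<mu> g)"
      using \<rho>(2) by (simp add: \<phi>_def S_def)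
  next
    fix \<rho>' assume "\<forall>f\<in>Cc. (\<forall>x. 0 \<le> f x) \<longrightarrow> integ \<rho>' f = (SUP g\<in>{g \<in> Cc. \<forall>x. 0 \<le> g x \<and> g x \<le> f x}. integ \<mu> g)"
    then show "\<rho>' = \<rho>" using \<rho>(2) by (intro radon_eqI) (simp add: \<phi>_def S_def)
  qed
  with \<rho> show "pos_part \<mu> \<in> positive_radon"
    and "f \<in> Cc \<Longrightarrow> (\<And>x. 0 \<le> f x) \<Longrightarrow>
      integ (pos_part \<mu>) f = (SUP g\<in>{g\<in>Cc. \<forall>x. 0 \<le> g x \<and> g x \<le> f x}. integ \<mu> g)"
    by (auto simp: \<phi>_def S_def)
  show "f \<in> Cc \<Longrightarrow> bdd_above (integ \<mu> ` {g\<in>Cc. \<forall>x. 0 \<le> g x \<and> g x \<le> f x})"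
    using bdd by (simp add: S_def)
qed

lemma pos_part_upper:
  fixes \<mu> :: "'a::t2_space radon"
  assumes "f \<in> Cc" "g \<in> Cc" "\<And>x. 0 \<le> g x" "\<And>x. g x \<le> f x"
  shows "integ \<mu> g \<le> integ (pos_part \<mu>) f"
proof -
  have "\<And>x. 0 \<le> f x" using assms(3,4) order_trans by blast
  then show ?thesis
    using assms by (simp add: pos_part_SUP) (intro cSUP_upper pos_part_bdd, auto)
qed

lemma pos_part_least:
  fixes \<mu> :: "'a::t2_space radon"
  assumes "f \<in> Cc" "\<And>x. 0 \<le> f x" "\<And>g. g \<in> Cc \<Longrightarrow> (\<And>x. 0 \<le> g x) \<Longrightarrow> (\<And>x. g x \<le> f x) \<Longrightarrow> integ \<mu> g \<le> b"
  shows "integ (pos_part \<mu>) f \<le> b"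
proof -
  have "(\<lambda>_. 0) \<in> {g\<in>Cc. \<forall>x. 0 \<le> g x \<and> g x \<le> f x}" using assms by auto
  then show ?thesis using assms by (simp add: pos_part_SUP) (rule cSUP_least, auto)
qed

lemma pos_part_approx:
  fixes \<mu> :: "'a::t2_space radon"
  assumes "f \<in> Cc" "\<And>x. 0 \<le> f x" "0 < e"
  obtains g where "g \<in> Cc" "\<And>x. 0 \<le> g x" "\<And>x. g x \<le> f x" "integ (pos_part \<mu>) f - e < integ \<mu> g"
proof -
  have "\<exists>g. g \<in> Cc \<and> (\<forall>x. 0 \<le> g x) \<and> (\<forall>x. g x \<le> f x) \<and> integ (pos_part \<mu>) f - e < integ \<mu> g"
  proof (rule ccontr)
    assume "\<not> ?thesis"
    then have *: "integ \<mu> g \<le> integ (pos_part \<mu>) f - e"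
      if "g \<in> Cc" "\<forall>x. 0 \<le> g x" "\<forall>x. g x \<le> f x" for g using that by (meson not_le)
    have "integ (pos_part \<mu>) f \<le> integ (pos_part \<mu>) f - e"
      by (rule pos_part_least[OF assms(1,2)]) (rule *, auto)
    then show False using assms(3) by linarith
  qed
  then show thesis using that by blast
qed

lemma neg_part_positive: "neg_part (\<mu> :: 'a::t2_space radon) \<in> positive_radon"
  by (simp add: neg_part_def pos_part_positive)

lemma pos_part_minus_neg_part:
  fixes \<mu> :: "'a::t2_space radon"
  shows "pos_part \<mu> - neg_part \<mu> = \<mu>"
proof (rule radon_eqI)
  fix f :: "'a \<Rightarrow> real" assume f: "f \<in> Cc" "\<And>x. 0 \<le> f x"
  have "integ (pos_part \<mu>) f \<le> integ \<mu> f + integ (neg_part \<mu>) f"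
  proof (rule pos_part_least[OF f])
    fix g assume g: "g \<in> Cc" "\<And>x. 0 \<le> g x" "\<And>x. g x \<le> f x"
    have "integ (- \<mu>) (\<lambda>x. f x - g x) \<le> integ (neg_part \<mu>) f"
      unfolding neg_part_def using f g by (intro pos_part_upper) auto
    then show "integ \<mu> g \<le> integ \<mu> f + integ (neg_part \<mu>) f" using f g by (simp add: integ_diff)
  qed
  moreover have "integ (neg_part \<mu>) f \<le> integ (pos_part \<mu>) f - integ \<mu> f"
    unfolding neg_part_def
  proof (rule pos_part_least[OF f])
    fix g assume g: "g \<in> Cc" "\<And>x. 0 \<le> g x" "\<And>x. g x \<le> f x"
    have "integ \<mu> (\<lambda>x. f x - g x) \<le> integ (pos_part \<mu>) f"
      using f g by (intro pos_part_upper) auto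
    then show "integ (- \<mu>) g \<le> integ (pos_part \<mu>) f - integ \<mu> f" using f g by (simp add: integ_diff)
  qed
  ultimately show "integ (pos_part \<mu> - neg_part \<mu>) f = integ \<mu> f" by simp
qed

text \<open>\<open>\<rho>\<^sup>+\<close> is the least positive measure \<open>P\<close> for which \<open>P - \<rho>\<close> is positive.\<close>

lemma pos_part_le:
  fixes P Q :: "'a::t2_space radon"
  assumes "P \<in> positive_radon" "Q \<in> positive_radon"
  shows "P - pos_part (P - Q) \<in> positive_radon"
proof (rule positive_radonI)
  fix f :: "'a \<Rightarrow> real" assume f: "f \<in> Cc" "\<And>x. 0 \<le> f x"
  have "integ (pos_part (P - Q)) f \<le> integ P f"
  proof (rule pos_part_least[OF f])
    fix g assume g: "g \<in> Cc" "\<And>x. 0 \<le> g x" "\<And>x. g x \<le> f x"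
    have "integ P g \<le> integ P f" using assms f g by (intro integ_mono)
    moreover have "0 \<le> integ Q g" using assms g by (intro positive_radonD)
    ultimately show "integ (P - Q) g \<le> integ P f" by simp
  qed
  then show "0 \<le> integ (P - pos_part (P - Q)) f" by simp
qed

lemma pos_part_of_positive: "\<mu> \<in> positive_radon \<Longrightarrow> pos_part \<mu> = \<mu>"
  and neg_part_of_positive: "\<mu> \<in> positive_radon \<Longrightarrow> neg_part \<mu> = 0"
  for \<mu> :: "'a::t2_space radon"
proof -
  assume \<mu>: "\<mu> \<in> positive_radon"
  have "integ (neg_part \<mu>) f = 0" if f: "f \<in> Cc" "\<And>x. 0 \<le> f x" for f
  proof (rule antisym)
    show "integ (neg_part \<mu>) f \<le> 0" unfolding neg_part_def
      using positive_radonD[OF \<mu>] by (intro pos_part_least[OF f]) auto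
  qed (use neg_part_positive f in \<open>auto intro: positive_radonD\<close>)
  then show 1: "neg_part \<mu> = 0" by (intro radon_eqI) auto
  show "pos_part \<mu> = \<mu>" using pos_part_minus_neg_part[of \<mu>] 1 by simp
qed

text \<open>
  Mutual singularity of the two parts. A nearly optimal \<open>g\<close> in the supremum defining \<open>\<mu>\<^sup>+(f)\<close> separates
  them, because \<open>\<mu>\<^sup>+(f) - e < \<mu>(g) = \<mu>\<^sup>+(g) - \<mu>\<^sup>-(g)\<close> and \<open>\<mu>\<^sup>+(g) \<le> \<mu>\<^sup>+(f)\<close>.
\<close>

lemma Jordan_singular:
  fixes \<mu> :: "'a::t2_space radon"
  assumes f: "f \<in> Cc" "\<And>x. 0 \<le> f x" and e: "0 < e"
  obtains g where "g \<in> Cc" "\<And>x. 0 \<le> g x" "\<And>x. g x \<le> f x"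
    "integ (neg_part \<mu>) g < e" "integ (pos_part \<mu>) (\<lambda>x. f x - g x) < e"
proof -
  obtain g where g: "g \<in> Cc" "\<And>x. 0 \<le> g x" "\<And>x. g x \<le> f x" "integ (pos_part \<mu>) f - e < integ \<mu> g"
    using pos_part_approx[OF assms] by blast
  have 1: "integ \<mu> g = integ (pos_part \<mu>) g - integ (neg_part \<mu>) g"
    by (metis pos_part_minus_neg_part integ_minus)
  have 2: "integ (pos_part \<mu>) g \<le> integ (pos_part \<mu>) f"
    using f g by (intro integ_mono pos_part_positive)
  have 3: "0 \<le> integ (neg_part \<mu>) g" using g by (intro positive_radonD neg_part_positive)
  show thesis
    using 1 2 3 g f by (intro that[of g]) (auto simp: integ_diff)
qed

section \<open>The integral of lower semicontinuous functions\<close>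

definition lsc :: "('a::topological_space \<Rightarrow> ennreal) \<Rightarrow> bool" where
  "lsc f \<longleftrightarrow> (\<forall>a. open {x. a < f x})"

definition minorants :: "('a::topological_space \<Rightarrow> ennreal) \<Rightarrow> ('a \<Rightarrow> real) set" where
  "minorants f = {g\<in>Cc. \<forall>x. 0 \<le> g x \<and> ennreal (g x) \<le> f x}"

lemma minorantsD:
  assumes "g \<in> minorants f"
  shows "g \<in> Cc" "0 \<le> g x" "ennreal (g x) \<le> f x"
  using assms by (auto simp: minorants_def)

lemma lsc_integral_minorants: "lsc_integral \<mu> f = (SUP g\<in>minorants f. ennreal (integ \<mu> g))"
  by (simp add: lsc_integral_def minorants_def)

lemma minorants_zero: "(\<lambda>_. 0) \<in> minorants f"
  by (simp add: minorants_def)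

lemma minorants_nonempty [simp]: "minorants f \<noteq> {}"
  using minorants_zero by blast

lemma minorants_max:
  fixes f :: "'a::t2_space \<Rightarrow> ennreal"
  shows "g \<in> minorants f \<Longrightarrow> h \<in> minorants f \<Longrightarrow> (\<lambda>x. max (g x) (h x)) \<in> minorants f"
  by (auto simp: minorants_def intro!: Cc_max) (auto simp: max_def)

lemma lsc_integral_upper: "g \<in> minorants f \<Longrightarrow> ennreal (integ \<mu> g) \<le> lsc_integral \<mu> f"
  unfolding lsc_integral_minorants by (rule SUP_upper)

lemma lsc_integral_mono: "(\<And>x. f x \<le> g x) \<Longrightarrow> lsc_integral \<mu> f \<le> lsc_integral \<mu> g"
  unfolding lsc_integral_minorants
  by (intro SUP_subset_mono) (auto simp: minorants_def intro: order_trans)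

lemma lsc_integral_Cc:
  fixes \<mu> :: "'a::t2_space radon"
  assumes "\<mu> \<in> positive_radon" "f \<in> Cc" "\<And>x. 0 \<le> f x"
  shows "lsc_integral \<mu> (\<lambda>x. ennreal (f x)) = ennreal (integ \<mu> f)"
proof (rule antisym)
  show "lsc_integral \<mu> (\<lambda>x. ennreal (f x)) \<le> ennreal (integ \<mu> f)"
    unfolding lsc_integral_minorants
  proof (rule SUP_least)
    fix g assume g: "g \<in> minorants (\<lambda>x. ennreal (f x))"
    have "g x \<le> f x" for x using minorantsD(3)[OF g, of x] assms(3)[of x] by (simp add: ennreal_le_iff)
    then show "ennreal (integ \<mu> g) \<le> ennreal (integ \<mu> f)"
      using assms minorantsD[OF g] by (intro ennreal_leI integ_mono)
  qed
  show "ennreal (integ \<mu> f) \<le> lsc_integral \<mu> (\<lambda>x. ennreal (f x))"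
    using assms by (intro lsc_integral_upper) (simp add: minorants_def)
qed

lemma lsc_integral_zero_fun [simp]: "lsc_integral \<mu> (\<lambda>_. 0) = 0" for \<mu> :: "'a::t2_space radon"
proof -
  have "g = (\<lambda>_. 0)" if "g \<in> minorants (\<lambda>_::'a. 0)" for g
  proof
    fix x show "g x = 0" using minorantsD(2,3)[OF that, of x] by (simp add: ennreal_eq_0_iff)
  qed
  then have "ennreal (integ \<mu> g) \<le> 0" if "g \<in> minorants (\<lambda>_::'a. 0)" for g
    using that by (metis ennreal_0 integ_zero_fun order_refl)
  then have "lsc_integral \<mu> (\<lambda>_. 0) \<le> 0"
    unfolding lsc_integral_minorants by (rule SUP_least)
  then show ?thesis by simp
qed

lemma lsc_integral_zero [simp]: "lsc_integral 0 f = 0"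
  unfolding lsc_integral_minorants by (simp add: image_constant_conv)

lemma lsc_const [simp]: "lsc (\<lambda>_. c)"
  by (auto simp: lsc_def)

lemma lsc_indicator: "open U \<Longrightarrow> lsc (indicator U)"
proof -
  assume "open U"
  moreover have "{x. a < (indicator U x :: ennreal)} = (if a < 1 then U else {})" for a
    by (auto simp: indicator_def not_less)
  ultimately show ?thesis by (simp add: lsc_def)
qed

lemma lsc_ennreal: "continuous_on UNIV g \<Longrightarrow> lsc (\<lambda>x. ennreal (g x))"
  unfolding lsc_def by (auto intro!: open_Collect_less continuous_on_ennreal)

lemma lsc_SUP: "(\<And>i. i \<in> I \<Longrightarrow> lsc (F i)) \<Longrightarrow> lsc (\<lambda>x. SUP i\<in>I. F i x)"
  unfolding lsc_def by (simp add: less_SUP_iff Collect_bex_eq open_UN)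

lemma SUP_add_le_ennreal:
  fixes F :: "'i \<Rightarrow> ennreal" and G :: "'j \<Rightarrow> ennreal"
  assumes "A \<noteq> {}" "B \<noteq> {}" "\<And>a b. a \<in> A \<Longrightarrow> b \<in> B \<Longrightarrow> F a + G b \<le> c"
  shows "(SUP a\<in>A. F a) + (SUP b\<in>B. G b) \<le> c"
proof -
  have "(SUP a\<in>A. F a) + (SUP b\<in>B. G b) = (SUP a\<in>A. F a + (SUP b\<in>B. G b))"
    using assms(1) by (simp add: ennreal_SUP_add_left)
  also have "\<dots> \<le> c"
  proof (rule SUP_least)
    fix a assume "a \<in> A"
    have "F a + (SUP b\<in>B. G b) = (SUP b\<in>B. F a + G b)"
      using assms(2) by (simp add: ennreal_SUP_add_right)
    also have "\<dots> \<le> c" using \<open>a \<in> A\<close> by (intro SUP_least assms(3))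
    finally show "F a + (SUP b\<in>B. G b) \<le> c" .
  qed
  finally show ?thesis .
qed

text \<open>
  The minorants of \<open>f\<close> form a directed set, so near-optimal minorants for \<open>\<mu>\<close> and for \<open>\<nu>\<close> are both
  dominated by their maximum.
\<close>

lemma lsc_integral_add_measure:
  fixes \<mu> \<nu> :: "'a::t2_space radon"
  assumes "\<mu> \<in> positive_radon" "\<nu> \<in> positive_radon"
  shows "lsc_integral (\<mu> + \<nu>) f = lsc_integral \<mu> f + lsc_integral \<nu> f"
proof (rule antisym)
  show "lsc_integral (\<mu> + \<nu>) f \<le> lsc_integral \<mu> f + lsc_integral \<nu> f"
    unfolding lsc_integral_minorants[of "\<mu> + \<nu>"]
  proof (rule SUP_least)
    fix g assume g: "g \<in> minorants f"
    have "ennreal (integ (\<mu> + \<nu>) g) = ennreal (integ \<mu> g) + ennreal (integ \<nu> g)"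
      using assms minorantsD[OF g] by (simp add: ennreal_plus positive_radonD)
    also have "\<dots> \<le> lsc_integral \<mu> f + lsc_integral \<nu> f" using g by (intro add_mono lsc_integral_upper)
    finally show "ennreal (integ (\<mu> + \<nu>) g) \<le> lsc_integral \<mu> f + lsc_integral \<nu> f" .
  qed
  show "lsc_integral \<mu> f + lsc_integral \<nu> f \<le> lsc_integral (\<mu> + \<nu>) f"
    unfolding lsc_integral_minorants[of \<mu>] lsc_integral_minorants[of \<nu>]
  proof (rule SUP_add_le_ennreal)
    fix g h assume g: "g \<in> minorants f" and h: "h \<in> minorants f"
    let ?m = "\<lambda>x. max (g x) (h x)"
    have m: "?m \<in> minorants f" using g h by (rule minorants_max)
    have "ennreal (integ \<mu> g) + ennreal (integ \<nu> h) \<le> ennreal (integ \<mu> ?m) + ennreal (integ \<nu> ?m)"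
      using assms minorantsD(1)[OF g] minorantsD(1)[OF h] by (intro add_mono ennreal_leI integ_mono) auto
    also have "\<dots> = ennreal (integ (\<mu> + \<nu>) ?m)"
      using assms minorantsD[OF m] by (simp add: ennreal_plus positive_radonD)
    also have "\<dots> \<le> lsc_integral (\<mu> + \<nu>) f" using m by (rule lsc_integral_upper)
    finally show "ennreal (integ \<mu> g) + ennreal (integ \<nu> h) \<le> lsc_integral (\<mu> + \<nu>) f" .
  qed auto
qed

lemma lsc_integral_scale_measure:
  fixes \<mu> :: "'a::t2_space radon"
  assumes "\<mu> \<in> positive_radon" "0 \<le> c"
  shows "lsc_integral (c *\<^sub>R \<mu>) f = ennreal c * lsc_integral \<mu> f"
  unfolding lsc_integral_minorants using assms
  by (simp add: SUP_mult_left_ennreal ennreal_mult positive_radonD minorantsD)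

lemma lsc_integral_mono_measure:
  fixes \<mu> \<nu> :: "'a::t2_space radon"
  assumes "\<mu> \<in> positive_radon" "\<nu> - \<mu> \<in> positive_radon"
  shows "lsc_integral \<mu> f \<le> lsc_integral \<nu> f"
proof -
  have "lsc_integral \<nu> f = lsc_integral (\<mu> + (\<nu> - \<mu>)) f" by simp
  also have "\<dots> = lsc_integral \<mu> f + lsc_integral (\<nu> - \<mu>) f"
    using assms by (rule lsc_integral_add_measure)
  finally show ?thesis by simp
qed

lemma lsc_integral_cmult:
  fixes \<mu> :: "'a::t2_space radon" and c :: real
  assumes "\<mu> \<in> positive_radon" "0 < c"
  shows "lsc_integral \<mu> (\<lambda>x. ennreal c * f x) = ennreal c * lsc_integral \<mu> f"
proof (rule antisym)
  have *: "ennreal c * lsc_integral \<mu> f \<le> lsc_integral \<mu> (\<lambda>x. ennreal c * f x)" if c: "0 < c" for c f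
    unfolding lsc_integral_minorants[of _ f] SUP_mult_left_ennreal
  proof (rule SUP_least)
    fix g assume g: "g \<in> minorants f"
    have "(\<lambda>x. c * g x) \<in> minorants (\<lambda>x. ennreal c * f x)"
      using minorantsD[OF g] c by (auto simp: minorants_def ennreal_mult intro!: mult_left_mono)
    then show "ennreal c * ennreal (integ \<mu> g) \<le> lsc_integral \<mu> (\<lambda>x. ennreal c * f x)"
      using lsc_integral_upper[of "\<lambda>x. c * g x" _ \<mu>] minorantsD[OF g] c
        positive_radonD[OF assms(1) minorantsD(1)[OF g] minorantsD(2)[OF g]]
      by (simp add: integ_cmult ennreal_mult)
  qed
  show "ennreal c * lsc_integral \<mu> f \<le> lsc_integral \<mu> (\<lambda>x. ennreal c * f x)" using *[OF assms(2)] .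
  have "ennreal (inverse c) * lsc_integral \<mu> (\<lambda>x. ennreal c * f x) \<le>
      lsc_integral \<mu> (\<lambda>x. ennreal (inverse c) * (ennreal c * f x))"
    using assms(2) by (intro *) simp
  also have "(\<lambda>x. ennreal (inverse c) * (ennreal c * f x)) = f"
    using assms(2) by (simp add: mult.assoc[symmetric] ennreal_mult[symmetric])
  finally have "ennreal c * (ennreal (inverse c) * lsc_integral \<mu> (\<lambda>x. ennreal c * f x)) \<le>
      ennreal c * lsc_integral \<mu> f" by (rule mult_left_mono) simp
  then show "lsc_integral \<mu> (\<lambda>x. ennreal c * f x) \<le> ennreal c * lsc_integral \<mu> f"
    using assms(2) by (simp add: mult.assoc[symmetric] ennreal_mult[symmetric])
qed

context locally_compact_Hausdorff
begin

text \<open>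
  Complete regularity gives enough minorants: if \<open>a < f x\<close>, then \<open>a\<close> times a cutoff function supported
  in the open set \<open>{f > a}\<close> is a minorant that attains the value \<open>a\<close> at \<open>x\<close>.
\<close>

lemma lsc_eq_SUP_minorants:
  fixes f :: "'a \<Rightarrow> ennreal"
  assumes "lsc f"
  shows "(SUP g\<in>minorants f. ennreal (g x)) = f x"
proof (rule antisym)
  show "f x \<le> (SUP g\<in>minorants f. ennreal (g x))"
  proof (rule dense_le)
    fix a assume a: "a < f x"
    then have "a < top" using top_greatest order_less_le_trans by blast
    then obtain r where r: "a = ennreal r" "0 \<le> r" by (cases a) auto
    have U: "open {y. a < f y}" using assms by (simp add: lsc_def)
    obtain g C where g: "g \<in> Cc" "\<And>y. 0 \<le> g y" "\<And>y. g y \<le> 1" "\<And>y. y \<in> {x} \<Longrightarrow> g y = 1"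
      "compact C" "C \<subseteq> {y. a < f y}" "\<And>y. y \<notin> C \<Longrightarrow> g y = 0"
      by (rule Urysohn_Cc[of "{x}", OF _ U]) (use a in auto)
    have "ennreal (r * g y) \<le> f y" for y
    proof (cases "y \<in> C")
      case True
      have "ennreal (r * g y) \<le> ennreal r" using r g(3)[of y] by (intro ennreal_leI) (simp add: mult_left_le)
      also have "\<dots> \<le> f y" using True g(6) r by auto
      finally show ?thesis .
    qed (simp add: g(7))
    then have "(\<lambda>y. r * g y) \<in> minorants f" using g(1,2) r by (simp add: minorants_def)
    then have "ennreal (r * g x) \<le> (SUP g\<in>minorants f. ennreal (g x))" by (rule SUP_upper)
    then show "a \<le> (SUP g\<in>minorants f. ennreal (g x))" using g(4) r by simp
  qed
qed (auto intro!: SUP_least simp: minorantsD)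

text \<open>
  A version of Dini's theorem. If a minorant \<open>g\<close> of \<open>f\<close> lies below the supremum of an upward directed
  family, then by compactness of its support \<open>g - \<delta>\<close> already lies below a single member of the
  family. Directed families take the place of increasing sequences because a lower semicontinuous
  function is the supremum of its minorants, of which there are uncountably many in general.
\<close>

lemma lsc_integral_le_SUP_directed:
  fixes F :: "'i \<Rightarrow> 'a \<Rightarrow> ennreal"
  assumes \<mu>: "\<mu> \<in> positive_radon" and "I \<noteq> {}"
    and F: "\<And>i. i \<in> I \<Longrightarrow> lsc (F i)"
    and dir: "\<And>i j. i \<in> I \<Longrightarrow> j \<in> I \<Longrightarrow> \<exists>k\<in>I. \<forall>x. F i x \<le> F k x \<and> F j x \<le> F k x"
    and f: "\<And>x. f x \<le> (SUP i\<in>I. F i x)"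
  shows "lsc_integral \<mu> f \<le> (SUP i\<in>I. lsc_integral \<mu> (F i))" (is "_ \<le> ?S")
  unfolding lsc_integral_minorants[of \<mu> f]
proof (rule SUP_least)
  fix g assume g: "g \<in> minorants f"
  obtain \<phi> where \<phi>: "\<phi> \<in> Cc" "\<And>x. 0 \<le> \<phi> x" "\<And>x. \<phi> x \<le> 1" "\<And>x. g x \<noteq> 0 \<Longrightarrow> \<phi> x = 1"
    using Cc_cutoff[OF minorantsD(1)[OF g]] by blast
  obtain K where K: "compact K" "\<And>x. x \<notin> K \<Longrightarrow> g x = 0" using Cc_support[OF minorantsD(1)[OF g]] by blast
  define c where "c = integ \<mu> \<phi>"
  have c: "0 \<le> c" unfolding c_def using \<mu> \<phi> by (intro positive_radonD)
  have finite_dir: "\<exists>k\<in>I. \<forall>i\<in>D. \<forall>x. F i x \<le> F k x" if "finite D" "D \<subseteq> I" for D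
    using that
  proof (induction D)
    case empty
    then show ?case using \<open>I \<noteq> {}\<close> by auto
  next
    case (insert i D)
    then obtain k where k: "k \<in> I" "\<forall>i\<in>D. \<forall>x. F i x \<le> F k x" by auto
    obtain l where l: "l \<in> I" "\<forall>x. F i x \<le> F l x \<and> F k x \<le> F l x"
      using dir[of i k] insert.prems k by auto
    have "\<forall>j\<in>insert i D. \<forall>x. F j x \<le> F l x"
      using k l order_trans by (auto; blast)
    then show ?case using l(1) by blast
  qed
  show "ennreal (integ \<mu> g) \<le> ?S"
  proof (rule ennreal_le_epsilon)
    fix e :: real assume e: "0 < e"
    \<comment> \<open>lowering \<open>g\<close> by \<open>\<delta>\<close> on its support costs at most \<open>\<delta> * c \<le> e\<close> in the integral\<close>
    define \<delta> where "\<delta> = e / (c + 1)"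
    have \<delta>: "0 < \<delta>" "\<delta> * c \<le> e" using e c by (auto simp: \<delta>_def field_simps)
    \<comment> \<open>the open set where \<open>g < F i + \<delta>\<close>, written so that its openness is evident\<close>
    define U where "U i = {x. g x < \<delta>} \<union> (\<Union>q\<in>{0..}. {x. g x < q + \<delta>} \<inter> {x. ennreal q < F i x})" for i
    have cont: "continuous_on UNIV g" using minorantsD(1)[OF g] by (rule Cc_cont)
    have "open (U i)" if "i \<in> I" for i
    proof -
      have "open {x. g x < a}" for a using cont by (intro open_Collect_less) auto
      then show ?thesis unfolding U_def using F[OF that] unfolding lsc_def by (intro open_Un open_UN ballI open_Int) auto
    qed
    moreover have "K \<subseteq> (\<Union>i\<in>I. U i)"
    proof
      fix x
      show "x \<in> (\<Union>i\<in>I. U i)"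
      proof (cases "g x < \<delta>")
        case True
        then show ?thesis using \<open>I \<noteq> {}\<close> by (auto simp: U_def)
      next
        case False
        define q where "q = g x - \<delta> / 2"
        have q: "0 \<le> q" "q < g x" "g x < q + \<delta>" using False \<delta> by (auto simp: q_def)
        have "ennreal q < ennreal (g x)" using q by (simp add: ennreal_less_iff)
        also have "\<dots> \<le> f x" using minorantsD(3)[OF g] .
        also have "\<dots> \<le> (SUP i\<in>I. F i x)" by (rule f)
        finally obtain i where "i \<in> I" "ennreal q < F i x" by (auto simp: less_SUP_iff)
        then show ?thesis using q by (auto simp: U_def)
      qed
    qed
    ultimately obtain D where D: "D \<subseteq> I" "finite D" "K \<subseteq> (\<Union>i\<in>D. U i)"
      using compactE_image[OF K(1), of I U] by metis
    obtain k where k: "k \<in> I" "\<forall>i\<in>D. \<forall>x. F i x \<le> F k x" using finite_dir[OF D(2,1)] by blast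
    have U_mono: "U i \<subseteq> U k" if "i \<in> D" for i
      unfolding U_def using k(2) that by (fastforce intro: order_less_le_trans)
    let ?h = "\<lambda>x. max (g x - \<delta> * \<phi> x) 0"
    have hC: "?h \<in> Cc" using minorantsD(1)[OF g] \<phi>(1) by simp
    have "ennreal (?h x) \<le> F k x" for x
    proof (cases "g x \<le> \<delta> * \<phi> x")
      case True
      then show ?thesis by (simp add: max_absorb2)
    next
      case False
      then have "g x \<noteq> 0" using \<phi>(2)[of x] \<delta> by (smt (verit) mult_nonneg_nonneg)
      then have "x \<in> K" "\<phi> x = 1" using K(2) \<phi>(4) by blast+
      then have "x \<in> U k" using D(3) U_mono by blast
      then obtain q where "0 \<le> q" "g x < q + \<delta>" "ennreal q < F k x"
        using False \<open>\<phi> x = 1\<close> by (auto simp: U_def)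
      moreover have "ennreal (?h x) \<le> ennreal q" using calculation \<open>\<phi> x = 1\<close> by (intro ennreal_leI) auto
      ultimately show ?thesis by (meson order.strict_trans2 order.trans less_imp_le)
    qed
    then have h: "?h \<in> minorants (F k)" using hC by (simp add: minorants_def)
    have "integ \<mu> g - \<delta> * c = integ \<mu> (\<lambda>x. g x - \<delta> * \<phi> x)"
      using minorantsD(1)[OF g] \<phi>(1) by (simp add: integ_diff integ_cmult c_def)
    also have "\<dots> \<le> integ \<mu> ?h"
      using \<mu> hC minorantsD(1)[OF g] \<phi>(1) by (intro integ_mono) auto
    finally have "integ \<mu> g \<le> integ \<mu> ?h + e" using \<delta>(2) by linarith
    then have "ennreal (integ \<mu> g) \<le> ennreal (integ \<mu> ?h + e)" by (rule ennreal_leI)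
    also have "\<dots> = ennreal (integ \<mu> ?h) + ennreal e"
      using e positive_radonD[OF \<mu> hC] by (simp add: ennreal_plus)
    also have "\<dots> \<le> ?S + ennreal e"
      using lsc_integral_upper[OF h] k(1) by (intro add_right_mono) (rule SUP_upper2)
    finally show "ennreal (integ \<mu> g) \<le> ?S + ennreal e" .
  qed
qed

lemma lsc_integral_SUP_directed:
  fixes F :: "'i \<Rightarrow> 'a \<Rightarrow> ennreal"
  assumes "\<mu> \<in> positive_radon" "I \<noteq> {}" "\<And>i. i \<in> I \<Longrightarrow> lsc (F i)"
    "\<And>i j. i \<in> I \<Longrightarrow> j \<in> I \<Longrightarrow> \<exists>k\<in>I. \<forall>x. F i x \<le> F k x \<and> F j x \<le> F k x"
  shows "lsc_integral \<mu> (\<lambda>x. SUP i\<in>I. F i x) = (SUP i\<in>I. lsc_integral \<mu> (F i))"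
  using assms
  by (intro antisym lsc_integral_le_SUP_directed SUP_least lsc_integral_mono) (auto intro: SUP_upper)

lemma lsc_eq_SUP_add_minorants:
  fixes f g :: "'a \<Rightarrow> ennreal"
  assumes "lsc f" "lsc g"
  shows "f x + g x = (SUP p\<in>minorants f \<times> minorants g. ennreal (fst p x + snd p x))"
proof (rule antisym)
  have "(SUP u\<in>minorants f. ennreal (u x)) + (SUP v\<in>minorants g. ennreal (v x)) \<le>
      (SUP p\<in>minorants f \<times> minorants g. ennreal (fst p x + snd p x))"
  proof (rule SUP_add_le_ennreal)
    fix u v assume u: "u \<in> minorants f" and v: "v \<in> minorants g"
    have "ennreal (u x) + ennreal (v x) = ennreal (fst (u, v) x + snd (u, v) x)"
      using minorantsD(2)[OF u] minorantsD(2)[OF v] by (simp add: ennreal_plus)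
    also have "\<dots> \<le> (SUP p\<in>minorants f \<times> minorants g. ennreal (fst p x + snd p x))"
      using u v by (intro SUP_upper) auto
    finally show "ennreal (u x) + ennreal (v x) \<le> (SUP p\<in>minorants f \<times> minorants g. ennreal (fst p x + snd p x))" .
  qed auto
  then show "f x + g x \<le> (SUP p\<in>minorants f \<times> minorants g. ennreal (fst p x + snd p x))"
    using lsc_eq_SUP_minorants[OF assms(1), of x] lsc_eq_SUP_minorants[OF assms(2), of x] by simp
  show "(SUP p\<in>minorants f \<times> minorants g. ennreal (fst p x + snd p x)) \<le> f x + g x"
    by (rule SUP_least) (auto simp: minorantsD ennreal_plus intro!: add_mono)
qed

lemma lsc_add:
  fixes f g :: "'a \<Rightarrow> ennreal"
  assumes "lsc f" "lsc g"
  shows "lsc (\<lambda>x. f x + g x)"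
  unfolding lsc_eq_SUP_add_minorants[OF assms]
  by (intro lsc_SUP lsc_ennreal continuous_intros Cc_cont) (auto simp: minorantsD)

lemma lsc_sum:
  fixes f :: "'i \<Rightarrow> 'a \<Rightarrow> ennreal"
  shows "(\<And>i. i \<in> I \<Longrightarrow> lsc (f i)) \<Longrightarrow> lsc (\<lambda>x. \<Sum>i\<in>I. f i x)"
  by (induction I rule: infinite_finite_induct) (auto intro: lsc_add)

text \<open>
  Superadditivity is evident. For subadditivity, \<open>f + g\<close> is the supremum of the directed family of all
  \<open>u + v\<close> with minorants \<open>u\<close> of \<open>f\<close> and \<open>v\<close> of \<open>g\<close>.
\<close>

lemma lsc_integral_add:
  fixes f g :: "'a \<Rightarrow> ennreal"
  assumes \<mu>: "\<mu> \<in> positive_radon" and f: "lsc f" and g: "lsc g"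
  shows "lsc_integral \<mu> (\<lambda>x. f x + g x) = lsc_integral \<mu> f + lsc_integral \<mu> g"
proof (rule antisym)
  let ?I = "minorants f \<times> minorants g"
  have "lsc_integral \<mu> (\<lambda>x. f x + g x) \<le> (SUP p\<in>?I. lsc_integral \<mu> (\<lambda>x. ennreal (fst p x + snd p x)))"
  proof (rule lsc_integral_le_SUP_directed[OF \<mu>])
    show "lsc (\<lambda>x. ennreal (fst p x + snd p x))" if "p \<in> ?I" for p
      using that by (intro lsc_ennreal continuous_intros Cc_cont) (auto simp: minorantsD)
    fix p q assume "p \<in> ?I" "q \<in> ?I"
    then show "\<exists>r\<in>?I. \<forall>x. ennreal (fst p x + snd p x) \<le> ennreal (fst r x + snd r x) \<and>
        ennreal (fst q x + snd q x) \<le> ennreal (fst r x + snd r x)"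
      by (intro bexI[of _ "(\<lambda>x. max (fst p x) (fst q x), \<lambda>x. max (snd p x) (snd q x))"])
        (auto intro!: minorants_max ennreal_leI add_mono)
  qed (auto simp: lsc_eq_SUP_add_minorants[OF f g])
  also have "\<dots> \<le> lsc_integral \<mu> f + lsc_integral \<mu> g"
  proof (rule SUP_least, clarify)
    fix u v assume u: "u \<in> minorants f" and v: "v \<in> minorants g"
    have "lsc_integral \<mu> (\<lambda>x. ennreal (u x + v x)) = ennreal (integ \<mu> u) + ennreal (integ \<mu> v)"
      using \<mu> minorantsD[OF u] minorantsD[OF v]
      by (subst lsc_integral_Cc) (auto simp: integ_add ennreal_plus positive_radonD)
    also have "\<dots> \<le> lsc_integral \<mu> f + lsc_integral \<mu> g"
      using u v by (intro add_mono lsc_integral_upper)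
    finally show "lsc_integral \<mu> (\<lambda>x. ennreal (fst (u, v) x + snd (u, v) x)) \<le> lsc_integral \<mu> f + lsc_integral \<mu> g"
      by simp
  qed
  finally show "lsc_integral \<mu> (\<lambda>x. f x + g x) \<le> lsc_integral \<mu> f + lsc_integral \<mu> g" .
  show "lsc_integral \<mu> f + lsc_integral \<mu> g \<le> lsc_integral \<mu> (\<lambda>x. f x + g x)"
    unfolding lsc_integral_minorants[of \<mu> f] lsc_integral_minorants[of \<mu> g]
  proof (rule SUP_add_le_ennreal)
    fix u v assume u: "u \<in> minorants f" and v: "v \<in> minorants g"
    have "(\<lambda>x. u x + v x) \<in> minorants (\<lambda>x. f x + g x)"
      using minorantsD[OF u] minorantsD[OF v] by (auto simp: minorants_def ennreal_plus intro!: add_mono)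
    from lsc_integral_upper[OF this, of \<mu>]
    show "ennreal (integ \<mu> u) + ennreal (integ \<mu> v) \<le> lsc_integral \<mu> (\<lambda>x. f x + g x)"
      using \<mu> minorantsD[OF u] minorantsD[OF v] by (simp add: integ_add ennreal_plus positive_radonD)
  qed auto
qed

lemma lsc_integral_sum:
  fixes f :: "'i \<Rightarrow> 'a \<Rightarrow> ennreal"
  assumes "\<mu> \<in> positive_radon" "\<And>i. i \<in> I \<Longrightarrow> lsc (f i)"
  shows "lsc_integral \<mu> (\<lambda>x. \<Sum>i\<in>I. f i x) = (\<Sum>i\<in>I. lsc_integral \<mu> (f i))"
  using assms(2)
proof (induction I rule: infinite_finite_induct)
  case (insert i I)
  then show ?case using assms(1) by (simp add: lsc_integral_add lsc_sum)
qed auto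

end

section \<open>The Borel measure of a positive Radon measure\<close>

definition outer_mass :: "'a::topological_space radon \<Rightarrow> 'a set \<Rightarrow> ennreal" where
  "outer_mass \<mu> N = (INF U\<in>{U. open U \<and> N \<subseteq> U}. lsc_integral \<mu> (indicator U))"

lemma negligible_for_outer_mass: "negligible_for \<mu> N \<longleftrightarrow> outer_mass \<mu> N = 0"
  by (simp add: negligible_for_def outer_mass_def)

lemma outer_mass_le: "open U \<Longrightarrow> N \<subseteq> U \<Longrightarrow> outer_mass \<mu> N \<le> lsc_integral \<mu> (indicator U)"
  unfolding outer_mass_def by (rule INF_lower) simp

lemma lsc_integral_indicator_mono:
  "U \<subseteq> V \<Longrightarrow> lsc_integral \<mu> (indicator U) \<le> lsc_integral \<mu> (indicator V)"
  by (rule lsc_integral_mono) (auto simp: indicator_def)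

lemma outer_mass_open: "open U \<Longrightarrow> outer_mass \<mu> U = lsc_integral \<mu> (indicator U)"
  unfolding outer_mass_def
  by (intro antisym INF_lower INF_greatest lsc_integral_indicator_mono) auto

lemma outer_mass_mono: "M \<subseteq> N \<Longrightarrow> outer_mass \<mu> M \<le> outer_mass \<mu> N"
  unfolding outer_mass_def by (rule INF_superset_mono) auto

lemma outer_mass_empty [simp]: "outer_mass \<mu> {} = 0" for \<mu> :: "'a::t2_space radon"
proof -
  have "(indicator {} :: 'a \<Rightarrow> ennreal) = (\<lambda>_. 0)" by (simp add: fun_eq_iff)
  then show ?thesis by (simp add: outer_mass_open)
qed

definition radon_measure :: "'a::topological_space radon \<Rightarrow> 'a measure" where
  "radon_measure \<mu> = measure_of UNIV (sets borel) (outer_mass \<mu>)"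

lemma sets_radon_measure [simp, measurable_cong]: "sets (radon_measure \<mu>) = sets borel"
  using sets.sigma_sets_eq[of "borel :: 'a measure"] by (simp add: radon_measure_def)

lemma space_radon_measure [simp]: "space (radon_measure \<mu>) = UNIV"
  by (simp add: radon_measure_def)

lemma lsc_borel_measurable [measurable]: "lsc f \<Longrightarrow> f \<in> borel_measurable borel"
  by (rule borel_measurableI_greater) (simp add: lsc_def)

lemma lsc_borel_measurable_radon [measurable]: "lsc f \<Longrightarrow> f \<in> borel_measurable (radon_measure \<mu>)"
  using lsc_borel_measurable[of f] by simp

lemma minorants_indicatorD:
  assumes "g \<in> minorants (indicator U)"
  shows "g x \<le> 1" "x \<notin> U \<Longrightarrow> g x = 0"
proof -
  have "ennreal (g x) \<le> 1"
    using minorantsD(3)[OF assms, of x] by (rule order_trans) (simp add: indicator_def)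
  then show "g x \<le> 1" by simp
  show "x \<notin> U \<Longrightarrow> g x = 0"
    using minorantsD(2,3)[OF assms, of x] by (simp add: ennreal_eq_0_iff)
qed

context locally_compact_Hausdorff
begin

text \<open>The union is a directed supremum of finite sums of indicators.\<close>

lemma lsc_integral_UN:
  fixes U :: "nat \<Rightarrow> 'a set"
  assumes \<mu>: "\<mu> \<in> positive_radon" and U: "\<And>i. open (U i)"
  shows "lsc_integral \<mu> (indicator (\<Union>i. U i)) \<le> (\<Sum>i. lsc_integral \<mu> (indicator (U i)))"
proof -
  define F where "F n x = (\<Sum>i<n. indicator (U i) x :: ennreal)" for n x
  have "lsc_integral \<mu> (indicator (\<Union>i. U i)) \<le> (SUP n. lsc_integral \<mu> (F n))"
  proof (rule lsc_integral_le_SUP_directed[OF \<mu>])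
    show "lsc (F n)" for n unfolding F_def using U by (intro lsc_sum lsc_indicator)
    show "\<exists>k\<in>UNIV. \<forall>x. F i x \<le> F k x \<and> F j x \<le> F k x" for i j
      unfolding F_def by (intro bexI[of _ "max i j"] allI conjI sum_mono2) auto
    show "indicator (\<Union>i. U i) x \<le> (SUP n. F n x)" for x
    proof (cases "x \<in> (\<Union>i. U i)")
      case True
      then obtain i where i: "x \<in> U i" by blast
      have "(1::ennreal) = (\<Sum>j\<in>{i}. indicator (U j) x)" using i by simp
      also have "\<dots> \<le> F (Suc i) x" unfolding F_def by (intro sum_mono2) auto
      also have "\<dots> \<le> (SUP n. F n x)" by (intro SUP_upper) simp
      finally show ?thesis using True by simp
    qed simp
  qed auto
  also have "\<dots> = (SUP n. \<Sum>i<n. lsc_integral \<mu> (indicator (U i)))"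
    unfolding F_def using \<mu> U by (simp add: lsc_integral_sum lsc_indicator)
  also have "\<dots> = (\<Sum>i. lsc_integral \<mu> (indicator (U i)))" by (rule suminf_eq_SUP[symmetric])
  finally show ?thesis .
qed

lemma outer_mass_UN:
  fixes N :: "nat \<Rightarrow> 'a set"
  assumes \<mu>: "\<mu> \<in> positive_radon"
  shows "outer_mass \<mu> (\<Union>i. N i) \<le> (\<Sum>i. outer_mass \<mu> (N i))"
proof (rule ennreal_le_epsilon)
  fix e :: real assume fin: "(\<Sum>i. outer_mass \<mu> (N i)) < top" and e: "0 < e"
  have "\<exists>U. open U \<and> N i \<subseteq> U \<and> lsc_integral \<mu> (indicator U) \<le> outer_mass \<mu> (N i) + ennreal (e * (1/2) ^ Suc i)" for i
  proof -
    have "outer_mass \<mu> (N i) < top"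
      using fin ennreal_suminf_lessD by blast
    moreover have "0 < ennreal (e * (1/2) ^ Suc i)" using e by simp
    ultimately have "outer_mass \<mu> (N i) < outer_mass \<mu> (N i) + ennreal (e * (1/2) ^ Suc i)"
      by (simp add: less_top[symmetric])
    then show ?thesis unfolding outer_mass_def[of \<mu> "N i"] INF_less_iff by (auto intro: less_imp_le)
  qed
  then obtain U where U: "\<And>i. open (U i)" "\<And>i. N i \<subseteq> U i"
    "\<And>i. lsc_integral \<mu> (indicator (U i)) \<le> outer_mass \<mu> (N i) + ennreal (e * (1/2) ^ Suc i)" by metis
  have "outer_mass \<mu> (\<Union>i. N i) \<le> lsc_integral \<mu> (indicator (\<Union>i. U i))"
    using U(1,2) by (intro outer_mass_le) auto
  also have "\<dots> \<le> (\<Sum>i. lsc_integral \<mu> (indicator (U i)))" using \<mu> U(1) by (rule lsc_integral_UN)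
  also have "\<dots> \<le> (\<Sum>i. outer_mass \<mu> (N i) + ennreal (e * (1/2) ^ Suc i))"
    using U(3) by (intro suminf_le summableI) auto
  also have "\<dots> = (\<Sum>i. outer_mass \<mu> (N i)) + (\<Sum>i. ennreal (e * (1/2) ^ Suc i))"
    by (simp only: suminf_add[OF summableI summableI, symmetric])
  also have "(\<Sum>i. ennreal (e * (1/2) ^ Suc i)) = ennreal e"
    using e sums_mult[OF power_half_series, of e] by (intro suminf_ennreal_eq) auto
  finally show "outer_mass \<mu> (\<Union>i. N i) \<le> (\<Sum>i. outer_mass \<mu> (N i)) + ennreal e" .
qed

lemma outer_measure_space_outer_mass:
  fixes \<mu> :: "'a radon"
  assumes "\<mu> \<in> positive_radon"
  shows "outer_measure_space UNIV (outer_mass \<mu>)"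
  using outer_mass_UN[OF assms]
  by (auto simp: outer_measure_space_def positive_def increasing_def countably_subadditive_def
      intro: outer_mass_mono)

text \<open>
  Open sets satisfy Caratheodory's criterion. A minorant of the indicator of \<open>U \<inter> V\<close>, lowered by \<open>e\<close> and
  truncated at \<open>0\<close>, vanishes off a closed subset \<open>C\<close> of \<open>U \<inter> V\<close>; it can therefore be added to any minorant
  of the indicator of \<open>V - C\<close> without exceeding \<open>1\<^sub>V\<close>.
\<close>

lemma outer_mass_open_split:
  fixes U V :: "'a set"
  assumes \<mu>: "\<mu> \<in> positive_radon" and U: "open U" and V: "open V"
  shows "lsc_integral \<mu> (indicator (U \<inter> V)) + outer_mass \<mu> (V - U) \<le> lsc_integral \<mu> (indicator V)"
  unfolding lsc_integral_minorants[of \<mu> "indicator (U \<inter> V)"]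
proof (subst ennreal_SUP_add_left[symmetric], simp, rule SUP_least)
  fix g assume g: "g \<in> minorants (indicator (U \<inter> V))"
  note gC = minorantsD(1)[OF g]
  obtain \<phi> where \<phi>: "\<phi> \<in> Cc" "\<And>x. 0 \<le> \<phi> x" "\<And>x. \<phi> x \<le> 1" "\<And>x. g x \<noteq> 0 \<Longrightarrow> \<phi> x = 1"
    using Cc_cutoff[OF gC] by blast
  note g1 = minorants_indicatorD[OF g]
  have pos: "0 \<le> integ \<mu> g" using \<mu> gC minorantsD(2)[OF g] by (rule positive_radonD)
  define c where "c = integ \<mu> \<phi>"
  have c: "0 \<le> c" unfolding c_def using \<mu> \<phi> by (intro positive_radonD)
  show "ennreal (integ \<mu> g) + outer_mass \<mu> (V - U) \<le> lsc_integral \<mu> (indicator V)"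
  proof (rule ennreal_le_epsilon)
    fix d :: real assume d: "0 < d"
    define e where "e = d / (c + 1)"
    have e: "0 < e" "e * c \<le> d" using d c by (auto simp: e_def field_simps)
    define C where "C = {x. e \<le> g x}"
    have "closed C" unfolding C_def using Cc_cont[OF gC] by (intro closed_Collect_le) auto
    have C: "C \<subseteq> U \<inter> V" using g1(2) e(1) unfolding C_def by (force simp: not_le)
    let ?g = "\<lambda>x. max (g x - e * \<phi> x) 0"
    have g'C: "?g \<in> Cc" using gC \<phi>(1) by simp
    have g'0: "?g x = 0" if "x \<notin> C" for x
      using that \<phi>(4)[of x] \<phi>(2)[of x] e(1) by (cases "g x = 0") (auto simp: C_def)
    have g'1: "?g x \<le> 1" for x using g1(1)[of x] \<phi>(2)[of x] e(1) by (smt (verit) mult_nonneg_nonneg)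
    have "ennreal (integ \<mu> ?g) + lsc_integral \<mu> (indicator (V - C)) \<le> lsc_integral \<mu> (indicator V)"
      unfolding lsc_integral_minorants[of \<mu> "indicator (V - C)"]
    proof (subst ennreal_SUP_add_right, simp, rule SUP_least)
      fix h assume h: "h \<in> minorants (indicator (V - C))"
      note h1 = minorants_indicatorD[OF h]
      have "(\<lambda>x. ?g x + h x) \<in> minorants (indicator V)"
        unfolding minorants_def
      proof (intro CollectI conjI allI)
        show "(\<lambda>x. ?g x + h x) \<in> Cc" using g'C minorantsD(1)[OF h] by (rule Cc_add)
        show "0 \<le> ?g x + h x" for x using minorantsD(2)[OF h, of x] by simp
        show "ennreal (?g x + h x) \<le> indicator V x" for x
        proof (cases "x \<in> V")
          case True
          have "?g x + h x \<le> 1"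
            using g'0[of x] g'1[of x] h1[of x] by (cases "x \<in> C") auto
          then show ?thesis using True by simp
        next
          case False
          then have "?g x + h x = 0" using g'0[of x] h1(2)[of x] C by auto
          then show ?thesis by simp
        qed
      qed
      from lsc_integral_upper[OF this, of \<mu>]
      show "ennreal (integ \<mu> ?g) + ennreal (integ \<mu> h) \<le> lsc_integral \<mu> (indicator V)"
        using positive_radonD[OF \<mu> g'C] positive_radonD[OF \<mu> minorantsD(1,2)[OF h]]
          integ_add[OF g'C minorantsD(1)[OF h], of \<mu>]
        by (simp add: ennreal_plus)
    qed
    moreover have "outer_mass \<mu> (V - U) \<le> lsc_integral \<mu> (indicator (V - C))"
      using V \<open>closed C\<close> C by (intro outer_mass_le open_Diff) auto
    moreover have "ennreal (integ \<mu> g) \<le> ennreal (integ \<mu> ?g) + ennreal d"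
    proof -
      have "integ \<mu> g - e * c = integ \<mu> (\<lambda>x. g x - e * \<phi> x)"
        using gC \<phi>(1) by (simp add: integ_diff integ_cmult c_def)
      also have "\<dots> \<le> integ \<mu> ?g" using \<mu> gC \<phi>(1) by (intro integ_mono) auto
      finally have "integ \<mu> g \<le> integ \<mu> ?g + d" using e(2) by linarith
      then show ?thesis using d positive_radonD[OF \<mu> g'C] by (simp add: ennreal_plus[symmetric] ennreal_leI del: ennreal_plus)
    qed
    ultimately have "ennreal (integ \<mu> g) + outer_mass \<mu> (V - U) \<le>
        (ennreal (integ \<mu> ?g) + ennreal d) + lsc_integral \<mu> (indicator (V - C))" by (intro add_mono)
    also have "\<dots> = (ennreal (integ \<mu> ?g) + lsc_integral \<mu> (indicator (V - C))) + ennreal d"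
      by (simp only: ac_simps)
    also have "\<dots> \<le> lsc_integral \<mu> (indicator V) + ennreal d"
      by (rule add_right_mono) fact
    finally show "ennreal (integ \<mu> g) + outer_mass \<mu> (V - U) \<le> lsc_integral \<mu> (indicator V) + ennreal d" .
  qed
qed

lemma emeasure_radon_measure:
  fixes \<mu> :: "'a radon"
  assumes \<mu>: "\<mu> \<in> positive_radon" and B: "B \<in> sets borel"
  shows "emeasure (radon_measure \<mu>) B = outer_mass \<mu> B"
proof -
  let ?L = "lambda_system UNIV UNIV (outer_mass \<mu>)"
  note oms = outer_measure_space_outer_mass[OF \<mu>]
  have sig: "sigma_algebra UNIV (UNIV :: 'a set set)"
    using sigma_algebra_Pow[of "UNIV :: 'a set"] by simp
  interpret P: sigma_algebra UNIV "UNIV :: 'a set set" by (rule sig)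
  have ms: "measure_space UNIV ?L (outer_mass \<mu>)"
    using sigma_algebra.caratheodory_lemma[OF sig oms] .
  have sub: "subadditive UNIV (outer_mass \<mu>)"
    using oms P.countably_subadditive_subadditive unfolding outer_measure_space_def by blast
  have "U \<in> ?L" if U: "open U" for U
    unfolding P.lambda_system_eq
  proof (intro CollectI conjI ballI UNIV_I)
    fix N
    show "outer_mass \<mu> (N \<inter> U) + outer_mass \<mu> (N - U) = outer_mass \<mu> N"
    proof (rule antisym)
      show "outer_mass \<mu> (N \<inter> U) + outer_mass \<mu> (N - U) \<le> outer_mass \<mu> N"
        unfolding outer_mass_def[of \<mu> N]
      proof (rule INF_greatest, clarify)
        fix V assume V: "open V" "N \<subseteq> V"
        have "outer_mass \<mu> (N \<inter> U) + outer_mass \<mu> (N - U) \<le>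
            lsc_integral \<mu> (indicator (U \<inter> V)) + outer_mass \<mu> (V - U)"
          using U V by (intro add_mono outer_mass_le outer_mass_mono) auto
        also have "\<dots> \<le> lsc_integral \<mu> (indicator V)" by (rule outer_mass_open_split[OF \<mu> U V(1)])
        finally show "outer_mass \<mu> (N \<inter> U) + outer_mass \<mu> (N - U) \<le> lsc_integral \<mu> (indicator V)" .
      qed
      have "outer_mass \<mu> ((N \<inter> U) \<union> (N - U)) \<le> outer_mass \<mu> (N \<inter> U) + outer_mass \<mu> (N - U)"
        using sub by (rule subadditiveD) auto
      then show "outer_mass \<mu> N \<le> outer_mass \<mu> (N \<inter> U) + outer_mass \<mu> (N - U)"
        by (simp add: Int_Diff_Un)
    qed
  qed
  then have "sets borel \<subseteq> ?L"
    using sigma_algebra.sigma_sets_subset[of UNIV ?L "Collect open"] ms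
    by (auto simp: measure_space_def borel_def subset_eq)
  then have "measure_space UNIV (sets (borel :: 'a measure)) (outer_mass \<mu>)"
    using measure_down[OF ms _ ] sets.sigma_algebra_axioms[of "borel :: 'a measure"] by simp
  then show ?thesis
    unfolding radon_measure_def measure_space_def using B by (intro emeasure_measure_of_sigma) auto
qed

lemma emeasure_radon_open:
  fixes \<mu> :: "'a radon"
  assumes "\<mu> \<in> positive_radon" "open U"
  shows "emeasure (radon_measure \<mu>) U = lsc_integral \<mu> (indicator U)"
  using assms by (simp add: emeasure_radon_measure outer_mass_open)

text \<open>
  Step functions built from the superlevel sets of a lower semicontinuous \<open>f\<close> are combinations of
  indicators of open sets: a new largest value \<open>b\<close>, with predecessor \<open>p\<close>, adds \<open>b - p\<close> on \<open>{f > b}\<close>.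
\<close>

lemma nn_integral_radon_step:
  fixes f :: "'a \<Rightarrow> ennreal"
  assumes \<mu>: "\<mu> \<in> positive_radon" and f: "lsc f" and D: "finite D" "D \<subseteq> {0<..}"
  defines "h \<equiv> \<lambda>q x. if ennreal q < f x then ennreal q else 0"
  shows "lsc (\<lambda>x. SUP q\<in>D. h q x) \<and>
    (\<integral>\<^sup>+x. (SUP q\<in>D. h q x) \<partial>radon_measure \<mu>) = lsc_integral \<mu> (\<lambda>x. SUP q\<in>D. h q x)"
  using D
proof (induction D rule: finite_linorder_max_induct)
  case empty
  then show ?case by (simp add: bot_ennreal)
next
  case (insert b A)
  let ?U = "{x. ennreal b < f x}" and ?S = "\<lambda>x. SUP q\<in>A. h q x"
  have U: "open ?U" using f by (simp add: lsc_def)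
  have b: "0 < b" using insert.prems by simp
  define p where "p = Max (insert 0 A)"
  have fin: "finite (insert 0 A)" using insert.hyps(1) by simp
  have p: "p \<in> insert 0 A" "\<And>q. q \<in> A \<Longrightarrow> q \<le> p" "0 \<le> p"
    unfolding p_def by (rule Max_in[OF fin], simp) (use fin in \<open>auto intro: Max_ge\<close>)
  then have pb: "0 < b - p" using insert.hyps(2) b by auto
  let ?J = "\<lambda>x. ennreal (b - p) * indicator ?U x"
  have eq: "(SUP q\<in>insert b A. h q x) = ?S x + ?J x" for x
  proof (cases "ennreal b < f x")
    case True
    have h: "h q x = ennreal q" if "q \<in> A" for q
      using True insert.hyps(2) that unfolding h_def
      by (metis ennreal_leI less_imp_le order_le_less_trans)
    have "?S x = ennreal p"
    proof (rule antisym)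
      show "?S x \<le> ennreal p" using h p(2) by (auto intro!: SUP_least ennreal_leI)
      show "ennreal p \<le> ?S x" using p(1) h by (cases "p = 0") (auto intro!: SUP_upper2[of p])
    qed
    moreover have "sup (h b x) (ennreal p) = ennreal b"
      using True pb unfolding h_def by (simp add: sup.absorb1 ennreal_leI)
    ultimately show ?thesis using True p(3) pb by (simp add: ennreal_plus[symmetric] del: ennreal_plus)
  next
    case False
    then have "h b x = 0" by (simp add: h_def)
    then show ?thesis using False by (simp add: sup_absorb2)
  qed
  have "{x. a < ?J x} = (if a < ennreal (b - p) then ?U else {})" for a
    by (auto simp: indicator_def split: if_splits)
  then have J: "lsc ?J" using U by (simp add: lsc_def)
  have S: "lsc ?S" "(\<integral>\<^sup>+x. ?S x \<partial>radon_measure \<mu>) = lsc_integral \<mu> ?S" using insert by auto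
  have "(\<integral>\<^sup>+x. ?S x + ?J x \<partial>radon_measure \<mu>) = lsc_integral \<mu> ?S + (\<integral>\<^sup>+x. ?J x \<partial>radon_measure \<mu>)"
    unfolding S(2)[symmetric] by (rule nn_integral_add[OF lsc_borel_measurable_radon[OF S(1)] lsc_borel_measurable_radon[OF J]])
  also have "(\<integral>\<^sup>+x. ?J x \<partial>radon_measure \<mu>) = ennreal (b - p) * emeasure (radon_measure \<mu>) ?U"
    by (rule nn_integral_cmult_indicator) (simp only: sets_radon_measure borel_open[OF U])
  also have "\<dots> = lsc_integral \<mu> ?J"
    by (simp only: emeasure_radon_open[OF \<mu> U] lsc_integral_cmult[OF \<mu> pb])
  also have "lsc_integral \<mu> ?S + lsc_integral \<mu> ?J = lsc_integral \<mu> (\<lambda>x. ?S x + ?J x)"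
    by (rule lsc_integral_add[OF \<mu> S(1) J, symmetric])
  finally show ?case unfolding eq using lsc_add[OF S(1) J] by blast
qed

text \<open>
  The step functions with values among the first \<open>n\<close> rational numbers increase to \<open>f\<close>, and both
  integrals are continuous along increasing sequences of lower semicontinuous functions.
\<close>

lemma nn_integral_radon_measure:
  fixes f :: "'a \<Rightarrow> ennreal"
  assumes \<mu>: "\<mu> \<in> positive_radon" and f: "lsc f"
  shows "(\<integral>\<^sup>+x. f x \<partial>radon_measure \<mu>) = lsc_integral \<mu> f"
proof -
  define h where "h = (\<lambda>q x. if ennreal q < f x then ennreal q else 0)"
  define r where "r = from_nat_into (\<rat> :: real set)"
  define D where "D n = r ` {..<n} \<inter> {0<..}" for n
  define F where "F n x = (SUP q\<in>D n. h q x)" for n x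
  have step: "lsc (F n)" "(\<integral>\<^sup>+x. F n x \<partial>radon_measure \<mu>) = lsc_integral \<mu> (F n)" for n
    using nn_integral_radon_step[OF \<mu> f, of "D n"] by (auto simp: D_def F_def[abs_def] h_def)
  have inc: "F i x \<le> F j x" if "i \<le> j" for i j x
    unfolding F_def D_def using that by (intro SUP_subset_mono) auto
  have sup: "(SUP n. F n x) = f x" for x
  proof (rule antisym)
    have "h q x \<le> f x" for q by (simp add: h_def less_imp_le)
    then show "(SUP n. F n x) \<le> f x" unfolding F_def by (intro SUP_least)
    show "f x \<le> (SUP n. F n x)"
    proof (rule dense_le)
      fix a assume "a < f x"
      then obtain c where c: "a < c" "c < f x" using dense by blast
      obtain s where s: "a = ennreal s" "0 \<le> s" using c by (cases a) auto
      have "c < top" using c(2) top_greatest order_less_le_trans by blast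
      then obtain t where t: "c = ennreal t" "0 \<le> t" by (cases c) auto
      have "s < t" using c(1) s t by (simp add: ennreal_less_iff)
      then obtain q where q: "q \<in> \<rat>" "s < q" "q < t" using Rats_dense_in_real by blast
      have "range r = \<rat>" unfolding r_def by (rule range_from_nat_into) (auto simp: countable_rat)
      then obtain k where k: "q = r k" using q(1) by (metis imageE)
      have "ennreal q < f x" using q s t c(2) by (metis ennreal_leI less_imp_le order_le_less_trans)
      then have "ennreal q \<le> F (Suc k) x"
        unfolding F_def using k q s by (intro SUP_upper2[of q]) (auto simp: D_def h_def)
      moreover have "a \<le> ennreal q" using s q by (simp add: ennreal_leI)
      ultimately show "a \<le> (SUP n. F n x)" by (meson SUP_upper2 UNIV_I order_trans)
    qed
  qed
  have "(\<integral>\<^sup>+x. f x \<partial>radon_measure \<mu>) = (\<integral>\<^sup>+x. (SUP n. F n x) \<partial>radon_measure \<mu>)" by (simp add: sup)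
  also have "\<dots> = (SUP n. \<integral>\<^sup>+x. F n x \<partial>radon_measure \<mu>)"
    using inc step(1) by (intro nn_integral_monotone_convergence_SUP) (auto simp: incseq_def le_fun_def)
  also have "\<dots> = lsc_integral \<mu> (\<lambda>x. SUP n. F n x)"
    unfolding step(2)
  proof (rule lsc_integral_SUP_directed[symmetric, OF \<mu>])
    show "\<exists>k\<in>UNIV. \<forall>x. F i x \<le> F k x \<and> F j x \<le> F k x" for i j
      using inc by (intro bexI[of _ "max i j"]) auto
  qed (use step(1) in auto)
  finally show ?thesis by (simp add: sup)
qed

lemma nn_integral_radon_Cc:
  fixes g :: "'a \<Rightarrow> real"
  assumes "\<mu> \<in> positive_radon" "g \<in> Cc" "\<And>x. 0 \<le> g x"
  shows "(\<integral>\<^sup>+x. ennreal (g x) \<partial>radon_measure \<mu>) = ennreal (integ \<mu> g)"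
  using assms by (simp add: nn_integral_radon_measure lsc_integral_Cc lsc_ennreal Cc_cont)

lemma emeasure_radon_compact:
  fixes K :: "'a set"
  assumes "\<mu> \<in> positive_radon" "compact K"
  shows "emeasure (radon_measure \<mu>) K < top"
proof -
  obtain g where g: "g \<in> Cc" "\<And>x. 0 \<le> g x" "\<And>x. g x \<le> 1" "\<And>x. x \<in> K \<Longrightarrow> g x = 1"
    using cutoff[OF assms(2)] by blast
  have "emeasure (radon_measure \<mu>) K = (\<integral>\<^sup>+x. indicator K x \<partial>radon_measure \<mu>)"
    using assms by (simp add: borel_compact)
  also have "\<dots> \<le> (\<integral>\<^sup>+x. ennreal (g x) \<partial>radon_measure \<mu>)"
    using g by (intro nn_integral_mono) (auto simp: indicator_def)
  also have "\<dots> < top" using assms g by (simp add: nn_integral_radon_Cc)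
  finally show ?thesis .
qed

text \<open>
  The restriction of \<open>\<mu>\<close> to \<open>K\<close>, as the functional that integrates \<open>f 1\<^sub>K\<close> against the Borel measure of
  \<open>\<mu>\<close>. A cutoff function equal to \<open>1\<close> on \<open>K\<close> shows that it detects whether \<open>K\<close> is a null set.
\<close>

lemma restrict_radon:
  fixes K :: "'a set"
  assumes \<mu>: "\<mu> \<in> positive_radon" and K: "compact K"
  obtains \<rho> where "\<rho> \<in> positive_radon" "\<mu> - \<rho> \<in> positive_radon" "lsc_integral \<rho> (indicator (- K)) = 0"
    "\<rho> = 0 \<Longrightarrow> emeasure (radon_measure \<mu>) K = 0"
proof -
  let ?M = "radon_measure \<mu>"
  define \<phi> where "\<phi> f = (\<integral>\<^sup>+x. ennreal (f x) * indicator K x \<partial>?M)" for f :: "'a \<Rightarrow> real"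
  have le: "\<phi> f \<le> ennreal (integ \<mu> f)" if "f \<in> Cc" "\<And>x. 0 \<le> f x" for f
    unfolding nn_integral_radon_Cc[OF \<mu> that, symmetric] \<phi>_def
    by (intro nn_integral_mono) (auto simp: indicator_def)
  have fin: "\<phi> f < top" if "f \<in> Cc" "\<And>x. 0 \<le> f x" for f
    using le[OF that] by (metis ennreal_less_top order_le_less_trans)
  have Ks: "K \<in> sets borel" using K by (rule borel_compact)
  have m: "(\<lambda>x. ennreal (f x) * indicator K x) \<in> borel_measurable ?M" if "f \<in> Cc" for f
    using Ks that by (intro borel_measurable_times_ennreal borel_measurable_indicator
        lsc_borel_measurable_radon lsc_ennreal Cc_cont) auto
  obtain \<rho> where \<rho>: "\<rho> \<in> positive_radon" "\<And>f. f \<in> Cc \<Longrightarrow> (\<And>x. 0 \<le> f x) \<Longrightarrow> integ \<rho> f = enn2real (\<phi> f)"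
  proof (rule radon_of_cone[of "\<lambda>f. enn2real (\<phi> f)"])
    fix f g :: "'a \<Rightarrow> real" assume fg: "f \<in> Cc" "g \<in> Cc" "\<And>x. 0 \<le> f x" "\<And>x. 0 \<le> g x"
    have "\<phi> (\<lambda>x. f x + g x) = \<phi> f + \<phi> g"
    proof -
      have "ennreal (f x + g x) * indicator K x = ennreal (f x) * indicator K x + ennreal (g x) * indicator K x" for x
        using fg(3,4) by (simp add: distrib_right)
      then show ?thesis unfolding \<phi>_def using m fg(1,2) by (simp add: nn_integral_add)
    qed
    then show "enn2real (\<phi> (\<lambda>x. f x + g x)) = enn2real (\<phi> f) + enn2real (\<phi> g)"
      using fin fg by (simp add: enn2real_plus)
  next
    fix f :: "'a \<Rightarrow> real" and c :: real assume f: "f \<in> Cc" "\<And>x. 0 \<le> f x" and c: "0 \<le> c"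
    have "\<phi> (\<lambda>x. c * f x) = ennreal c * \<phi> f"
      unfolding \<phi>_def using f m c by (simp add: ennreal_mult mult.assoc nn_integral_cmult)
    then show "enn2real (\<phi> (\<lambda>x. c * f x)) = c * enn2real (\<phi> f)"
      using c by (simp add: enn2real_mult)
  qed auto
  have "\<mu> - \<rho> \<in> positive_radon"
  proof (rule positive_radonI)
    fix f :: "'a \<Rightarrow> real" assume f: "f \<in> Cc" "\<And>x. 0 \<le> f x"
    have "enn2real (\<phi> f) \<le> integ \<mu> f"
      using le[OF f] positive_radonD[OF \<mu> f] by (simp add: enn2real_leI)
    then show "0 \<le> integ (\<mu> - \<rho>) f" using \<rho>(2)[OF f] by simp
  qed
  moreover have "lsc_integral \<rho> (indicator (- K)) = 0"
    unfolding lsc_integral_minorants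
  proof (rule antisym, rule SUP_least)
    fix g assume g: "g \<in> minorants (indicator (- K))"
    have z: "ennreal (g x) * indicator K x = 0" for x
      using minorantsD(2,3)[OF g, of x] by (auto simp: indicator_def split: if_splits)
    have "\<phi> g = 0" unfolding \<phi>_def z by simp
    then show "ennreal (integ \<rho> g) \<le> 0" using \<rho>(2)[OF minorantsD(1,2)[OF g]] by simp
  qed simp
  moreover have "emeasure ?M K = 0" if "\<rho> = 0"
  proof -
    obtain g where g: "g \<in> Cc" "\<And>x. 0 \<le> g x" "\<And>x. g x \<le> 1" "\<And>x. x \<in> K \<Longrightarrow> g x = 1"
      using cutoff[OF K] by blast
    have "emeasure ?M K = (\<integral>\<^sup>+x. indicator K x \<partial>?M)" using Ks by simp
    also have "\<dots> = \<phi> g" unfolding \<phi>_def using g by (intro nn_integral_cong) (auto simp: indicator_def)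
    also have "\<dots> = 0"
      using \<rho>(2)[OF g(1,2)] that fin[OF g(1,2)] by (auto simp: enn2real_eq_0_iff)
    finally show ?thesis .
  qed
  ultimately show thesis using that \<rho>(1) by blast
qed

end

section \<open>Products of Radon measures\<close>

lemma Cc_tensor:
  fixes f :: "'a::t2_space \<Rightarrow> real" and g :: "'b::t2_space \<Rightarrow> real"
  assumes "f \<in> Cc" "g \<in> Cc"
  shows "(\<lambda>(x, y). f x * g y) \<in> Cc"
proof -
  obtain K where K: "compact K" "\<And>x. x \<notin> K \<Longrightarrow> f x = 0" using Cc_support[OF assms(1)] by blast
  obtain L where L: "compact L" "\<And>x. x \<notin> L \<Longrightarrow> g x = 0" using Cc_support[OF assms(2)] by blast
  have "continuous_on UNIV (\<lambda>p. f (fst p) * g (snd p))"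
    by (intro continuous_on_mult continuous_on_compose2[OF Cc_cont[OF assms(1)]]
        continuous_on_compose2[OF Cc_cont[OF assms(2)]] continuous_intros) auto
  then have c: "continuous_on UNIV (\<lambda>(x, y). f x * g y)" by (simp add: case_prod_unfold)
  show ?thesis unfolding Cc_iff
  proof (intro conjI exI[of _ "K \<times> L"] c)
    show "compact (K \<times> L)" using K(1) L(1) by (rule compact_Times)
    show "\<forall>x. x \<notin> K \<times> L \<longrightarrow> (case x of (x, y) \<Rightarrow> f x * g y) = 0"
      using K(2) L(2) by force
  qed
qed

lemma Cc_prod_support:
  fixes F :: "'a::t2_space \<times> 'b::t2_space \<Rightarrow> real"
  assumes "F \<in> Cc"
  obtains K L where "compact K" "compact L" "\<And>x y. x \<notin> K \<or> y \<notin> L \<Longrightarrow> F (x, y) = 0"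
proof -
  obtain C where C: "compact C" "\<And>p. p \<notin> C \<Longrightarrow> F p = 0" using Cc_support[OF assms] by blast
  have "compact (fst ` C)" "compact (snd ` C)"
    using C(1) by (auto intro!: compact_continuous_image continuous_intros)
  moreover have "F (x, y) = 0" if "x \<notin> fst ` C \<or> y \<notin> snd ` C" for x y
    using that C(2)[of "(x, y)"] by force
  ultimately show thesis using that by blast
qed

lemma Cc_slice:
  fixes F :: "'a::t2_space \<times> 'b::t2_space \<Rightarrow> real"
  assumes "F \<in> Cc"
  shows "(\<lambda>y. F (x, y)) \<in> Cc"
proof -
  obtain K L where KL: "compact K" "compact L" "\<And>x y. x \<notin> K \<or> y \<notin> L \<Longrightarrow> F (x, y) = 0"
    using Cc_prod_support[OF assms] by blast
  have "continuous_on UNIV (F \<circ> Pair x)"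
    by (intro continuous_on_compose continuous_on_subset[OF Cc_cont[OF assms]] continuous_intros) simp
  then show ?thesis unfolding Cc_iff using KL(2,3) by (auto simp: o_def)
qed

lemma Cc_swap:
  fixes F :: "'a::t2_space \<times> 'b::t2_space \<Rightarrow> real"
  assumes "F \<in> Cc"
  shows "(\<lambda>(y, x). F (x, y)) \<in> Cc"
proof -
  obtain K L where K: "compact K" "compact L" "\<And>x y. x \<notin> K \<or> y \<notin> L \<Longrightarrow> F (x, y) = 0"
    using Cc_prod_support[OF assms] by blast
  have "continuous_on UNIV (\<lambda>p. (snd p, fst p))"
    by (rule continuous_on_Pair[OF continuous_on_snd[OF continuous_on_id] continuous_on_fst[OF continuous_on_id]])
  then have "continuous_on UNIV (\<lambda>p. F (snd p, fst p))"
    by (rule continuous_on_compose2[OF Cc_cont[OF assms]]) simp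
  moreover have "compact (L \<times> K)" using K by (intro compact_Times)
  moreover have "\<forall>p. p \<notin> L \<times> K \<longrightarrow> F (snd p, fst p) = 0" using K(3) by auto
  ultimately have "(\<lambda>p. F (snd p, fst p)) \<in> Cc" unfolding Cc_iff by blast
  then show ?thesis by (simp add: case_prod_unfold)
qed

text \<open>The algebra to which the Stone--Weierstrass theorem will be applied.\<close>

inductive_set tensors :: "('a::topological_space \<times> 'b::topological_space \<Rightarrow> real) set" where
  tensor: "f \<in> Cc \<Longrightarrow> g \<in> Cc \<Longrightarrow> (\<lambda>(x, y). f x * g y) \<in> tensors"
| plus: "F \<in> tensors \<Longrightarrow> G \<in> tensors \<Longrightarrow> (\<lambda>p. F p + G p) \<in> tensors"

lemma tensors_Cc: "F \<in> tensors \<Longrightarrow> F \<in> Cc"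
  for F :: "'a::t2_space \<times> 'b::t2_space \<Rightarrow> real"
  by (induction rule: tensors.induct) (auto intro: Cc_tensor Cc_add)

lemma tensors_mult_tensor:
  fixes G :: "'a::t2_space \<times> 'b::t2_space \<Rightarrow> real"
  assumes "G \<in> tensors" "f \<in> Cc" "g \<in> Cc"
  shows "(\<lambda>p. f (fst p) * g (snd p) * G p) \<in> tensors"
  using assms(1)
proof (induction)
  case (tensor u v)
  have "(\<lambda>(x, y). (f x * u x) * (g y * v y)) \<in> tensors"
    using assms tensor by (intro tensors.tensor Cc_mult)
  then show ?case by (simp add: case_prod_unfold mult_ac)
next
  case (plus F G)
  from tensors.plus[OF plus.IH] show ?case by (simp add: distrib_left)
qed

lemma tensors_mult:
  fixes F G :: "'a::t2_space \<times> 'b::t2_space \<Rightarrow> real"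
  assumes "F \<in> tensors" "G \<in> tensors"
  shows "(\<lambda>p. F p * G p) \<in> tensors"
  using assms(1)
proof (induction)
  case (tensor f g)
  then show ?case using tensors_mult_tensor[OF assms(2), of f g] by (simp add: case_prod_unfold)
next
  case (plus F F')
  from tensors.plus[OF plus.IH] show ?case by (simp add: distrib_right)
qed

text \<open>Continuity of a signed Radon measure along functions dominated by multiples of one \<open>\<phi>\<close>.\<close>

lemma radon_bounded_on:
  fixes \<rho> :: "'a::t2_space radon"
  assumes "\<phi> \<in> Cc" "\<And>x. 0 \<le> \<phi> x"
  obtains B where "0 \<le> B" "\<And>H e. H \<in> Cc \<Longrightarrow> 0 \<le> e \<Longrightarrow> (\<And>x. \<bar>H x\<bar> \<le> e * \<phi> x) \<Longrightarrow> \<bar>integ \<rho> H\<bar> \<le> e * B"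
proof -
  obtain P Q where PQ: "P \<in> positive_radon" "Q \<in> positive_radon" "\<rho> = P - Q" by (rule radon_split)
  show thesis
  proof (rule that[of "integ P \<phi> + integ Q \<phi>"])
    show "0 \<le> integ P \<phi> + integ Q \<phi>" using PQ assms by (simp add: positive_radonD)
    fix H :: "'a \<Rightarrow> real" and e :: real assume H: "H \<in> Cc" "0 \<le> e" "\<And>x. \<bar>H x\<bar> \<le> e * \<phi> x"
    have "\<bar>integ P H\<bar> \<le> integ P (\<lambda>x. e * \<phi> x)" "\<bar>integ Q H\<bar> \<le> integ Q (\<lambda>x. e * \<phi> x)"
      using PQ H assms(1) by (auto intro!: integ_abs_le)
    then show "\<bar>integ \<rho> H\<bar> \<le> e * (integ P \<phi> + integ Q \<phi>)"
      using PQ(3) assms(1) by (simp add: integ_cmult distrib_left)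
  qed
qed

context locally_compact_Hausdorff
begin

lemma locally_compact_Hausdorff_prod: "locally_compact_Hausdorff TYPE('a \<times> 'a)"
proof
  have "locally_compact_space (prod_topology (euclidean :: 'a topology) (euclidean :: 'a topology))"
    using lc by (simp only: locally_compact_space_prod_topology simp_thms)
  then show "locally_compact_space (euclidean :: ('a \<times> 'a) topology)" by simp
qed

interpretation prod: locally_compact_Hausdorff "TYPE('a \<times> 'a)"
  by (rule locally_compact_Hausdorff_prod)

lemma Cc_separates:
  fixes x y :: 'a
  assumes "x \<noteq> y"
  obtains a where "a \<in> Cc" "a x = (1::real)" "a y = 0"
proof -
  have K: "compact {x}" "open (- {y})" "{x} \<subseteq> - {y}" using assms by auto
  obtain a C where a: "a \<in> Cc" "\<And>z. z \<in> {x} \<Longrightarrow> a z = (1::real)" "C \<subseteq> - {y}" "\<And>z. z \<notin> C \<Longrightarrow> a z = 0"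
    using Urysohn_Cc[OF K] by metis
  have "a x = 1" using a(2) by simp
  moreover have "a y = 0" using a(3) by (intro a(4)) auto
  ultimately show thesis using that a(1) by blast
qed

text \<open>
  Near \<open>x0\<close> the slices \<open>F(x, _)\<close> are uniformly close to \<open>F(x0, _)\<close> on the compact set that carries them.
\<close>

lemma Cc_partial_integral:
  fixes F :: "'a \<times> 'a \<Rightarrow> real"
  assumes \<nu>: "\<nu> \<in> positive_radon" and F: "F \<in> Cc"
  shows "(\<lambda>x. integ \<nu> (\<lambda>y. F (x, y))) \<in> Cc"
proof -
  obtain K L where K: "compact K" and L: "compact L" and 0: "\<And>x y. x \<notin> K \<or> y \<notin> L \<Longrightarrow> F (x, y) = 0"
    using Cc_prod_support[OF F] by blast
  obtain \<phi> where \<phi>: "\<phi> \<in> Cc" "\<And>x. 0 \<le> \<phi> x" "\<And>x. \<phi> x \<le> 1" "\<And>x. x \<in> L \<Longrightarrow> \<phi> x = 1"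
    using cutoff[OF L] by blast
  define c where "c = integ \<nu> \<phi>"
  have c: "0 \<le> c" unfolding c_def using \<nu> \<phi> by (intro positive_radonD)
  have "isCont (\<lambda>x. integ \<nu> (\<lambda>y. F (x, y))) x0" for x0
    unfolding isCont_def
  proof (rule tendstoI)
    fix e :: real assume e: "0 < e"
    define d where "d = e / (c + 1)"
    have d: "0 < d" "d * c < e" using e c by (auto simp: d_def field_simps)
    have "continuous_on (UNIV \<times> L) F" using Cc_cont[OF F] continuous_on_subset by blast
    then obtain V where V: "x0 \<in> V" "open V" "\<forall>x\<in>V \<inter> UNIV. \<forall>y\<in>L. dist (F (x, y)) (F (x0, y)) \<le> d"
      by (rule continuous_on_prod_compactE[OF _ L UNIV_I d(1)])
    have "dist (integ \<nu> (\<lambda>y. F (x, y))) (integ \<nu> (\<lambda>y. F (x0, y))) < e" if "x \<in> V" for x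
    proof -
      have "\<bar>F (x, y) - F (x0, y)\<bar> \<le> d * \<phi> y" for y
        using V(3) that \<phi>(2)[of y] \<phi>(4)[of y] 0[of x y] 0[of x0 y] d(1)
        by (cases "y \<in> L") (auto simp: dist_real_def)
      then have "\<bar>integ \<nu> (\<lambda>y. F (x, y) - F (x0, y))\<bar> \<le> integ \<nu> (\<lambda>y. d * \<phi> y)"
        using \<nu> \<phi>(1) F by (intro integ_abs_le Cc_diff Cc_slice) auto
      also have "\<dots> = d * c" using \<phi>(1) by (simp add: integ_cmult c_def)
      also have "\<dots> < e" by (rule d)
      finally show ?thesis using F by (simp add: integ_diff Cc_slice dist_real_def)
    qed
    then show "eventually (\<lambda>x. dist (integ \<nu> (\<lambda>y. F (x, y))) (integ \<nu> (\<lambda>y. F (x0, y))) < e) (at x0)"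
      using V by (auto simp: eventually_at_topological)
  qed
  then have "continuous_on UNIV (\<lambda>x. integ \<nu> (\<lambda>y. F (x, y)))"
    by (simp add: continuous_at_imp_continuous_on)
  moreover have "integ \<nu> (\<lambda>y. F (x, y)) = 0" if "x \<notin> K" for x
    using 0 that by simp
  ultimately show ?thesis unfolding Cc_iff using K by blast
qed

text \<open>
  Uniform approximation is not enough for measures of infinite mass; the error has to be bounded by
  multiples of one compactly supported function \<open>\<phi>\<close>. So \<open>F\<close> is approximated on a compact square
  by Stone--Weierstrass, and the approximation is multiplied by a product of cutoff functions that
  is \<open>1\<close> where \<open>F\<close> does not vanish.
\<close>

lemma tensors_dense:
  fixes F :: "'a \<times> 'a \<Rightarrow> real"
  assumes F: "F \<in> Cc"
  obtains \<phi> where "\<phi> \<in> Cc" "\<And>p. 0 \<le> \<phi> p"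
    "\<And>e. 0 < e \<Longrightarrow> \<exists>G\<in>tensors. \<forall>p. \<bar>F p - G p\<bar> \<le> e * \<phi> p"
proof -
  obtain K0 L0 where K0: "compact K0" "compact L0" "\<And>x y. x \<notin> K0 \<or> y \<notin> L0 \<Longrightarrow> F (x, y) = 0"
    using Cc_prod_support[OF F] by blast
  obtain f where f: "f \<in> Cc" "\<And>x. 0 \<le> f x" "\<And>x. f x \<le> 1" "\<And>x. x \<in> K0 \<union> L0 \<Longrightarrow> f x = 1"
    using cutoff[OF compact_Un[OF K0(1,2)]] by blast
  obtain K where K: "compact K" "\<And>x. x \<notin> K \<Longrightarrow> f x = 0" using Cc_support[OF f(1)] by blast
  obtain h where h: "h \<in> Cc" "\<And>x. 0 \<le> h x" "\<And>x. h x \<le> 1" "\<And>x. x \<in> K \<Longrightarrow> h x = (1::real)"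
    using cutoff[OF K(1)] by blast
  let ?S = "K \<times> K"
  let ?\<phi> = "\<lambda>p. f (fst p) * f (snd p)"
  define R where "R = {u :: 'a \<times> 'a \<Rightarrow> real. \<exists>G\<in>tensors. \<forall>p\<in>?S. u p = G p}"
  have tR: "(\<lambda>p. a (fst p) * b (snd p)) \<in> R" if "a \<in> Cc" "b \<in> Cc" for a b
    unfolding R_def using tensors.tensor[OF that]
    by (intro CollectI bexI[of _ "\<lambda>p. a (fst p) * b (snd p)"]) (auto simp: case_prod_unfold)
  interpret function_ring_on R ?S
  proof
    show "compact ?S" using K(1) by (intro compact_Times)
    show "continuous_on ?S u" if u: "u \<in> R" for u
    proof -
      obtain G where G: "G \<in> tensors" "\<forall>p\<in>?S. u p = G p" using u unfolding R_def by blast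
      have "continuous_on ?S G" using Cc_cont[OF tensors_Cc[OF G(1)]] continuous_on_subset by blast
      then show ?thesis using G(2) by (subst continuous_on_cong[OF refl, of ?S u G]) auto
    qed
    show "(\<lambda>p. u p + v p) \<in> R" if uv: "u \<in> R" "v \<in> R" for u v
    proof -
      obtain G H where "G \<in> tensors" "\<forall>p\<in>?S. u p = G p" "H \<in> tensors" "\<forall>p\<in>?S. v p = H p"
        using uv unfolding R_def by blast
      then show ?thesis unfolding R_def
        by (intro CollectI bexI[of _ "\<lambda>p. G p + H p"]) (auto intro: tensors.plus)
    qed
    show "(\<lambda>p. u p * v p) \<in> R" if uv: "u \<in> R" "v \<in> R" for u v
    proof -
      obtain G H where "G \<in> tensors" "\<forall>p\<in>?S. u p = G p" "H \<in> tensors" "\<forall>p\<in>?S. v p = H p"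
        using uv unfolding R_def by blast
      then show ?thesis unfolding R_def
        by (intro CollectI bexI[of _ "\<lambda>p. G p * H p"]) (auto intro: tensors_mult)
    qed
    show "(\<lambda>_. c) \<in> R" for c
    proof -
      have "(\<lambda>(x, y). (c * h x) * h y) \<in> tensors" using h(1) by (intro tensors.tensor) auto
      moreover have "\<forall>p\<in>?S. c = (\<lambda>(x, y). (c * h x) * h y) p" using h(4) by auto
      ultimately show ?thesis unfolding R_def by blast
    qed
    show "\<exists>u\<in>R. u p \<noteq> u q" if pq: "p \<in> ?S" "q \<in> ?S" "p \<noteq> q" for p q
    proof (cases "fst p = fst q")
      case False
      then obtain a where a: "a \<in> Cc" "a (fst p) = 1" "a (fst q) = 0" by (rule Cc_separates)
      have "h (snd p) = 1" using pq(1) by (intro h(4)) (simp add: mem_Times_iff)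
      then show ?thesis using a by (intro bexI[OF _ tR[OF a(1) h(1)]]) simp
    next
      case True
      then have "snd p \<noteq> snd q" using pq(3) by (simp add: prod_eq_iff)
      then obtain a where a: "a \<in> Cc" "a (snd p) = 1" "a (snd q) = 0" by (rule Cc_separates)
      have "h (fst p) = 1" using pq(1) by (intro h(4)) (simp add: mem_Times_iff)
      then show ?thesis using a by (intro bexI[OF _ tR[OF h(1) a(1)]]) simp
    qed
  qed
  show thesis
  proof (rule that[of ?\<phi>])
    show "?\<phi> \<in> Cc" using Cc_tensor[OF f(1) f(1)] by (simp add: case_prod_unfold)
    show "0 \<le> ?\<phi> p" for p using f(2) by simp
    fix e :: real assume "0 < e"
    have "continuous_on ?S F" using Cc_cont[OF F] continuous_on_subset by blast
    then obtain u where u: "u \<in> R" "\<forall>p\<in>?S. \<bar>F p - u p\<bar> < e"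
      using Stone_Weierstrass_basic \<open>0 < e\<close> by blast
    then obtain G where G: "G \<in> tensors" "\<forall>p\<in>?S. u p = G p" unfolding R_def by blast
    have "\<bar>F p - ?\<phi> p * G p\<bar> \<le> e * ?\<phi> p" for p
    proof (cases "p \<in> ?S")
      case True
      have "F p = ?\<phi> p * F p"
      proof (cases "F p = 0")
        case False
        then have "fst p \<in> K0" "snd p \<in> L0" using K0(3)[of "fst p" "snd p"] by auto
        then have "f (fst p) = 1" "f (snd p) = 1" by (intro f(4); simp)+
        then show ?thesis by simp
      qed simp
      then have "\<bar>F p - ?\<phi> p * G p\<bar> = ?\<phi> p * \<bar>F p - G p\<bar>"
        using f(2) by (metis abs_mult abs_of_nonneg mult_nonneg_nonneg right_diff_distrib)
      also have "\<dots> \<le> ?\<phi> p * e" using u(2) G(2) True f(2) by (intro mult_left_mono) (auto intro: less_imp_le)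
      finally show ?thesis by (simp add: mult.commute)
    next
      case False
      then have "?\<phi> p = 0" using K(2) by (cases p) auto
      moreover have "F p = 0"
      proof (rule ccontr)
        assume "F p \<noteq> 0"
        then have "fst p \<in> K0" "snd p \<in> L0" using K0(3)[of "fst p" "snd p"] by auto
        then have "f (fst p) = 1" "f (snd p) = 1" by (intro f(4); simp)+
        with \<open>?\<phi> p = 0\<close> show False by simp
      qed
      ultimately show ?thesis by (auto simp only: mult_zero_left mult_zero_right diff_self abs_zero)
    qed
    then show "\<exists>G\<in>tensors. \<forall>p. \<bar>F p - G p\<bar> \<le> e * ?\<phi> p"
      by (intro bexI[OF _ tensors_mult_tensor[OF G(1) f(1) f(1)]]) simp
  qed
qed

lemma radon_prod_eqI:
  fixes \<rho> \<sigma> :: "('a \<times> 'a) radon"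
  assumes eq: "\<And>f g. f \<in> Cc \<Longrightarrow> g \<in> Cc \<Longrightarrow>
    integ \<rho> (\<lambda>(x, y). f x * g y) = integ \<sigma> (\<lambda>(x, y). f x * g y)"
  shows "\<rho> = \<sigma>"
proof (rule radon_eqI)
  fix F :: "'a \<times> 'a \<Rightarrow> real" assume F: "F \<in> Cc"
  have t: "integ \<rho> G = integ \<sigma> G" if "G \<in> tensors" for G
    using that by induction (auto simp: eq integ_add tensors_Cc)
  obtain \<phi> where \<phi>: "\<phi> \<in> Cc" "\<And>p. 0 \<le> \<phi> p"
    and d: "\<And>e. 0 < e \<Longrightarrow> \<exists>G\<in>tensors. \<forall>p. \<bar>F p - G p\<bar> \<le> e * \<phi> p"
    using tensors_dense[OF F] by blast
  obtain B where B: "0 \<le> B" "\<And>H e. H \<in> Cc \<Longrightarrow> 0 \<le> e \<Longrightarrow> (\<And>x. \<bar>H x\<bar> \<le> e * \<phi> x) \<Longrightarrow> \<bar>integ (\<rho> - \<sigma>) H\<bar> \<le> e * B"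
    using radon_bounded_on[OF \<phi>] by blast
  have "\<bar>integ (\<rho> - \<sigma>) F\<bar> \<le> 0 + e" if e: "0 < e" for e
  proof -
    define d' where "d' = e / (B + 1)"
    have d': "0 < d'" "d' * B \<le> e" using e B(1) by (auto simp: d'_def field_simps)
    obtain G where G: "G \<in> tensors" "\<forall>p. \<bar>F p - G p\<bar> \<le> d' * \<phi> p" using d[OF d'(1)] by blast
    have "\<bar>integ (\<rho> - \<sigma>) (\<lambda>p. F p - G p)\<bar> \<le> d' * B"
      using G d'(1) F tensors_Cc[OF G(1)] by (intro B(2)) auto
    moreover have "integ (\<rho> - \<sigma>) (\<lambda>p. F p - G p) = integ (\<rho> - \<sigma>) F"
      using t[OF G(1)] integ_diff[OF F tensors_Cc[OF G(1)], of "\<rho> - \<sigma>"] by simp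
    ultimately show ?thesis using d'(2) by simp
  qed
  then have "\<bar>integ (\<rho> - \<sigma>) F\<bar> \<le> 0" by (rule field_le_epsilon)
  then show "integ \<rho> F = integ \<sigma> F" by simp
qed

lemma product_radon_eqI:
  fixes \<mu> \<nu> :: "'a radon"
  assumes "\<And>f g. f \<in> Cc \<Longrightarrow> g \<in> Cc \<Longrightarrow> integ \<rho> (\<lambda>(x, y). f x * g y) = integ \<mu> f * integ \<nu> g"
  shows "product_radon \<mu> \<nu> = \<rho>"
  unfolding product_radon_def
  by (rule the_equality) (use assms in \<open>auto intro!: radon_prod_eqI\<close>)

lemma positive_product_exists:
  fixes \<mu> \<nu> :: "'a radon"
  assumes \<mu>: "\<mu> \<in> positive_radon" and \<nu>: "\<nu> \<in> positive_radon"
  obtains \<rho> where "\<rho> \<in> positive_radon" "\<And>F. F \<in> Cc \<Longrightarrow> integ \<rho> F = integ \<mu> (\<lambda>x. integ \<nu> (\<lambda>y. F (x, y)))"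
    "\<And>f g. f \<in> Cc \<Longrightarrow> g \<in> Cc \<Longrightarrow> integ \<rho> (\<lambda>(x, y). f x * g y) = integ \<mu> f * integ \<nu> g"
proof -
  have "positive_functional (\<lambda>F. integ \<mu> (\<lambda>x. integ \<nu> (\<lambda>y. F (x, y))))"
    unfolding positive_functional_def
    using assms by (auto simp: integ_add integ_cmult Cc_slice Cc_partial_integral intro!: positive_radonD)
  then obtain \<rho> :: "('a \<times> 'a) radon" where \<rho>: "\<rho> \<in> positive_radon"
    "\<And>F. F \<in> Cc \<Longrightarrow> integ \<rho> F = integ \<mu> (\<lambda>x. integ \<nu> (\<lambda>y. F (x, y)))"
    using radon_of_functional by blast
  moreover have "integ \<rho> (\<lambda>(x, y). f x * g y) = integ \<mu> f * integ \<nu> g" if "f \<in> Cc" "g \<in> Cc" for f g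
    using that integ_cmult[OF that(1), of \<mu> "integ \<nu> g"] by (simp add: \<rho>(2) Cc_tensor integ_cmult mult.commute)
  ultimately show thesis using that by blast
qed

lemma product_radon_tensor:
  fixes \<mu> \<nu> :: "'a radon"
  assumes "f \<in> Cc" "g \<in> Cc"
  shows "integ (product_radon \<mu> \<nu>) (\<lambda>(x, y). f x * g y) = integ \<mu> f * integ \<nu> g"
proof -
  obtain P Q where P: "P \<in> positive_radon" "Q \<in> positive_radon" "\<mu> = P - Q" by (rule radon_split)
  obtain R S where R: "R \<in> positive_radon" "S \<in> positive_radon" "\<nu> = R - S" by (rule radon_split)
  obtain a where a: "\<And>f g. f \<in> Cc \<Longrightarrow> g \<in> Cc \<Longrightarrow> integ a (\<lambda>(x, y). f x * g y) = integ P f * integ R g"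
    using positive_product_exists[OF P(1) R(1)] by metis
  obtain b where b: "\<And>f g. f \<in> Cc \<Longrightarrow> g \<in> Cc \<Longrightarrow> integ b (\<lambda>(x, y). f x * g y) = integ P f * integ S g"
    using positive_product_exists[OF P(1) R(2)] by metis
  obtain c where c: "\<And>f g. f \<in> Cc \<Longrightarrow> g \<in> Cc \<Longrightarrow> integ c (\<lambda>(x, y). f x * g y) = integ Q f * integ R g"
    using positive_product_exists[OF P(2) R(1)] by metis
  obtain d where d: "\<And>f g. f \<in> Cc \<Longrightarrow> g \<in> Cc \<Longrightarrow> integ d (\<lambda>(x, y). f x * g y) = integ Q f * integ S g"
    using positive_product_exists[OF P(2) R(2)] by metis
  have *: "integ (a + d - b - c) (\<lambda>(x, y). f x * g y) = integ \<mu> f * integ \<nu> g" if "f \<in> Cc" "g \<in> Cc" for f g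
    using that by (simp add: a b c d P(3) R(3) algebra_simps)
  then have "product_radon \<mu> \<nu> = a + d - b - c" by (rule product_radon_eqI)
  with * assms show ?thesis by simp
qed

lemma product_radon_positive:
  fixes \<mu> \<nu> :: "'a radon"
  assumes "\<mu> \<in> positive_radon" "\<nu> \<in> positive_radon"
  shows "product_radon \<mu> \<nu> \<in> positive_radon"
    and "F \<in> Cc \<Longrightarrow> integ (product_radon \<mu> \<nu>) F = integ \<mu> (\<lambda>x. integ \<nu> (\<lambda>y. F (x, y)))"
proof -
  obtain \<rho> where \<rho>: "\<rho> \<in> positive_radon" "\<And>F. F \<in> Cc \<Longrightarrow> integ \<rho> F = integ \<mu> (\<lambda>x. integ \<nu> (\<lambda>y. F (x, y)))"
    "\<And>f g. f \<in> Cc \<Longrightarrow> g \<in> Cc \<Longrightarrow> integ \<rho> (\<lambda>(x, y). f x * g y) = integ \<mu> f * integ \<nu> g"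
    using positive_product_exists[OF assms] by blast
  have "product_radon \<mu> \<nu> = \<rho>" using \<rho>(3) by (rule product_radon_eqI)
  with \<rho> show "product_radon \<mu> \<nu> \<in> positive_radon"
    "F \<in> Cc \<Longrightarrow> integ (product_radon \<mu> \<nu>) F = integ \<mu> (\<lambda>x. integ \<nu> (\<lambda>y. F (x, y)))" by auto
qed

lemma product_radon_linear:
  fixes \<mu> \<nu> \<tau> :: "'a radon"
  shows product_radon_add_left: "product_radon (\<mu> + \<nu>) \<tau> = product_radon \<mu> \<tau> + product_radon \<nu> \<tau>"
    and product_radon_add_right: "product_radon \<tau> (\<mu> + \<nu>) = product_radon \<tau> \<mu> + product_radon \<tau> \<nu>"
    and product_radon_diff_left: "product_radon (\<mu> - \<nu>) \<tau> = product_radon \<mu> \<tau> - product_radon \<nu> \<tau>"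
    and product_radon_diff_right: "product_radon \<tau> (\<mu> - \<nu>) = product_radon \<tau> \<mu> - product_radon \<tau> \<nu>"
    and product_radon_scale_left: "product_radon (c *\<^sub>R \<mu>) \<tau> = c *\<^sub>R product_radon \<mu> \<tau>"
    and product_radon_scale_right: "product_radon \<tau> (c *\<^sub>R \<mu>) = c *\<^sub>R product_radon \<tau> \<mu>"
  by (rule product_radon_eqI; simp add: product_radon_tensor algebra_simps)+

lemma product_radon_swap:
  fixes \<mu> \<nu> :: "'a radon"
  assumes "\<mu> \<in> positive_radon" "\<nu> \<in> positive_radon" "F \<in> Cc"
  shows "integ (product_radon \<nu> \<mu>) F = integ (product_radon \<mu> \<nu>) (\<lambda>(x, y). F (y, x))"
proof -
  note sw = Cc_swap
  have "positive_functional (\<lambda>F. integ (product_radon \<mu> \<nu>) (\<lambda>(x, y). F (y, x)))"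
    unfolding positive_functional_def
  proof (intro conjI ballI allI impI)
    fix F G :: "'a \<times> 'a \<Rightarrow> real" and c :: real assume F: "F \<in> Cc"
    show "integ (product_radon \<mu> \<nu>) (\<lambda>(x, y). F (y, x) + G (y, x)) =
        integ (product_radon \<mu> \<nu>) (\<lambda>(x, y). F (y, x)) + integ (product_radon \<mu> \<nu>) (\<lambda>(x, y). G (y, x))" if G: "G \<in> Cc"
      using integ_add[OF sw[OF F] sw[OF G]] by (simp add: case_prod_unfold)
    show "integ (product_radon \<mu> \<nu>) (\<lambda>(x, y). c * F (y, x)) = c * integ (product_radon \<mu> \<nu>) (\<lambda>(x, y). F (y, x))"
      using integ_cmult[OF sw[OF F]] by (simp add: case_prod_unfold)
    show "0 \<le> integ (product_radon \<mu> \<nu>) (\<lambda>(x, y). F (y, x))" if "\<forall>p. 0 \<le> F p"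
      using product_radon_positive(1)[OF assms(1,2)] sw[OF F] that by (intro positive_radonD) auto
  qed
  then obtain \<rho> :: "('a \<times> 'a) radon"
    where \<rho>: "\<And>F. F \<in> Cc \<Longrightarrow> integ \<rho> F = integ (product_radon \<mu> \<nu>) (\<lambda>(x, y). F (y, x))"
    using radon_of_functional by blast
  have "product_radon \<nu> \<mu> = \<rho>"
  proof (rule product_radon_eqI)
    fix f g :: "'a \<Rightarrow> real" assume "f \<in> Cc" "g \<in> Cc"
    then show "integ \<rho> (\<lambda>(x, y). f x * g y) = integ \<nu> f * integ \<mu> g"
      using product_radon_tensor[of g f \<mu> \<nu>] by (simp add: \<rho> Cc_tensor mult.commute)
  qed
  then show ?thesis using \<rho> assms by simp
qed

text \<open>
  Tonelli's theorem for lower semicontinuous functions. Radon measures need not be \<open>\<sigma>\<close>-finite, and the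
  Borel sets of the square need not be generated by rectangles, so the argument does not run through
  product measures: \<open>k\<close> is the supremum of the directed family of its minorants, and against these the
  product acts as an iterated integral.
\<close>

lemma lsc_integral_prod_SUP:
  fixes k :: "'a \<times> 'a \<Rightarrow> ennreal"
  assumes \<nu>: "\<nu> \<in> positive_radon" and k: "lsc k"
  shows "lsc_integral \<nu> (\<lambda>y. k (x, y)) = (SUP F\<in>minorants k. ennreal (integ \<nu> (\<lambda>y. F (x, y))))"
proof -
  have "lsc_integral \<nu> (\<lambda>y. k (x, y)) = lsc_integral \<nu> (\<lambda>y. SUP F\<in>minorants k. ennreal (F (x, y)))"
    using prod.lsc_eq_SUP_minorants[OF k] by simp
  also have "\<dots> = (SUP F\<in>minorants k. lsc_integral \<nu> (\<lambda>y. ennreal (F (x, y))))"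
  proof (rule lsc_integral_SUP_directed[OF \<nu>])
    show "lsc (\<lambda>y. ennreal (F (x, y)))" if "F \<in> minorants k" for F
      using minorantsD(1)[OF that] by (intro lsc_ennreal Cc_cont Cc_slice)
    fix F G assume "F \<in> minorants k" "G \<in> minorants k"
    from minorants_max[OF this]
    show "\<exists>H\<in>minorants k. \<forall>y. ennreal (F (x, y)) \<le> ennreal (H (x, y)) \<and> ennreal (G (x, y)) \<le> ennreal (H (x, y))"
      by (rule bexI[rotated]) (auto intro!: ennreal_leI)
  qed simp
  also have "\<dots> = (SUP F\<in>minorants k. ennreal (integ \<nu> (\<lambda>y. F (x, y))))"
    using \<nu> by (intro SUP_cong refl lsc_integral_Cc) (auto simp: minorantsD intro: Cc_slice)
  finally show ?thesis .
qed

lemma lsc_partial_integral: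
  fixes k :: "'a \<times> 'a \<Rightarrow> ennreal"
  assumes "\<nu> \<in> positive_radon" "lsc k"
  shows "lsc (\<lambda>x. lsc_integral \<nu> (\<lambda>y. k (x, y)))"
  unfolding lsc_integral_prod_SUP[OF assms]
  using assms by (intro lsc_SUP lsc_ennreal Cc_cont Cc_partial_integral) (auto simp: minorantsD)

lemma lsc_integral_Tonelli:
  fixes k :: "'a \<times> 'a \<Rightarrow> ennreal"
  assumes \<mu>: "\<mu> \<in> positive_radon" and \<nu>: "\<nu> \<in> positive_radon" and k: "lsc k"
  shows "lsc_integral (product_radon \<mu> \<nu>) k = lsc_integral \<mu> (\<lambda>x. lsc_integral \<nu> (\<lambda>y. k (x, y)))"
proof -
  have C: "(\<lambda>x. integ \<nu> (\<lambda>y. F (x, y))) \<in> Cc" and p: "0 \<le> integ \<nu> (\<lambda>y. F (x, y))"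
    if "F \<in> minorants k" for F x
    using minorantsD(1,2)[OF that] \<nu> by (auto intro!: Cc_partial_integral positive_radonD Cc_slice)
  have "lsc_integral \<mu> (\<lambda>x. lsc_integral \<nu> (\<lambda>y. k (x, y))) =
      (SUP F\<in>minorants k. lsc_integral \<mu> (\<lambda>x. ennreal (integ \<nu> (\<lambda>y. F (x, y)))))"
    unfolding lsc_integral_prod_SUP[OF \<nu> k]
  proof (rule lsc_integral_SUP_directed[OF \<mu>])
    show "lsc (\<lambda>x. ennreal (integ \<nu> (\<lambda>y. F (x, y))))" if "F \<in> minorants k" for F
      using C[OF that] by (intro lsc_ennreal Cc_cont)
    fix F G assume FG: "F \<in> minorants k" "G \<in> minorants k"
    have m: "(\<lambda>p. max (F p) (G p)) \<in> minorants k" using FG by (rule minorants_max)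
    have "integ \<nu> (\<lambda>y. F (x, y)) \<le> integ \<nu> (\<lambda>y. max (F (x, y)) (G (x, y)))"
      "integ \<nu> (\<lambda>y. G (x, y)) \<le> integ \<nu> (\<lambda>y. max (F (x, y)) (G (x, y)))" for x
      using minorantsD(1)[OF FG(1)] minorantsD(1)[OF FG(2)] \<nu>
      by (auto intro!: integ_mono Cc_max Cc_slice)
    then show "\<exists>H\<in>minorants k. \<forall>x. ennreal (integ \<nu> (\<lambda>y. F (x, y))) \<le> ennreal (integ \<nu> (\<lambda>y. H (x, y))) \<and>
        ennreal (integ \<nu> (\<lambda>y. G (x, y))) \<le> ennreal (integ \<nu> (\<lambda>y. H (x, y)))"
      by (intro bexI[OF _ m]) (auto intro!: ennreal_leI)
  qed simp
  also have "\<dots> = (SUP F\<in>minorants k. ennreal (integ (product_radon \<mu> \<nu>) F))"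
    using \<mu> \<nu> C p by (intro SUP_cong refl)
      (auto simp: lsc_integral_Cc product_radon_positive(2) minorantsD)
  finally show ?thesis by (simp add: lsc_integral_minorants)
qed

lemma lsc_integral_product_commute:
  fixes k :: "'a \<times> 'a \<Rightarrow> ennreal"
  assumes \<mu>: "\<mu> \<in> positive_radon" and \<nu>: "\<nu> \<in> positive_radon" and sym: "\<And>x y. k (x, y) = k (y, x)"
  shows "lsc_integral (product_radon \<mu> \<nu>) k = lsc_integral (product_radon \<nu> \<mu>) k"
proof -
  have "lsc_integral (product_radon \<nu> \<mu>) k \<le> lsc_integral (product_radon \<mu> \<nu>) k"
    if \<mu>: "\<mu> \<in> positive_radon" and \<nu>: "\<nu> \<in> positive_radon" for \<mu> \<nu> :: "'a radon"
    unfolding lsc_integral_minorants[of "product_radon \<nu> \<mu>"]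
  proof (rule SUP_least)
    fix F assume F: "F \<in> minorants k"
    have "(\<lambda>(x, y). F (y, x)) \<in> Cc" using minorantsD(1)[OF F] by (rule Cc_swap)
    then have "(\<lambda>(x, y). F (y, x)) \<in> minorants k"
      using minorantsD(2,3)[OF F] sym by (auto simp: minorants_def case_prod_unfold) (metis prod.collapse)
    from lsc_integral_upper[OF this, of "product_radon \<mu> \<nu>"]
    show "ennreal (integ (product_radon \<nu> \<mu>) F) \<le> lsc_integral (product_radon \<mu> \<nu>) k"
      using product_radon_swap[OF \<mu> \<nu> minorantsD(1)[OF F]] by simp
  qed
  from this[OF \<mu> \<nu>] this[OF \<nu> \<mu>] show ?thesis by (rule antisym[rotated])
qed

text \<open>
  Half of the formula \<open>(\<mu> \<otimes> \<mu>)\<^sup>+ = \<mu>\<^sup>+ \<otimes> \<mu>\<^sup>+ + \<mu>\<^sup>- \<otimes> \<mu>\<^sup>-\<close>, the half that transfers finiteness of energy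
  from \<open>\<mu>\<close> to \<open>\<mu>\<^sup>+\<close> and \<open>\<mu>\<^sup>-\<close>. If \<open>g\<close> and \<open>f - g\<close> separate \<open>\<mu>\<^sup>+\<close> from \<open>\<mu>\<^sup>-\<close>, then
  \<open>g \<otimes> g + (f - g) \<otimes> (f - g)\<close> is nearly \<open>f \<otimes> f\<close> for the two measures on the right and nearly \<open>0\<close>
  for \<open>\<mu>\<^sup>+ \<otimes> \<mu>\<^sup>-\<close> and \<open>\<mu>\<^sup>- \<otimes> \<mu>\<^sup>+\<close>.
\<close>

lemma pos_part_product_ge:
  fixes \<mu> :: "'a radon"
  defines "P \<equiv> pos_part \<mu>" and "Q \<equiv> neg_part \<mu>"
  shows "pos_part (product_radon \<mu> \<mu>) - (product_radon P P + product_radon Q Q) \<in> positive_radon"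
proof (rule positive_radonI)
  fix F :: "'a \<times> 'a \<Rightarrow> real" assume F: "F \<in> Cc" "\<And>p. 0 \<le> F p"
  have P: "P \<in> positive_radon" and Q: "Q \<in> positive_radon" and PQ: "\<mu> = P - Q"
    unfolding P_def Q_def by (simp_all add: pos_part_positive neg_part_positive pos_part_minus_neg_part)
  note pp = product_radon_positive(1)
  obtain K L where K: "compact K" "compact L" "\<And>x y. x \<notin> K \<or> y \<notin> L \<Longrightarrow> F (x, y) = 0"
    using Cc_prod_support[OF F(1)] by blast
  obtain f where f: "f \<in> Cc" "\<And>x. 0 \<le> f x" "\<And>x. f x \<le> 1" "\<And>x. x \<in> K \<union> L \<Longrightarrow> f x = 1"
    using cutoff[OF compact_Un[OF K(1,2)]] by blast
  obtain C where C: "0 < C" "\<And>p. \<bar>F p\<bar> \<le> C" using Cc_bounded[OF F(1)] by blast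
  have Ff: "F (x, y) \<le> C * (f x * f y)" for x y
  proof (cases "x \<in> K \<and> y \<in> L")
    case True
    then show ?thesis using f(4)[of x] f(4)[of y] C(2)[of "(x, y)"] by auto
  next
    case False
    then show ?thesis using K(3)[of x y] C(1) f(2)[of x] f(2)[of y] by auto
  qed
  define b where "b = integ P f + integ Q f"
  have bP: "0 \<le> integ P f" "0 \<le> integ Q f"
    using P Q f(1,2) by (auto intro!: positive_radonD)
  have "integ (product_radon P P) F + integ (product_radon Q Q) F \<le> integ (pos_part (product_radon \<mu> \<mu>)) F + e"
    if e: "0 < e" for e
  proof -
    define d where "d = e / (4 * C * b + 1)"
    have b: "0 \<le> b" using bP by (simp add: b_def)
    have "0 \<le> 4 * C * b" using C(1) b by simp
    then have d: "0 < d" "4 * C * d * b \<le> e" using e by (auto simp: d_def field_simps)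
    obtain g where g: "g \<in> Cc" "\<And>x. 0 \<le> g x" "\<And>x. g x \<le> f x" "integ Q g < d" "integ P (\<lambda>x. f x - g x) < d"
      using Jordan_singular[OF f(1,2) d(1), of \<mu>] unfolding P_def Q_def by blast
    \<comment> \<open>\<open>P\<close> hardly charges \<open>h\<close>, and \<open>Q\<close> hardly charges \<open>g\<close>\<close>
    define h where "h x = f x - g x" for x
    have h: "h \<in> Cc" "\<And>x. 0 \<le> h x" "\<And>x. h x \<le> f x" "integ P h < d"
      using g f(1) by (auto simp: h_def[abs_def])
    have n: "0 \<le> integ P g" "0 \<le> integ Q g" "0 \<le> integ P h" "0 \<le> integ Q h"
      using P Q g h by (auto intro!: positive_radonD)
    have u: "integ P g \<le> integ P f" "integ Q g \<le> integ Q f" "integ P h \<le> integ P f" "integ Q h \<le> integ Q f"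
      using P Q g h f by (auto intro!: integ_mono)
    define t where "t u v = (\<lambda>(x, y). u x * v y)" for u v :: "'a \<Rightarrow> real"
    have tC: "t u v \<in> Cc" if "u \<in> Cc" "v \<in> Cc" for u v unfolding t_def using that by (rule Cc_tensor)
    have ti: "integ (product_radon \<alpha> \<beta>) (t u v) = integ \<alpha> u * integ \<beta> v" if "u \<in> Cc" "v \<in> Cc" for u v \<alpha> \<beta>
      unfolding t_def using that by (rule product_radon_tensor)
    define H where "H p = C * (t g g p + t h h p)" for p
    define H' where "H' p = C * (t g h p + t h g p)" for p
    have HC: "H \<in> Cc" "H' \<in> Cc" unfolding H_def[abs_def] H'_def[abs_def] using tC g(1) h(1) by auto
    define G where "G p = min (F p) (H p)" for p
    have GC: "G \<in> Cc" unfolding G_def[abs_def] using F(1) HC(1) by (rule Cc_min)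
    have H0: "0 \<le> H p" for p using C(1) g(2) h(2) by (cases p) (auto simp: H_def t_def)
    have G0: "0 \<le> G p" "G p \<le> F p" "G p \<le> H p" for p using F(2)[of p] H0[of p] by (auto simp: G_def)
    have FG: "F p - G p \<le> H' p" for p
    proof (cases p)
      case (Pair x y)
      have "0 \<le> H' p" using C(1) g(2) h(2) Pair by (auto simp: H'_def t_def)
      moreover have "F p - H p \<le> H' p"
        using Ff[of x y] Pair unfolding H_def H'_def t_def h_def by (simp add: algebra_simps)
      ultimately show ?thesis by (auto simp: G_def min_def)
    qed
    have diag: "integ (product_radon \<alpha> \<alpha>) F - integ (product_radon \<alpha> \<alpha>) G \<le> 2 * C * (integ \<alpha> g * integ \<alpha> h)"
      if \<alpha>: "\<alpha> \<in> positive_radon" for \<alpha>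
    proof -
      have "integ (product_radon \<alpha> \<alpha>) F - integ (product_radon \<alpha> \<alpha>) G = integ (product_radon \<alpha> \<alpha>) (\<lambda>p. F p - G p)"
        using F(1) GC by (simp add: integ_diff)
      also have "\<dots> \<le> integ (product_radon \<alpha> \<alpha>) H'"
        using \<alpha> F(1) GC HC FG by (intro integ_mono pp Cc_diff)
      also have "\<dots> = 2 * C * (integ \<alpha> g * integ \<alpha> h)"
        unfolding H'_def[abs_def] using tC g(1) h(1) by (simp add: integ_cmult integ_add ti algebra_simps)
      finally show ?thesis .
    qed
    have off: "integ (product_radon \<alpha> \<beta>) G \<le> C * (integ \<alpha> g * integ \<beta> g + integ \<alpha> h * integ \<beta> h)"
      if "\<alpha> \<in> positive_radon" "\<beta> \<in> positive_radon" for \<alpha> \<beta>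
    proof -
      have "integ (product_radon \<alpha> \<beta>) G \<le> integ (product_radon \<alpha> \<beta>) H"
        using that GC HC G0 by (intro integ_mono pp)
      also have "\<dots> = C * (integ \<alpha> g * integ \<beta> g + integ \<alpha> h * integ \<beta> h)"
        unfolding H_def[abs_def] using tC g(1) h(1) by (simp add: integ_cmult integ_add ti)
      finally show ?thesis .
    qed
    have Pgh: "2 * C * (integ P g * integ P h) \<le> 2 * C * (integ P f * d)"
      and Qgh: "2 * C * (integ Q g * integ Q h) \<le> 2 * C * (d * integ Q f)"
      using C(1) g(4) h(4) n u d(1) bP by (intro mult_left_mono mult_mono; simp)+
    have PQg: "C * (integ P g * integ Q g + integ P h * integ Q h) \<le> C * (integ P f * d + d * integ Q f)"
      using C(1) g(4) h(4) n u d(1) bP by (intro mult_left_mono add_mono mult_mono) auto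
    have "integ (product_radon \<mu> \<mu>) G \<le> integ (pos_part (product_radon \<mu> \<mu>)) F"
      using F(1) GC G0 by (intro pos_part_upper)
    moreover have "integ (product_radon \<mu> \<mu>) G = integ (product_radon P P) G + integ (product_radon Q Q) G
        - integ (product_radon P Q) G - integ (product_radon Q P) G"
      unfolding PQ by (simp add: product_radon_diff_left product_radon_diff_right)
    moreover have "2 * C * (integ P f * d) + 2 * C * (d * integ Q f) + 2 * (C * (integ P f * d + d * integ Q f)) = 4 * C * d * b"
      by (simp add: b_def algebra_simps)
    moreover have "integ (product_radon Q P) G \<le> C * (integ P g * integ Q g + integ P h * integ Q h)"
      using off[OF Q P] by (simp add: mult.commute)
    ultimately show ?thesis using diag[OF P] diag[OF Q] off[OF P Q] Pgh Qgh PQg d(2) by linarith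
  qed
  then have "integ (product_radon P P) F + integ (product_radon Q Q) F \<le> integ (pos_part (product_radon \<mu> \<mu>)) F"
    by (rule field_le_epsilon)
  then show "0 \<le> integ (pos_part (product_radon \<mu> \<mu>) - (product_radon P P + product_radon Q Q)) F" by simp
qed

end

section \<open>The energy form\<close>

text \<open>
  Mutual energy and potential of positive measures are taken in \<open>[0, \<infinity>]\<close>, where sums and Tonelli's
  theorem are unconditional; the versions for signed measures are reduced to these.
\<close>

definition mutual :: "('a::topological_space \<Rightarrow> 'a \<Rightarrow> ennreal) \<Rightarrow> 'a radon \<Rightarrow> 'a radon \<Rightarrow> ennreal" where
  "mutual \<kappa> \<mu> \<nu> = lsc_integral (product_radon \<mu> \<nu>) (\<lambda>(x, y). \<kappa> x y)"

definition pot :: "('a::topological_space \<Rightarrow> 'a \<Rightarrow> ennreal) \<Rightarrow> 'a radon \<Rightarrow> 'a \<Rightarrow> ennreal" where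
  "pot \<kappa> \<mu> x = lsc_integral \<mu> (\<kappa> x)"

definition inner_energy :: "('a::topological_space \<Rightarrow> 'a \<Rightarrow> ennreal) \<Rightarrow> 'a radon \<Rightarrow> 'a radon \<Rightarrow> real" where
  "inner_energy \<kappa> \<mu> \<nu> = real_of_ereal (energy \<kappa> \<mu> \<nu>)"

lemma potential_positive:
  fixes \<mu> :: "'a::t2_space radon"
  shows "\<mu> \<in> positive_radon \<Longrightarrow> potential \<kappa> \<mu> x = enn2ereal (pot \<kappa> \<mu> x)"
  by (simp add: potential_def signed_integral_def pot_def pos_part_of_positive neg_part_of_positive zero_ennreal.rep_eq)

text \<open>
  The integral against \<open>\<rho> = P - Q\<close> can be computed from any decomposition into positive measures, not
  only that of Hahn and Jordan, since \<open>P + \<rho>\<^sup>- = Q + \<rho>\<^sup>+\<close>.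
\<close>

lemma signed_integral_diff:
  fixes P Q :: "'a::t2_space radon"
  assumes P: "P \<in> positive_radon" and Q: "Q \<in> positive_radon"
    and fin: "lsc_integral P f < top" "lsc_integral Q f < top"
  shows "signed_integral_defined (P - Q) f"
    and "signed_integral (P - Q) f = ereal (enn2real (lsc_integral P f) - enn2real (lsc_integral Q f))"
proof -
  let ?p = "pos_part (P - Q)" and ?n = "neg_part (P - Q)"
  have n: "?n = pos_part (Q - P)" by (simp add: neg_part_def)
  have "lsc_integral ?p f \<le> lsc_integral P f"
    using pos_part_positive pos_part_le[OF P Q] by (rule lsc_integral_mono_measure)
  then have 1: "lsc_integral ?p f < top" using fin(1) by (rule order_le_less_trans)
  have "lsc_integral ?n f \<le> lsc_integral Q f"
    unfolding n using pos_part_positive pos_part_le[OF Q P] by (rule lsc_integral_mono_measure)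
  then have 2: "lsc_integral ?n f < top" using fin(2) by (rule order_le_less_trans)
  show "signed_integral_defined (P - Q) f" using 1 by (simp add: signed_integral_defined_def)
  have "P + ?n = Q + ?p" using pos_part_minus_neg_part[of "P - Q"] by (simp add: algebra_simps)
  then have "lsc_integral P f + lsc_integral ?n f = lsc_integral Q f + lsc_integral ?p f"
    using P Q pos_part_positive neg_part_positive by (metis lsc_integral_add_measure)
  then have "enn2real (lsc_integral P f) + enn2real (lsc_integral ?n f) =
      enn2real (lsc_integral Q f) + enn2real (lsc_integral ?p f)"
    using fin 1 2 by (metis enn2real_plus)
  moreover have "signed_integral (P - Q) f = ereal (enn2real (lsc_integral ?p f) - enn2real (lsc_integral ?n f))"
    unfolding signed_integral_def using 1 2
    by (cases "lsc_integral ?p f"; cases "lsc_integral ?n f") simp_all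
  ultimately show "signed_integral (P - Q) f = ereal (enn2real (lsc_integral P f) - enn2real (lsc_integral Q f))"
    by simp
qed

locale kernel_space = locally_compact_Hausdorff T for T :: "'a::t2_space itself" +
  fixes \<kappa> :: "'a \<Rightarrow> 'a \<Rightarrow> ennreal"
  assumes kernel: "is_kernel \<kappa>"
begin

lemma kernel_sym: "\<kappa> x y = \<kappa> y x"
  using kernel by (simp add: is_kernel_def)

lemma lsc_kernel: "lsc (\<lambda>(x, y). \<kappa> x y)"
  using kernel by (simp add: is_kernel_def lsc_def case_prod_unfold)

lemma lsc_pot: "\<mu> \<in> positive_radon \<Longrightarrow> lsc (pot \<kappa> \<mu>)"
  using lsc_partial_integral[OF _ lsc_kernel] by (simp add: pot_def[abs_def])

lemma mutual_pot:
  assumes "\<mu> \<in> positive_radon" "\<nu> \<in> positive_radon"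
  shows "mutual \<kappa> \<mu> \<nu> = lsc_integral \<mu> (pot \<kappa> \<nu>)"
  using lsc_integral_Tonelli[OF assms lsc_kernel] by (simp add: mutual_def pot_def[abs_def])

lemma mutual_commute:
  assumes "\<mu> \<in> positive_radon" "\<nu> \<in> positive_radon"
  shows "mutual \<kappa> \<mu> \<nu> = mutual \<kappa> \<nu> \<mu>"
  unfolding mutual_def by (rule lsc_integral_product_commute[OF assms]) (simp add: kernel_sym)

lemma mutual_add_left:
  assumes "\<mu> \<in> positive_radon" "\<nu> \<in> positive_radon" "\<tau> \<in> positive_radon"
  shows "mutual \<kappa> (\<mu> + \<nu>) \<tau> = mutual \<kappa> \<mu> \<tau> + mutual \<kappa> \<nu> \<tau>"
  using assms by (simp add: mutual_def product_radon_add_left lsc_integral_add_measure product_radon_positive)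

lemma mutual_scale_left:
  assumes "\<mu> \<in> positive_radon" "\<tau> \<in> positive_radon" "0 \<le> c"
  shows "mutual \<kappa> (c *\<^sub>R \<mu>) \<tau> = ennreal c * mutual \<kappa> \<mu> \<tau>"
  using assms by (simp add: mutual_def product_radon_scale_left lsc_integral_scale_measure product_radon_positive)

lemma mutual_add_right:
  assumes "\<mu> \<in> positive_radon" "\<nu> \<in> positive_radon" "\<tau> \<in> positive_radon"
  shows "mutual \<kappa> \<tau> (\<mu> + \<nu>) = mutual \<kappa> \<tau> \<mu> + mutual \<kappa> \<tau> \<nu>"
  using assms by (simp add: mutual_def product_radon_add_right lsc_integral_add_measure product_radon_positive)

lemma mutual_scale_right:
  assumes "\<mu> \<in> positive_radon" "\<tau> \<in> positive_radon" "0 \<le> c"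
  shows "mutual \<kappa> \<tau> (c *\<^sub>R \<mu>) = ennreal c * mutual \<kappa> \<tau> \<mu>"
  using assms by (simp add: mutual_def product_radon_scale_right lsc_integral_scale_measure product_radon_positive)

lemma mutual_mono_left:
  assumes "\<mu> \<in> positive_radon" "\<nu> - \<mu> \<in> positive_radon" "\<tau> \<in> positive_radon"
  shows "mutual \<kappa> \<mu> \<tau> \<le> mutual \<kappa> \<nu> \<tau>"
  using mutual_add_left[OF assms] by simp

abbreviation Epos :: "'a radon set" where "Epos \<equiv> finite_energy_pos \<kappa>"

abbreviation ip :: "'a radon \<Rightarrow> 'a radon \<Rightarrow> real" where "ip \<equiv> inner_energy \<kappa>"

lemma energy_positive:
  assumes "\<mu> \<in> positive_radon" "\<nu> \<in> positive_radon"
  shows "energy \<kappa> \<mu> \<nu> = enn2ereal (mutual \<kappa> \<mu> \<nu>)" "energy_defined \<kappa> \<mu> \<nu>"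
  using product_radon_positive(1)[OF assms]
  by (simp_all add: energy_def energy_defined_def signed_integral_def signed_integral_defined_def
      mutual_def pos_part_of_positive neg_part_of_positive zero_ennreal.rep_eq)

lemma Epos_iff: "\<mu> \<in> Epos \<longleftrightarrow> \<mu> \<in> positive_radon \<and> mutual \<kappa> \<mu> \<mu> < top"
proof (cases "\<mu> \<in> positive_radon")
  case True
  have fin: "\<bar>enn2ereal t\<bar> < \<infinity> \<longleftrightarrow> t < top" for t
    by (cases t) simp_all
  show ?thesis
    unfolding finite_energy_pos_def finite_energy_def Int_iff mem_Collect_eq energy_positive(1)[OF True True] fin
    using True energy_positive(2)[OF True True] by blast
qed (simp add: finite_energy_pos_def)

lemma EposD: "\<mu> \<in> Epos \<Longrightarrow> \<mu> \<in> positive_radon" "\<mu> \<in> Epos \<Longrightarrow> \<mu> \<in> finite_energy \<kappa>"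
  by (auto simp: finite_energy_pos_def)

lemma Epos_scale: "\<mu> \<in> Epos \<Longrightarrow> 0 \<le> c \<Longrightarrow> c *\<^sub>R \<mu> \<in> Epos"
  by (simp add: Epos_iff mutual_scale_left mutual_scale_right ennreal_mult_less_top)

lemma Epos_mono:
  assumes "\<mu> \<in> positive_radon" "\<nu> - \<mu> \<in> positive_radon" "\<nu> \<in> Epos"
  shows "\<mu> \<in> Epos"
proof -
  have \<nu>: "\<nu> \<in> positive_radon" using assms(3) by (rule EposD)
  have "mutual \<kappa> \<mu> \<mu> \<le> mutual \<kappa> \<nu> \<mu>" using assms by (intro mutual_mono_left)
  also have "\<dots> = mutual \<kappa> \<mu> \<nu>" using assms \<nu> by (intro mutual_commute)
  also have "\<dots> \<le> mutual \<kappa> \<nu> \<nu>" using assms \<nu> by (intro mutual_mono_left)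
  also have "\<dots> < top" using assms(3) by (simp add: Epos_iff)
  finally show ?thesis using assms(1) by (simp add: Epos_iff)
qed

lemma Epos_zero: "0 \<in> Epos"
proof -
  have "mutual \<kappa> 0 0 = 0" using mutual_pot[of 0 0] by simp
  then show ?thesis by (simp add: Epos_iff)
qed

end

locale energy_kernel = kernel_space +
  assumes energy_principle: "energy_principle \<kappa>"
begin

text \<open>
  The energy principle, applied to \<open>\<mu> - \<nu>\<close>, excludes infinite mutual energy: the positive part of
  \<open>(\<mu> - \<nu>) \<otimes> (\<mu> - \<nu>)\<close> is dominated by \<open>\<mu> \<otimes> \<mu> + \<nu> \<otimes> \<nu>\<close>, so an infinite \<open>\<kappa>(\<mu>, \<nu>)\<close> would make the
  energy of \<open>\<mu> - \<nu>\<close> well defined and equal to \<open>-\<infinity>\<close>.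
\<close>

lemma mutual_finite:
  assumes "\<mu> \<in> Epos" "\<nu> \<in> Epos"
  shows "mutual \<kappa> \<mu> \<nu> < top"
proof -
  let ?k = "\<lambda>(x, y). \<kappa> x y"
  have \<mu>: "\<mu> \<in> positive_radon" and \<nu>: "\<nu> \<in> positive_radon" using assms EposD by auto
  define P where "P = product_radon \<mu> \<mu> + product_radon \<nu> \<nu>"
  define Q where "Q = product_radon \<mu> \<nu> + product_radon \<nu> \<mu>"
  define \<rho> where "\<rho> = product_radon (\<mu> - \<nu>) (\<mu> - \<nu>)"
  have \<rho>: "\<rho> = P - Q"
    unfolding \<rho>_def P_def Q_def by (simp add: product_radon_diff_left product_radon_diff_right)
  have P: "P \<in> positive_radon" and Q: "Q \<in> positive_radon"
    unfolding P_def Q_def using \<mu> \<nu> by (auto intro!: positive_radon_add product_radon_positive(1))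
  have Pfin: "lsc_integral P ?k < top"
    unfolding P_def using assms \<mu> \<nu>
    by (simp add: lsc_integral_add_measure product_radon_positive(1) Epos_iff mutual_def)
  have le: "P - pos_part \<rho> \<in> positive_radon" unfolding \<rho> by (rule pos_part_le[OF P Q])
  have pfin: "lsc_integral (pos_part \<rho>) ?k < top"
    using lsc_integral_mono_measure[OF pos_part_positive le] Pfin by (rule order_le_less_trans)
  then have "energy_defined \<kappa> (\<mu> - \<nu>) (\<mu> - \<nu>)"
    by (simp add: energy_defined_def signed_integral_defined_def \<rho>_def)
  then have "0 \<le> energy \<kappa> (\<mu> - \<nu>) (\<mu> - \<nu>)" using energy_principle by (simp add: energy_principle_def)
  then have "0 \<le> enn2ereal (lsc_integral (pos_part \<rho>) ?k) - enn2ereal (lsc_integral (neg_part \<rho>) ?k)"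
    by (simp add: energy_def signed_integral_def \<rho>_def)
  then have nfin: "lsc_integral (neg_part \<rho>) ?k < top"
    using pfin by (cases "lsc_integral (pos_part \<rho>) ?k"; cases "lsc_integral (neg_part \<rho>) ?k") simp_all
  have "P - (P - pos_part \<rho>) \<in> positive_radon" using pos_part_positive by simp
  then have rfin: "lsc_integral (P - pos_part \<rho>) ?k < top"
    using lsc_integral_mono_measure[OF le] Pfin order_le_less_trans by blast
  have "Q = P - \<rho>" using \<rho> by simp
  also have "\<dots> = P - (pos_part \<rho> - neg_part \<rho>)" by (simp only: pos_part_minus_neg_part)
  finally have "Q = neg_part \<rho> + (P - pos_part \<rho>)" by (simp add: algebra_simps)
  then have "lsc_integral Q ?k = lsc_integral (neg_part \<rho>) ?k + lsc_integral (P - pos_part \<rho>) ?k"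
    by (simp only: lsc_integral_add_measure[OF neg_part_positive le])
  then have "lsc_integral Q ?k < top" using nfin rfin by simp
  moreover have "mutual \<kappa> \<mu> \<nu> \<le> lsc_integral Q ?k"
    unfolding Q_def mutual_def using \<mu> \<nu> by (simp add: lsc_integral_add_measure product_radon_positive(1))
  ultimately show ?thesis by simp
qed

definition mutual_real :: "'a radon \<Rightarrow> 'a radon \<Rightarrow> real" where "mutual_real \<mu> \<nu> = enn2real (mutual \<kappa> \<mu> \<nu>)"

lemma mutual_real_commute: "\<mu> \<in> Epos \<Longrightarrow> \<nu> \<in> Epos \<Longrightarrow> mutual_real \<mu> \<nu> = mutual_real \<nu> \<mu>"
  unfolding mutual_real_def using mutual_commute[of \<mu> \<nu>] EposD(1) by simp

lemma Epos_add: 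
  assumes "\<mu> \<in> Epos" "\<nu> \<in> Epos"
  shows "\<mu> + \<nu> \<in> Epos"
proof -
  have p: "\<mu> \<in> positive_radon" "\<nu> \<in> positive_radon" using assms EposD by auto
  have "mutual \<kappa> (\<mu> + \<nu>) (\<mu> + \<nu>) = mutual \<kappa> (\<mu> + \<nu>) \<mu> + mutual \<kappa> (\<mu> + \<nu>) \<nu>"
    using p by (simp add: mutual_add_right)
  then show ?thesis
    using p assms mutual_finite by (simp add: Epos_iff mutual_add_left)
qed

lemma mutual_real_add_left: "\<mu> \<in> Epos \<Longrightarrow> \<nu> \<in> Epos \<Longrightarrow> \<tau> \<in> Epos \<Longrightarrow> mutual_real (\<mu> + \<nu>) \<tau> = mutual_real \<mu> \<tau> + mutual_real \<nu> \<tau>"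
  by (simp add: mutual_real_def mutual_add_left EposD enn2real_plus mutual_finite)

lemma mutual_real_scale_left: "\<mu> \<in> Epos \<Longrightarrow> \<tau> \<in> Epos \<Longrightarrow> 0 \<le> c \<Longrightarrow> mutual_real (c *\<^sub>R \<mu>) \<tau> = c * mutual_real \<mu> \<tau>"
  by (simp add: mutual_real_def mutual_scale_left EposD enn2real_mult)

lemma energy_diff:
  assumes "P \<in> Epos" "Q \<in> Epos" "R \<in> Epos" "S \<in> Epos"
  shows "energy_defined \<kappa> (P - Q) (R - S)"
    and "energy \<kappa> (P - Q) (R - S) = ereal (mutual_real P R + mutual_real Q S - mutual_real P S - mutual_real Q R)"
proof -
  let ?k = "\<lambda>(x, y). \<kappa> x y"
  let ?A = "product_radon P R + product_radon Q S" and ?B = "product_radon P S + product_radon Q R"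
  have pos: "P \<in> positive_radon" "Q \<in> positive_radon" "R \<in> positive_radon" "S \<in> positive_radon"
    using assms EposD by auto
  have eq: "product_radon (P - Q) (R - S) = ?A - ?B"
    by (simp add: product_radon_diff_left product_radon_diff_right)
  have A: "?A \<in> positive_radon" "?B \<in> positive_radon"
    using pos by (auto intro!: positive_radon_add product_radon_positive(1))
  have li: "lsc_integral ?A ?k = mutual \<kappa> P R + mutual \<kappa> Q S" "lsc_integral ?B ?k = mutual \<kappa> P S + mutual \<kappa> Q R"
    using pos by (simp_all add: lsc_integral_add_measure product_radon_positive(1) mutual_def)
  have fin: "lsc_integral ?A ?k < top" "lsc_integral ?B ?k < top"
    unfolding li using assms by (simp_all add: mutual_finite)
  show "energy_defined \<kappa> (P - Q) (R - S)"
    unfolding energy_defined_def eq by (rule signed_integral_diff(1)[OF A fin])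
  show "energy \<kappa> (P - Q) (R - S) = ereal (mutual_real P R + mutual_real Q S - mutual_real P S - mutual_real Q R)"
    unfolding energy_def eq signed_integral_diff(2)[OF A fin] li mutual_real_def
    using assms by (simp add: enn2real_plus mutual_finite)
qed

text \<open>
  \<open>\<E> = \<E>\<^sup>+ - \<E>\<^sup>+\<close>. This is where the structure of \<open>(\<mu> \<otimes> \<mu>)\<^sup>+\<close> is needed; afterwards computations in
  \<open>\<E>\<close> may use arbitrary decompositions.
\<close>

lemma finite_energy_parts:
  assumes "\<mu> \<in> finite_energy \<kappa>"
  shows "pos_part \<mu> \<in> Epos" "neg_part \<mu> \<in> Epos"
proof -
  let ?k = "\<lambda>(x, y). \<kappa> x y" and ?\<rho> = "product_radon \<mu> \<mu>"
  let ?S = "product_radon (pos_part \<mu>) (pos_part \<mu>) + product_radon (neg_part \<mu>) (neg_part \<mu>)"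
  have "\<bar>enn2ereal (lsc_integral (pos_part ?\<rho>) ?k) - enn2ereal (lsc_integral (neg_part ?\<rho>) ?k)\<bar> < \<infinity>"
    using assms by (simp add: finite_energy_def energy_def signed_integral_def)
  then have "lsc_integral (pos_part ?\<rho>) ?k < top"
    by (cases "lsc_integral (pos_part ?\<rho>) ?k"; cases "lsc_integral (neg_part ?\<rho>) ?k") simp_all
  moreover have S: "?S \<in> positive_radon"
    by (intro positive_radon_add product_radon_positive(1) pos_part_positive neg_part_positive)
  ultimately have "lsc_integral ?S ?k < top"
    using lsc_integral_mono_measure[OF S pos_part_product_ge] order_le_less_trans by blast
  then have "mutual \<kappa> (pos_part \<mu>) (pos_part \<mu>) + mutual \<kappa> (neg_part \<mu>) (neg_part \<mu>) < top"
    by (simp add: lsc_integral_add_measure product_radon_positive(1) pos_part_positive neg_part_positive mutual_def)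
  then show "pos_part \<mu> \<in> Epos" "neg_part \<mu> \<in> Epos"
    by (simp_all add: Epos_iff pos_part_positive neg_part_positive)
qed

lemma finite_energy_diff: "P \<in> Epos \<Longrightarrow> Q \<in> Epos \<Longrightarrow> P - Q \<in> finite_energy \<kappa>"
  by (simp add: finite_energy_def energy_diff)

lemma finite_energy_split:
  assumes "\<mu> \<in> finite_energy \<kappa>"
  obtains P Q where "P \<in> Epos" "Q \<in> Epos" "\<mu> = P - Q"
  using finite_energy_parts[OF assms] pos_part_minus_neg_part[of \<mu>] by metis

lemma energy_inner:
  assumes "\<mu> \<in> finite_energy \<kappa>" "\<nu> \<in> finite_energy \<kappa>"
  shows "energy_defined \<kappa> \<mu> \<nu>" "energy \<kappa> \<mu> \<nu> = ereal (ip \<mu> \<nu>)"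
proof -
  obtain P Q where 1: "P \<in> Epos" "Q \<in> Epos" "\<mu> = P - Q" using finite_energy_split[OF assms(1)] by blast
  obtain R S where 2: "R \<in> Epos" "S \<in> Epos" "\<nu> = R - S" using finite_energy_split[OF assms(2)] by blast
  show "energy_defined \<kappa> \<mu> \<nu>" "energy \<kappa> \<mu> \<nu> = ereal (ip \<mu> \<nu>)"
    unfolding inner_energy_def 1(3) 2(3) using 1 2 by (simp_all add: energy_diff)
qed

lemma ip_diff_eq:
  assumes "P \<in> Epos" "Q \<in> Epos" "R \<in> Epos" "S \<in> Epos"
  shows "ip (P - Q) (R - S) = mutual_real P R + mutual_real Q S - mutual_real P S - mutual_real Q R"
  using assms by (simp add: inner_energy_def energy_diff)

lemma ip_Epos:
  assumes "P \<in> Epos" "R \<in> Epos"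
  shows "ip P R = mutual_real P R"
  by (simp only: inner_energy_def energy_positive(1)[OF EposD(1)[OF assms(1)] EposD(1)[OF assms(2)]]
      mutual_real_def enn2real_def)

lemma ip_commute:
  assumes "\<mu> \<in> finite_energy \<kappa>" "\<nu> \<in> finite_energy \<kappa>"
  shows "ip \<mu> \<nu> = ip \<nu> \<mu>"
proof -
  obtain P Q where 1: "P \<in> Epos" "Q \<in> Epos" "\<mu> = P - Q" using finite_energy_split[OF assms(1)] by blast
  obtain R S where 2: "R \<in> Epos" "S \<in> Epos" "\<nu> = R - S" using finite_energy_split[OF assms(2)] by blast
  show ?thesis unfolding 1(3) 2(3) using 1 2 by (simp add: ip_diff_eq mutual_real_commute[of R] mutual_real_commute[of S])
qed

lemma finite_energy_add:
  assumes "\<mu> \<in> finite_energy \<kappa>" "\<nu> \<in> finite_energy \<kappa>"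
  shows "\<mu> + \<nu> \<in> finite_energy \<kappa>" "\<tau> \<in> finite_energy \<kappa> \<Longrightarrow> ip (\<mu> + \<nu>) \<tau> = ip \<mu> \<tau> + ip \<nu> \<tau>"
proof -
  obtain P Q where 1: "P \<in> Epos" "Q \<in> Epos" "\<mu> = P - Q" using finite_energy_split[OF assms(1)] by blast
  obtain R S where 2: "R \<in> Epos" "S \<in> Epos" "\<nu> = R - S" using finite_energy_split[OF assms(2)] by blast
  have eq: "\<mu> + \<nu> = (P + R) - (Q + S)" using 1(3) 2(3) by simp
  show "\<mu> + \<nu> \<in> finite_energy \<kappa>" unfolding eq using 1 2 by (intro finite_energy_diff Epos_add)
  assume "\<tau> \<in> finite_energy \<kappa>"
  then obtain U V where 3: "U \<in> Epos" "V \<in> Epos" "\<tau> = U - V" using finite_energy_split by blast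
  have "ip ((P + R) - (Q + S)) (U - V) = ip (P - Q) (U - V) + ip (R - S) (U - V)"
    using 1 2 3 by (simp add: ip_diff_eq Epos_add mutual_real_add_left)
  then show "ip (\<mu> + \<nu>) \<tau> = ip \<mu> \<tau> + ip \<nu> \<tau>" using eq 1(3) 2(3) 3(3) by metis
qed

lemma finite_energy_scale:
  assumes "\<mu> \<in> finite_energy \<kappa>"
  shows "c *\<^sub>R \<mu> \<in> finite_energy \<kappa>" "\<tau> \<in> finite_energy \<kappa> \<Longrightarrow> ip (c *\<^sub>R \<mu>) \<tau> = c * ip \<mu> \<tau>"
proof -
  obtain P Q where 1: "P \<in> Epos" "Q \<in> Epos" "\<mu> = P - Q" using finite_energy_split[OF assms(1)] by blast
  have "\<exists>R\<in>Epos. \<exists>S\<in>Epos. c *\<^sub>R \<mu> = R - S \<and> (\<forall>U\<in>Epos. mutual_real R U - mutual_real S U = c * (mutual_real P U - mutual_real Q U))"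
  proof (cases "0 \<le> c")
    case True
    then show ?thesis using 1 Epos_scale[of P c] Epos_scale[of Q c]
      by (intro bexI[of _ "c *\<^sub>R P"] bexI[of _ "c *\<^sub>R Q"])
        (auto simp: mutual_real_scale_left scaleR_diff_right algebra_simps)
  next
    case False
    then show ?thesis using 1 Epos_scale[of P "- c"] Epos_scale[of Q "- c"]
      by (intro bexI[of _ "(- c) *\<^sub>R Q"] bexI[of _ "(- c) *\<^sub>R P"])
        (auto simp: mutual_real_scale_left scaleR_diff_right algebra_simps simp del: scaleR_minus_left,
         simp add: scaleR_diff_right)
  qed
  then obtain R S where 2: "R \<in> Epos" "S \<in> Epos" "c *\<^sub>R \<mu> = R - S"
    "\<And>U. U \<in> Epos \<Longrightarrow> mutual_real R U - mutual_real S U = c * (mutual_real P U - mutual_real Q U)" by blast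
  show "c *\<^sub>R \<mu> \<in> finite_energy \<kappa>" unfolding 2(3) using 2 by (intro finite_energy_diff)
  assume "\<tau> \<in> finite_energy \<kappa>"
  then obtain U V where 3: "U \<in> Epos" "V \<in> Epos" "\<tau> = U - V" using finite_energy_split by blast
  have "ip (R - S) (U - V) = (mutual_real R U - mutual_real S U) - (mutual_real R V - mutual_real S V)" using 2(1,2) 3 by (simp add: ip_diff_eq)
  also have "\<dots> = c * (mutual_real P U - mutual_real Q U) - c * (mutual_real P V - mutual_real Q V)" by (simp only: 2(4)[OF 3(1)] 2(4)[OF 3(2)])
  also have "\<dots> = c * ip (P - Q) (U - V)" using 1 3 by (simp add: ip_diff_eq algebra_simps)
  finally show "ip (c *\<^sub>R \<mu>) \<tau> = c * ip \<mu> \<tau>" using 1(3) 2(3) 3(3) by simp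
qed

lemma finite_energy_minus:
  assumes "\<mu> \<in> finite_energy \<kappa>" "\<nu> \<in> finite_energy \<kappa>"
  shows "\<mu> - \<nu> \<in> finite_energy \<kappa>" "\<tau> \<in> finite_energy \<kappa> \<Longrightarrow> ip (\<mu> - \<nu>) \<tau> = ip \<mu> \<tau> - ip \<nu> \<tau>"
proof -
  have eq: "\<mu> - \<nu> = \<mu> + (-1) *\<^sub>R \<nu>" by simp
  show "\<mu> - \<nu> \<in> finite_energy \<kappa>" unfolding eq using assms by (intro finite_energy_add finite_energy_scale)
  show "\<tau> \<in> finite_energy \<kappa> \<Longrightarrow> ip (\<mu> - \<nu>) \<tau> = ip \<mu> \<tau> - ip \<nu> \<tau>"
    unfolding eq using assms finite_energy_scale[OF assms(2), where c="-1"] by (subst finite_energy_add(2)) auto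
qed

lemma ip_right:
  assumes "\<mu> \<in> finite_energy \<kappa>" "\<nu> \<in> finite_energy \<kappa>" "\<tau> \<in> finite_energy \<kappa>"
  shows "ip \<tau> (\<mu> + \<nu>) = ip \<tau> \<mu> + ip \<tau> \<nu>" "ip \<tau> (\<mu> - \<nu>) = ip \<tau> \<mu> - ip \<tau> \<nu>"
    "ip \<tau> (c *\<^sub>R \<mu>) = c * ip \<tau> \<mu>"
  using assms ip_commute[of \<tau>]
  by (simp_all add: finite_energy_add finite_energy_minus finite_energy_scale)

lemmas ip_bilinear = finite_energy_add finite_energy_minus finite_energy_scale ip_right

lemma ip_nonneg: "\<mu> \<in> finite_energy \<kappa> \<Longrightarrow> 0 \<le> ip \<mu> \<mu>"
  and ip_definite: "\<mu> \<in> finite_energy \<kappa> \<Longrightarrow> ip \<mu> \<mu> = 0 \<Longrightarrow> \<mu> = 0"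
  using energy_principle energy_inner[of \<mu> \<mu>] by (auto simp: energy_principle_def)

lemma energy_norm_ip: "energy_norm \<kappa> \<mu> = sqrt (ip \<mu> \<mu>)"
  by (simp add: energy_norm_def inner_energy_def)

lemma energy_norm_nonneg: "\<mu> \<in> finite_energy \<kappa> \<Longrightarrow> 0 \<le> energy_norm \<kappa> \<mu>"
  by (simp add: energy_norm_ip ip_nonneg)

lemma energy_norm_power2: "\<mu> \<in> finite_energy \<kappa> \<Longrightarrow> (energy_norm \<kappa> \<mu>)\<^sup>2 = ip \<mu> \<mu>"
  by (simp add: energy_norm_ip ip_nonneg)

lemma Cauchy_Schwarz_ip:
  assumes \<mu>: "\<mu> \<in> finite_energy \<kappa>" and \<nu>: "\<nu> \<in> finite_energy \<kappa>"
  shows "\<bar>ip \<mu> \<nu>\<bar> \<le> energy_norm \<kappa> \<mu> * energy_norm \<kappa> \<nu>"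
proof (cases "ip \<nu> \<nu> = 0")
  case True
  then have "\<nu> = 0 *\<^sub>R \<nu>" using ip_definite[OF \<nu>] by simp
  then have "ip \<mu> \<nu> = 0 * ip \<mu> \<nu>" using ip_right(3)[OF \<nu> \<nu> \<mu>] by metis
  then show ?thesis using energy_norm_nonneg assms by simp
next
  case False
  then have pos: "0 < ip \<nu> \<nu>" using ip_nonneg[OF \<nu>] by simp
  define t where "t = ip \<mu> \<nu> / ip \<nu> \<nu>"
  have "0 \<le> ip (\<mu> - t *\<^sub>R \<nu>) (\<mu> - t *\<^sub>R \<nu>)" using \<mu> \<nu> by (intro ip_nonneg ip_bilinear)
  also have "\<dots> = ip \<mu> \<mu> - 2 * t * ip \<mu> \<nu> + t\<^sup>2 * ip \<nu> \<nu>"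
    using \<mu> \<nu> by (simp add: ip_bilinear ip_commute[of \<nu> \<mu>] power2_eq_square algebra_simps)
  also have "\<dots> = ip \<mu> \<mu> - (ip \<mu> \<nu>)\<^sup>2 / ip \<nu> \<nu>"
    using pos by (simp add: t_def power2_eq_square field_simps)
  finally have "(ip \<mu> \<nu>)\<^sup>2 \<le> ip \<mu> \<mu> * ip \<nu> \<nu>" using pos by (simp add: field_simps)
  then have "sqrt ((ip \<mu> \<nu>)\<^sup>2) \<le> sqrt (ip \<mu> \<mu> * ip \<nu> \<nu>)" by (rule real_sqrt_le_mono)
  then show ?thesis by (simp add: energy_norm_ip real_sqrt_mult)
qed

lemma energy_norm_triangle:
  assumes \<mu>: "\<mu> \<in> finite_energy \<kappa>" and \<nu>: "\<nu> \<in> finite_energy \<kappa>"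
  shows "energy_norm \<kappa> (\<mu> + \<nu>) \<le> energy_norm \<kappa> \<mu> + energy_norm \<kappa> \<nu>"
proof (rule power2_le_imp_le)
  have "(energy_norm \<kappa> (\<mu> + \<nu>))\<^sup>2 = ip \<mu> \<mu> + 2 * ip \<mu> \<nu> + ip \<nu> \<nu>"
    using \<mu> \<nu> by (simp add: energy_norm_power2 ip_bilinear ip_commute[of \<nu> \<mu>])
  also have "\<dots> \<le> (energy_norm \<kappa> \<mu>)\<^sup>2 + 2 * (energy_norm \<kappa> \<mu> * energy_norm \<kappa> \<nu>) + (energy_norm \<kappa> \<nu>)\<^sup>2"
    using Cauchy_Schwarz_ip[OF \<mu> \<nu>] \<mu> \<nu> by (simp add: energy_norm_power2)
  also have "\<dots> = (energy_norm \<kappa> \<mu> + energy_norm \<kappa> \<nu>)\<^sup>2" by (simp add: power2_sum)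
  finally show "(energy_norm \<kappa> (\<mu> + \<nu>))\<^sup>2 \<le> (energy_norm \<kappa> \<mu> + energy_norm \<kappa> \<nu>)\<^sup>2" .
qed (use energy_norm_nonneg \<mu> \<nu> in auto)

lemma ip_tendsto_left:
  assumes s: "\<And>n. s n \<in> finite_energy \<kappa>" and P: "P \<in> finite_energy \<kappa>" and \<tau>: "\<tau> \<in> finite_energy \<kappa>"
    and lim: "(\<lambda>n. energy_norm \<kappa> (s n - P)) \<longlonglongrightarrow> 0"
  shows "(\<lambda>n. ip (s n) \<tau>) \<longlonglongrightarrow> ip P \<tau>"
proof (rule LIM_zero_cancel, rule Lim_null_comparison)
  show "eventually (\<lambda>n. norm (ip (s n) \<tau> - ip P \<tau>) \<le> energy_norm \<kappa> (s n - P) * energy_norm \<kappa> \<tau>) sequentially"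
    using Cauchy_Schwarz_ip[OF finite_energy_minus(1)[OF s P] \<tau>] s P \<tau>
    by (simp add: finite_energy_minus)
  show "(\<lambda>n. energy_norm \<kappa> (s n - P) * energy_norm \<kappa> \<tau>) \<longlonglongrightarrow> 0"
    using tendsto_mult_right[OF lim, of "energy_norm \<kappa> \<tau>"] by (simp add: tendsto_mult_left_zero lim)
qed

end

section \<open>Vague compactness and strong completeness\<close>

text \<open>
  Bounded functionals form a compact subset of a product of intervals, so the sequence has a pointwise
  cluster point; linearity, positivity and upper bounds are closed conditions and persist.
  The topology has no countable base in general, hence a cluster point instead of a subsequence.
\<close>

lemma vague_cluster_exists:
  fixes s :: "nat \<Rightarrow> 'a::t2_space radon"
  assumes pos: "\<And>n. s n \<in> positive_radon"
    and bnd: "\<And>f. f \<in> Cc \<Longrightarrow> (\<And>x. 0 \<le> f x) \<Longrightarrow> \<exists>B. \<forall>n. integ (s n) f \<le> B"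
  obtains P where "P \<in> positive_radon" "vague_cluster_point (filtermap s sequentially) P"
    "\<And>f c. (\<And>n. lsc_integral (s n) f \<le> c) \<Longrightarrow> lsc_integral P f \<le> c"
proof -
  have "\<exists>B. \<forall>n. \<bar>integ (s n) f\<bar> \<le> B" for f
  proof (cases "f \<in> Cc")
    case True
    let ?g = "\<lambda>x. max (f x) (-1 * f x)"
    have g: "?g \<in> Cc" using True by (intro Cc_max Cc_cmult)
    have le: "\<bar>f x\<bar> \<le> ?g x" for x by simp
    have "0 \<le> ?g x" for x by (simp add: max_def)
    then obtain B where "\<forall>n. integ (s n) ?g \<le> B" using bnd[OF g] by blast
    then show ?thesis using integ_abs_le[OF pos True g le] order_trans by blast
  qed (auto simp: integ_outside)
  then obtain B where B: "\<And>f n. \<bar>integ (s n) f\<bar> \<le> B f" by metis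
  define C where "C = (PiE UNIV (\<lambda>f. {- B f..B f}) :: (('a \<Rightarrow> real) \<Rightarrow> real) set)"
  let ?F = "filtermap (\<lambda>n. integ (s n)) sequentially"
  have "compactin (product_topology (\<lambda>_. euclideanreal) UNIV) C"
    unfolding C_def compactin_PiE by (simp add: compactin_euclidean_iff)
  then have "compact C" by (simp add: euclidean_product_topology compactin_euclidean_iff)
  moreover have "integ (s n) \<in> C" for n
    unfolding C_def PiE_UNIV_domain using B by (simp add: Pi_iff abs_le_iff minus_le_iff)
  then have "eventually (\<lambda>\<phi>. \<phi> \<in> C) ?F" by (simp add: eventually_filtermap)
  moreover have "?F \<noteq> bot" by (simp add: filtermap_bot_iff)
  ultimately obtain \<phi> where \<phi>: "inf (nhds \<phi>) ?F \<noteq> bot"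
    unfolding compact_filter by blast
  have freq: "frequently (\<lambda>n. integ (s n) \<in> V) sequentially" if V: "open V" "\<phi> \<in> V" for V
  proof (rule ccontr)
    assume "\<not> ?thesis"
    then have "eventually (\<lambda>\<psi>. \<psi> \<notin> V) ?F" by (simp add: frequently_def eventually_filtermap)
    moreover have "eventually (\<lambda>\<psi>. \<psi> \<in> V) (nhds \<phi>)" using V by (rule eventually_nhds_in_open)
    ultimately have "eventually (\<lambda>_. False) (inf (nhds \<phi>) ?F)"
      unfolding eventually_inf by blast
    with \<phi> show False by (simp add: trivial_limit_def)
  qed
  have coord: "continuous_on UNIV (\<lambda>\<psi> :: ('a \<Rightarrow> real) \<Rightarrow> real. \<psi> f)" for f
    by (rule continuous_on_product_coordinates)
  have closed_property: "\<phi> \<in> S" if S: "closed S" "\<And>n. integ (s n) \<in> S" for S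
  proof (rule ccontr)
    assume "\<phi> \<notin> S"
    then have "frequently (\<lambda>n. integ (s n) \<in> - S) sequentially" using S(1) by (intro freq) auto
    with S(2) show False by simp
  qed
  have "positive_functional \<phi>"
    unfolding positive_functional_def
  proof (intro conjI ballI allI impI)
    fix f g :: "'a \<Rightarrow> real" and c :: real assume f: "f \<in> Cc"
    show "\<phi> (\<lambda>x. f x + g x) = \<phi> f + \<phi> g" if g: "g \<in> Cc"
      using closed_property[of "{\<psi>. \<psi> (\<lambda>x. f x + g x) = \<psi> f + \<psi> g}"] f g
      by (simp add: integ_add closed_Collect_eq coord continuous_on_add)
    show "\<phi> (\<lambda>x. c * f x) = c * \<phi> f"
      using closed_property[of "{\<psi>. \<psi> (\<lambda>x. c * f x) = c * \<psi> f}"] f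
      by (simp add: integ_cmult closed_Collect_eq coord continuous_on_mult_left)
    show "0 \<le> \<phi> f" if "\<forall>x. 0 \<le> f x"
      using closed_property[of "{\<psi>. 0 \<le> \<psi> f}"] positive_radonD[OF pos f] that
      by (simp add: closed_Collect_le coord)
  qed
  then obtain P :: "'a radon" where P: "P \<in> positive_radon" "\<And>f. f \<in> Cc \<Longrightarrow> integ P f = \<phi> f"
    using radon_of_functional by blast
  have "vague_cluster_point (filtermap s sequentially) P"
    unfolding vague_cluster_point_def
  proof (intro allI impI, elim conjE)
    fix U assume U: "openin vague_topology U" "P \<in> U"
    obtain V where V: "openin (product_topology (\<lambda>_. euclideanreal) Cc) V"
      "U = (\<lambda>\<mu>. restrict (integ \<mu>) Cc) -` V"
      using U(1) unfolding vague_topology_def openin_pullback_topology by auto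
    let ?r = "\<lambda>\<psi> :: ('a \<Rightarrow> real) \<Rightarrow> real. restrict \<psi> Cc"
    have "continuous_map (product_topology (\<lambda>_. euclideanreal) UNIV) (product_topology (\<lambda>_. euclideanreal) Cc) ?r"
      unfolding continuous_map_componentwise
    proof (intro conjI ballI)
      fix f :: "'a \<Rightarrow> real" assume "f \<in> Cc"
      then show "continuous_map (product_topology (\<lambda>_. euclideanreal) UNIV) euclideanreal (\<lambda>\<psi>. ?r \<psi> f)"
        using continuous_map_product_projection[of f UNIV "\<lambda>_. euclideanreal"] by simp
    qed auto
    then have "openin (product_topology (\<lambda>_. euclideanreal) UNIV) {\<psi> \<in> topspace (product_topology (\<lambda>_. euclideanreal) UNIV). ?r \<psi> \<in> V}"
      using V(1) by (rule openin_continuous_map_preimage)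
    then have "open {\<psi>. ?r \<psi> \<in> V}" by (simp add: euclidean_product_topology)
    moreover have "?r \<phi> = ?r (integ P)" using P(2) by (auto simp: fun_eq_iff)
    then have "\<phi> \<in> {\<psi>. ?r \<psi> \<in> V}" using U(2) V(2) by simp
    ultimately have "frequently (\<lambda>n. integ (s n) \<in> {\<psi>. ?r \<psi> \<in> V}) sequentially" by (rule freq)
    then show "frequently (\<lambda>\<nu>. \<nu> \<in> U) (filtermap s sequentially)"
      by (simp add: frequently_def eventually_filtermap V(2))
  qed
  moreover have "lsc_integral P f \<le> c" if c: "\<And>n. lsc_integral (s n) f \<le> c" for f c
  proof (cases c)
    case (real r)
    show ?thesis
      unfolding lsc_integral_minorants
    proof (rule SUP_least)
      fix g assume g: "g \<in> minorants f"
      have "integ (s n) g \<le> r" for n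
        using order_trans[OF lsc_integral_upper[OF g] c[of n]] real by (simp add: ennreal_le_iff)
      then have "\<phi> g \<le> r" using closed_property[of "{\<psi>. \<psi> g \<le> r}"] by (simp add: closed_Collect_le coord)
      then show "ennreal (integ P g) \<le> c" using P(2) minorantsD(1)[OF g] real by (simp add: ennreal_leI)
    qed
  qed simp
  ultimately show thesis using that P(1) by blast
qed

context energy_kernel
begin

text \<open>On the diagonal a zero of the kernel would make a unit point mass a measure of zero energy.\<close>

lemma kernel_diag_pos: "0 < \<kappa> x x"
proof (rule ccontr)
  assume "\<not> 0 < \<kappa> x x"
  then have 0: "\<kappa> x x = 0" by (simp add: zero_less_iff_neq_zero)
  have "positive_functional (\<lambda>f. f x)" by (simp add: positive_functional_def)
  then obtain \<delta> :: "'a radon" where \<delta>: "\<delta> \<in> positive_radon" "\<And>f. f \<in> Cc \<Longrightarrow> integ \<delta> f = f x"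
    using radon_of_functional by blast
  have eval: "lsc_integral \<delta> f \<le> f x" for f
    unfolding lsc_integral_minorants by (rule SUP_least) (simp add: \<delta>(2) minorantsD)
  have "pot \<kappa> \<delta> x = 0" using eval[of "\<kappa> x"] 0 by (simp add: pot_def)
  then have "mutual \<kappa> \<delta> \<delta> = 0" using eval[of "pot \<kappa> \<delta>"] \<delta>(1) by (simp add: mutual_pot)
  then have "\<delta> = 0"
    using energy_principle energy_positive[OF \<delta>(1) \<delta>(1)] by (simp add: energy_principle_def zero_ennreal.rep_eq)
  have "compact {x}" by simp
  then obtain g where g: "g \<in> Cc" "\<And>y. y \<in> {x} \<Longrightarrow> g y = (1::real)" using cutoff by metis
  have "integ \<delta> g = 1" using g(2)[of x] \<delta>(2)[OF g(1)] by simp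
  with \<open>\<delta> = 0\<close> show False by simp
qed

text \<open>
  Near a point \<open>(x, x)\<close> the kernel exceeds some \<open>c > 0\<close>. If \<open>u\<close> is a cutoff function supported near
  \<open>x\<close>, then \<open>c u \<otimes> u \<le> \<kappa>\<close>, and therefore \<open>c \<mu>(u)\<^sup>2 \<le> \<kappa>(\<mu>, \<mu>)\<close>.
\<close>

lemma vague_bound_local:
  obtains u B where "u \<in> Cc" "\<And>y. 0 \<le> u y" "u x = 1" "0 \<le> B"
    "\<And>\<mu>. \<mu> \<in> Epos \<Longrightarrow> integ \<mu> u \<le> B * energy_norm \<kappa> \<mu>"
proof -
  obtain t where t: "0 < t" "t < \<kappa> x x" using dense[OF kernel_diag_pos] by blast
  then have "t < top" using top_greatest order_less_le_trans by blast
  then obtain c where c: "t = ennreal c" "0 < c" using t(1) by (cases t) auto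
  have "open {p. t < \<kappa> (fst p) (snd p)}" using kernel by (simp add: is_kernel_def)
  moreover have "(x, x) \<in> {p. t < \<kappa> (fst p) (snd p)}" using t by simp
  ultimately obtain A D where AD: "open A" "open D" "x \<in> A" "x \<in> D" "A \<times> D \<subseteq> {p. t < \<kappa> (fst p) (snd p)}"
    by (auto elim!: open_prod_elim)
  have W: "compact {x}" "open (A \<inter> D)" "{x} \<subseteq> A \<inter> D" using AD by auto
  obtain u C where u: "u \<in> Cc" "\<And>y. 0 \<le> u y" "\<And>y. u y \<le> 1" "\<And>y. y \<in> {x} \<Longrightarrow> u y = 1"
    "C \<subseteq> A \<inter> D" "\<And>y. y \<notin> C \<Longrightarrow> u y = 0"
    using Urysohn_Cc[OF W] by metis
  let ?G = "\<lambda>(a, b). (c * u a) * u b"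
  have "ennreal (c * u a * u b) \<le> \<kappa> a b" for a b
  proof (cases "a \<in> C \<and> b \<in> C")
    case True
    then have "(a, b) \<in> A \<times> D" using u(5) by auto
    then have "t < \<kappa> a b" using AD(5) by auto
    moreover have "c * u a * u b \<le> c * 1 * 1"
      using u(2,3) c(2) by (intro mult_mono) auto
    then have "ennreal (c * u a * u b) \<le> t" using c(1) by (simp add: ennreal_leI)
    ultimately show ?thesis by simp
  next
    case False
    then show ?thesis using u(6) by auto
  qed
  moreover have "?G \<in> Cc" using u(1) by (intro Cc_tensor Cc_cmult)
  ultimately have G: "?G \<in> minorants (\<lambda>(x, y). \<kappa> x y)" using u(2) c(2) by (auto simp: minorants_def)
  show thesis
  proof (rule that[of u "1 / sqrt c"])
    fix \<mu> assume \<mu>: "\<mu> \<in> Epos"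
    have pos: "0 \<le> integ \<mu> u" using EposD(1)[OF \<mu>] u(1,2) by (rule positive_radonD)
    have "ennreal (integ (product_radon \<mu> \<mu>) ?G) \<le> mutual \<kappa> \<mu> \<mu>"
      unfolding mutual_def by (rule lsc_integral_upper[OF G])
    moreover have "integ (product_radon \<mu> \<mu>) ?G = c * (integ \<mu> u)\<^sup>2"
      using product_radon_tensor[of "\<lambda>x. c * u x" u \<mu> \<mu>] u(1) by (simp add: integ_cmult power2_eq_square)
    moreover have "mutual \<kappa> \<mu> \<mu> = ennreal (mutual_real \<mu> \<mu>)"
      using mutual_finite[OF \<mu> \<mu>] by (simp add: mutual_real_def)
    moreover have "0 \<le> mutual_real \<mu> \<mu>" by (simp add: mutual_real_def)
    ultimately have "c * (integ \<mu> u)\<^sup>2 \<le> mutual_real \<mu> \<mu>"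
      by (simp only: ennreal_le_iff)
    then have "(sqrt c * integ \<mu> u)\<^sup>2 \<le> (energy_norm \<kappa> \<mu>)\<^sup>2"
      using c(2) EposD(2)[OF \<mu>] by (simp add: energy_norm_power2 ip_Epos[OF \<mu> \<mu>] power_mult_distrib)
    then have "sqrt c * integ \<mu> u \<le> energy_norm \<kappa> \<mu>"
      using energy_norm_nonneg[OF EposD(2)[OF \<mu>]] by (rule power2_le_imp_le)
    then show "integ \<mu> u \<le> 1 / sqrt c * energy_norm \<kappa> \<mu>" using c(2) by (simp add: field_simps)
  qed (use u c in auto)
qed

lemma vague_bound:
  assumes f: "f \<in> Cc" "\<And>x. 0 \<le> f x"
  obtains B where "0 \<le> B" "\<And>\<mu>. \<mu> \<in> Epos \<Longrightarrow> integ \<mu> f \<le> B * energy_norm \<kappa> \<mu>"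
proof -
  define tame where "tame g \<longleftrightarrow> g \<in> Cc \<and> (\<forall>x. 0 \<le> g x) \<and>
      (\<exists>B\<ge>0. \<forall>\<mu>\<in>Epos. integ \<mu> g \<le> B * energy_norm \<kappa> \<mu>)" for g
  have "\<exists>u. tame u \<and> u x = 1" for x
  proof (rule vague_bound_local[of x])
    fix u B assume "u \<in> Cc" "\<And>y. 0 \<le> u y" "u x = 1" "0 \<le> B"
      "\<And>\<mu>. \<mu> \<in> Epos \<Longrightarrow> integ \<mu> u \<le> B * energy_norm \<kappa> \<mu>"
    then show "\<exists>u. tame u \<and> u x = 1" unfolding tame_def by (intro exI[of _ u]) blast
  qed
  then obtain u where u: "\<And>x. tame (u x)" "\<And>x. u x x = 1" by metis
  obtain K where K: "compact K" "\<And>x. x \<notin> K \<Longrightarrow> f x = 0" using Cc_support[OF f(1)] by blast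
  obtain b where b: "0 < b" "\<And>x. \<bar>f x\<bar> \<le> b" using Cc_bounded[OF f(1)] by blast
  have "open {y. 1/2 < u x y}" for x
    using u(1) Cc_cont by (intro open_Collect_less) (auto simp: tame_def)
  moreover have "K \<subseteq> (\<Union>x\<in>K. {y. 1/2 < u x y})" using u(2) by auto
  ultimately obtain D where D: "D \<subseteq> K" "finite D" "K \<subseteq> (\<Union>x\<in>D. {y. 1/2 < u x y})"
    using compactE_image[OF K(1), of K "\<lambda>x. {y. 1/2 < u x y}"] by metis
  have tame_add: "tame (\<lambda>y. g y + h y)" if g: "tame g" and h: "tame h" for g h
  proof -
    obtain B where B: "0 \<le> B" "\<And>\<mu>. \<mu> \<in> Epos \<Longrightarrow> integ \<mu> g \<le> B * energy_norm \<kappa> \<mu>"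
      using g by (auto simp: tame_def)
    obtain B' where B': "0 \<le> B'" "\<And>\<mu>. \<mu> \<in> Epos \<Longrightarrow> integ \<mu> h \<le> B' * energy_norm \<kappa> \<mu>"
      using h by (auto simp: tame_def)
    have "integ \<mu> (\<lambda>y. g y + h y) \<le> (B + B') * energy_norm \<kappa> \<mu>" if "\<mu> \<in> Epos" for \<mu>
      using B(2)[OF that] B'(2)[OF that] g h by (simp add: tame_def integ_add distrib_right)
    then show ?thesis using g h B B' unfolding tame_def by (auto intro!: exI[of _ "B + B'"])
  qed
  have "tame (\<lambda>_. 0)" by (auto simp: tame_def intro!: exI[of _ 0])
  with D(2) have S: "tame (\<lambda>y. \<Sum>x\<in>D. u x y)"
    by (induction D) (auto intro: tame_add u)
  then obtain B where B: "0 \<le> B" "\<And>\<mu>. \<mu> \<in> Epos \<Longrightarrow> integ \<mu> (\<lambda>y. \<Sum>x\<in>D. u x y) \<le> B * energy_norm \<kappa> \<mu>"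
    by (auto simp: tame_def)
  have le: "f y \<le> 2 * b * (\<Sum>x\<in>D. u x y)" for y
  proof (cases "y \<in> K")
    case True
    then obtain x where x: "x \<in> D" "1/2 < u x y" using D(3) by auto
    have "u x y \<le> (\<Sum>x\<in>D. u x y)"
      using D(2) x(1) u(1) by (intro member_le_sum) (auto simp: tame_def)
    then have "b * 1 \<le> b * (2 * (\<Sum>x\<in>D. u x y))" using b(1) x(2) by (intro mult_left_mono) auto
    then show ?thesis using b(2)[of y] by simp
  next
    case False
    have "0 \<le> (\<Sum>x\<in>D. u x y)" using S by (simp add: tame_def)
    then show ?thesis using False K(2) b(1) by simp
  qed
  show thesis
  proof (rule that[of "2 * b * B"])
    fix \<mu> assume \<mu>: "\<mu> \<in> Epos"
    have "integ \<mu> f \<le> integ \<mu> (\<lambda>y. 2 * b * (\<Sum>x\<in>D. u x y))"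
      using EposD(1)[OF \<mu>] f(1) S le by (intro integ_mono Cc_cmult) (auto simp: tame_def)
    also have "\<dots> = 2 * b * integ \<mu> (\<lambda>y. \<Sum>x\<in>D. u x y)" using S by (intro integ_cmult) (simp add: tame_def)
    also have "\<dots> \<le> 2 * b * (B * energy_norm \<kappa> \<mu>)" using B(2)[OF \<mu>] b(1) by (intro mult_left_mono) auto
    finally show "integ \<mu> f \<le> 2 * b * B * energy_norm \<kappa> \<mu>" by simp
  qed (use b B in simp)
qed

end

locale consistent_kernel = energy_kernel +
  assumes consistency: "consistency_principle \<kappa>"
begin

text \<open>
  \<open>\<E>\<^sup>+\<close> is strongly complete: a strong Cauchy sequence is strongly bounded, hence vaguely bounded,
  hence has a vague cluster point, to which it converges strongly by the consistency principle.
  The last clause is the lower semicontinuity of the integral along the cluster point; it carries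
  bounds on potentials, and the property of being supported by a compact set, over to the limit.
\<close>

lemma Epos_complete:
  assumes s: "\<And>n. s n \<in> Epos"
    and Cauchy: "\<And>e. 0 < e \<Longrightarrow> \<exists>N. \<forall>i\<ge>N. \<forall>j\<ge>N. energy_norm \<kappa> (s i - s j) < e"
  obtains P where "P \<in> Epos" "(\<lambda>n. energy_norm \<kappa> (s n - P)) \<longlonglongrightarrow> 0"
    "\<And>f c. (\<And>n. lsc_integral (s n) f \<le> c) \<Longrightarrow> lsc_integral P f \<le> c"
proof -
  have sE: "s n \<in> finite_energy \<kappa>" for n using s EposD(2) by blast
  obtain N where N: "\<And>i j. N \<le> i \<Longrightarrow> N \<le> j \<Longrightarrow> energy_norm \<kappa> (s i - s j) < 1"
    using Cauchy[of 1] by auto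
  define b where "b = Max ((\<lambda>n. energy_norm \<kappa> (s n)) ` {..N}) + 1"
  have b: "energy_norm \<kappa> (s n) \<le> b" for n
  proof (cases "n \<le> N")
    case True
    then have "energy_norm \<kappa> (s n) \<le> Max ((\<lambda>n. energy_norm \<kappa> (s n)) ` {..N})" by (intro Max_ge) auto
    then show ?thesis by (simp add: b_def)
  next
    case False
    have "s n = (s n - s N) + s N" by simp
    then have "energy_norm \<kappa> (s n) \<le> energy_norm \<kappa> (s n - s N) + energy_norm \<kappa> (s N)"
      using energy_norm_triangle[OF finite_energy_minus(1)[OF sE sE] sE, of n N N] by simp
    moreover have "energy_norm \<kappa> (s N) \<le> Max ((\<lambda>n. energy_norm \<kappa> (s n)) ` {..N})" by (intro Max_ge) auto
    moreover have "energy_norm \<kappa> (s n - s N) < 1" using N[of n N] False by simp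
    ultimately show ?thesis unfolding b_def by linarith
  qed
  have "\<exists>B. \<forall>n. integ (s n) f \<le> B" if f: "f \<in> Cc" "\<And>x. 0 \<le> f x" for f
  proof -
    obtain B where B: "0 \<le> B" "\<And>\<mu>. \<mu> \<in> Epos \<Longrightarrow> integ \<mu> f \<le> B * energy_norm \<kappa> \<mu>"
      using vague_bound[OF f] by blast
    have "integ (s n) f \<le> B * b" for n
      using B(2)[OF s] mult_left_mono[OF b B(1)] order_trans by blast
    then show ?thesis by blast
  qed
  then obtain P where P: "P \<in> positive_radon" "vague_cluster_point (filtermap s sequentially) P"
    "\<And>f c. (\<And>n. lsc_integral (s n) f \<le> c) \<Longrightarrow> lsc_integral P f \<le> c"
    using vague_cluster_exists[of s] EposD(1)[OF s] by blast
  have "strong_Cauchy \<kappa> (filtermap s sequentially)"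
    unfolding strong_Cauchy_def
  proof (intro allI impI)
    fix e :: real assume "0 < e"
    then obtain N where N: "\<forall>i\<ge>N. \<forall>j\<ge>N. energy_norm \<kappa> (s i - s j) < e" using Cauchy by blast
    have ev: "eventually (\<lambda>\<mu>. \<exists>n\<ge>N. \<mu> = s n) (filtermap s sequentially)"
      unfolding eventually_filtermap by (auto intro: eventually_sequentiallyI[of N])
    show "eventually (\<lambda>(\<mu>, \<nu>). energy_norm \<kappa> (\<mu> - \<nu>) < e) (filtermap s sequentially \<times>\<^sub>F filtermap s sequentially)"
      unfolding eventually_prod_filter using ev N by blast
  qed
  moreover have "filtermap s sequentially \<noteq> bot" by (simp add: filtermap_bot_iff)
  moreover have "eventually (\<lambda>\<nu>. \<nu> \<in> Epos) (filtermap s sequentially)"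
    using s by (simp add: eventually_filtermap)
  ultimately have "P \<in> finite_energy \<kappa>" "((\<lambda>\<nu>. energy_norm \<kappa> (\<nu> - P)) \<longlongrightarrow> 0) (filtermap s sequentially)"
    using consistency P(2) unfolding consistency_principle_def by blast+
  then show thesis using that P by (simp add: finite_energy_pos_def filterlim_filtermap)
qed

end

section \<open>Inner capacity and inner balayage\<close>

text \<open>Meant for closed \<open>K\<close>, where it says that the open set \<open>- K\<close> has measure zero.\<close>

definition carried_by :: "'a::topological_space radon \<Rightarrow> 'a set \<Rightarrow> bool" where
  "carried_by \<mu> K \<longleftrightarrow> lsc_integral \<mu> (indicator (- K)) = 0"

lemma carried_by_mono: "carried_by \<mu> K \<Longrightarrow> K \<subseteq> L \<Longrightarrow> carried_by \<mu> L"
  using lsc_integral_indicator_mono[of "- L" "- K" \<mu>] by (auto simp: carried_by_def)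

lemma AE_eq_if_nn_integral_le:
  fixes u v :: "'a \<Rightarrow> ennreal"
  assumes [measurable]: "u \<in> borel_measurable M" "v \<in> borel_measurable M"
    and le: "AE x in M. v x \<le> u x" and int: "(\<integral>\<^sup>+x. u x \<partial>M) \<le> (\<integral>\<^sup>+x. v x \<partial>M)" "(\<integral>\<^sup>+x. v x \<partial>M) < top"
  shows "AE x in M. u x = v x"
proof -
  have "(\<integral>\<^sup>+x. u x - v x \<partial>M) = (\<integral>\<^sup>+x. u x \<partial>M) - (\<integral>\<^sup>+x. v x \<partial>M)"
    using int le by (intro nn_integral_diff) auto
  also have "\<dots> = 0" using int by (simp add: diff_eq_0_iff_ennreal order_le_less_trans)
  finally have "AE x in M. u x - v x = 0" by (subst (asm) nn_integral_0_iff_AE) auto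
  moreover have "AE x in M. u x \<noteq> top"
    using nn_integral_noteq_infinite[of u M] int by (simp add: order_le_less_trans less_top)
  ultimately show ?thesis using le
    by eventually_elim (auto simp: diff_eq_0_iff_ennreal less_top)
qed

text \<open>The first variation at a minimum, for a quadratic function of the parameter.\<close>

lemma linear_term_nonneg:
  fixes a b :: real
  assumes "\<And>t. 0 \<le> t \<Longrightarrow> t \<le> 1 \<Longrightarrow> 0 \<le> 2 * t * a + t\<^sup>2 * b"
  shows "0 \<le> a"
proof (rule ccontr)
  assume "\<not> 0 \<le> a"
  then have a: "a < 0" by simp
  define t where "t = min 1 (- a / (\<bar>b\<bar> + 1))"
  have "t \<le> - a / (\<bar>b\<bar> + 1)" by (simp add: t_def)
  then have "t * (\<bar>b\<bar> + 1) \<le> - a" by (subst (asm) pos_le_divide_eq) auto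
  moreover have "0 < - a / (\<bar>b\<bar> + 1)" using a by (intro divide_pos_pos) auto
  ultimately have t: "0 < t" "t \<le> 1" "t * (\<bar>b\<bar> + 1) \<le> - a"
    by (auto simp: t_def)
  have "t * b \<le> t * (\<bar>b\<bar> + 1)" using t by (intro mult_left_mono) auto
  then have "2 * a + t * b < 0" using t a by linarith
  then have "t * (2 * a + t * b) < 0" using t(1) by (simp add: mult_pos_neg)
  then show False using assms[of t] t by (simp add: power2_eq_square algebra_simps)
qed

context locally_compact_Hausdorff
begin

lemma AE_carried_by:
  fixes K :: "'a set"
  assumes "\<mu> \<in> positive_radon" "compact K" "carried_by \<mu> K"
  shows "AE x in radon_measure \<mu>. x \<in> K"
proof (rule AE_I')
  have "emeasure (radon_measure \<mu>) (- K) = 0"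
    using assms by (simp add: emeasure_radon_open open_Compl compact_imp_closed carried_by_def)
  then show "- K \<in> null_sets (radon_measure \<mu>)"
    using assms(2) by (intro null_setsI) (simp_all add: borel_open open_Compl compact_imp_closed)
qed auto

lemma radon_zero_if_null:
  fixes \<mu> :: "'a radon"
  assumes \<mu>: "\<mu> \<in> positive_radon" and AE: "AE x in radon_measure \<mu>. False"
  shows "\<mu> = 0"
proof (rule radon_eqI)
  fix f :: "'a \<Rightarrow> real" assume f: "f \<in> Cc" "\<And>x. 0 \<le> f x"
  have "ennreal (integ \<mu> f) = (\<integral>\<^sup>+x. ennreal (f x) \<partial>radon_measure \<mu>)"
    using \<mu> f by (simp add: nn_integral_radon_Cc)
  also have "\<dots> = (\<integral>\<^sup>+x. 0 \<partial>radon_measure \<mu>)"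
    using AE by (intro nn_integral_cong_AE) (auto elim: eventually_mono)
  finally show "integ \<mu> f = integ 0 f"
    using positive_radonD[OF \<mu> f] by (simp add: ennreal_eq_0_iff)
qed

text \<open>
  Inner regularity in the form that is needed: if all but a part of small outer measure of a compact
  set \<open>C\<close> lies in \<open>S\<close>, then \<open>S\<close> contains a compact set of positive measure. Stated with the outer
  measure it applies to every set \<open>S\<close> on which \<open>\<mu>\<close> is concentrated, even if \<open>S\<close> is not a Borel set.
\<close>

lemma compact_subset_positive:
  fixes C S :: "'a set"
  assumes \<mu>: "\<mu> \<in> positive_radon" and C: "compact C"
    and less: "outer_mass \<mu> (C - S) < emeasure (radon_measure \<mu>) C"
  obtains K where "compact K" "K \<subseteq> S" "K \<subseteq> C" "emeasure (radon_measure \<mu>) K \<noteq> 0"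
proof -
  let ?M = "radon_measure \<mu>"
  obtain U where U: "open U" "C - S \<subseteq> U" "lsc_integral \<mu> (indicator U) < emeasure ?M C"
    using less unfolding outer_mass_def INF_less_iff by auto
  have "compact (C - U)" using C U(1) by (rule compact_diff)
  moreover have "emeasure ?M (C - U) \<noteq> 0"
  proof
    assume 0: "emeasure ?M (C - U) = 0"
    have "emeasure ?M C \<le> emeasure ?M (U \<union> (C - U))"
      using C U(1) by (intro emeasure_mono) (auto simp: borel_compact)
    also have "\<dots> \<le> emeasure ?M U + emeasure ?M (C - U)"
      using C U(1) by (intro emeasure_subadditive) (auto simp: borel_compact)
    also have "\<dots> = lsc_integral \<mu> (indicator U)" using 0 \<mu> U(1) by (simp add: emeasure_radon_open)
    finally show False using U(3) by simp
  qed
  moreover have "C - U \<subseteq> S" "C - U \<subseteq> C" using U(2) by auto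
  ultimately show thesis using that by blast
qed

end

context energy_kernel
begin

text \<open>
  The potential-theoretic null sets: those all of whose compact subsets are null sets for every
  measure of finite energy. They are exactly the sets of inner capacity zero.
\<close>

definition energy_null :: "'a set \<Rightarrow> bool" where
  "energy_null A \<longleftrightarrow> (\<forall>K \<sigma>. compact K \<longrightarrow> K \<subseteq> A \<longrightarrow> \<sigma> \<in> Epos \<longrightarrow> emeasure (radon_measure \<sigma>) K = 0)"

lemma energy_null_mono: "energy_null B \<Longrightarrow> A \<subseteq> B \<Longrightarrow> energy_null A"
  by (meson energy_null_def subset_trans)

text \<open>
  The cone onto which \<open>\<mu>\<close> is projected. Only measures carried by compact subsets of \<open>A\<close> are admitted;
  this makes the projection a limit of projections onto cones of compact sets.
\<close>

definition compact_cone :: "'a set \<Rightarrow> 'a radon set" where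
  "compact_cone A = {\<mu>\<in>Epos. \<exists>K. compact K \<and> K \<subseteq> A \<and> carried_by \<mu> K}"

lemma coneD: "\<mu> \<in> compact_cone A \<Longrightarrow> \<mu> \<in> Epos"
  by (simp add: compact_cone_def)

lemma cone_mono: "A \<subseteq> B \<Longrightarrow> compact_cone A \<subseteq> compact_cone B"
  by (auto simp: compact_cone_def)

lemma cone_compact: "compact K \<Longrightarrow> \<mu> \<in> compact_cone K \<longleftrightarrow> \<mu> \<in> Epos \<and> carried_by \<mu> K"
  by (auto simp: compact_cone_def intro: carried_by_mono)

lemma cone_zero: "0 \<in> compact_cone A"
  by (auto simp: compact_cone_def Epos_zero carried_by_def intro!: exI[of _ "{}"])

lemma cone_scale: "\<mu> \<in> compact_cone A \<Longrightarrow> 0 \<le> c \<Longrightarrow> c *\<^sub>R \<mu> \<in> compact_cone A"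
  by (auto simp: compact_cone_def Epos_scale carried_by_def lsc_integral_scale_measure EposD)

lemma cone_add:
  assumes "\<mu> \<in> compact_cone A" "\<nu> \<in> compact_cone A"
  shows "\<mu> + \<nu> \<in> compact_cone A"
proof -
  obtain K where K: "compact K" "K \<subseteq> A" "carried_by \<mu> K" using assms(1) by (auto simp: compact_cone_def)
  obtain L where L: "compact L" "L \<subseteq> A" "carried_by \<nu> L" using assms(2) by (auto simp: compact_cone_def)
  have "carried_by \<mu> (K \<union> L)" "carried_by \<nu> (K \<union> L)"
    using K(3) L(3) by (auto elim: carried_by_mono)
  then have "carried_by (\<mu> + \<nu>) (K \<union> L)"
    using assms coneD EposD by (simp add: carried_by_def lsc_integral_add_measure)
  moreover have "compact (K \<union> L)" "K \<union> L \<subseteq> A" using K L by auto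
  moreover have "\<mu> + \<nu> \<in> Epos" using assms coneD by (intro Epos_add)
  ultimately show ?thesis unfolding compact_cone_def by blast
qed

lemma restrict_Epos:
  assumes \<sigma>: "\<sigma> \<in> Epos" and K: "compact K"
  obtains \<rho> where "\<rho> \<in> Epos" "carried_by \<rho> K" "\<rho> = 0 \<Longrightarrow> emeasure (radon_measure \<sigma>) K = 0"
proof -
  obtain \<rho> where "\<rho> \<in> positive_radon" "\<sigma> - \<rho> \<in> positive_radon" "lsc_integral \<rho> (indicator (- K)) = 0"
    "\<rho> = 0 \<Longrightarrow> emeasure (radon_measure \<sigma>) K = 0"
    using restrict_radon[OF EposD(1)[OF \<sigma>] K] by blast
  then show thesis using that[of \<rho>] Epos_mono[OF _ _ \<sigma>] by (simp add: carried_by_def)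
qed

lemma inner_capacity_zero_iff_no_measure:
  "inner_capacity \<kappa> A = 0 \<longleftrightarrow>
    {\<mu>\<in>Epos. concentrated_on \<mu> A \<and> total_mass \<mu> = 1} = {}" (is "_ \<longleftrightarrow> ?S = {}")
proof
  assume "?S = {}"
  then have "inner_capacity \<kappa> A = inverse (INF \<mu>\<in>{}. energy \<kappa> \<mu> \<mu>)"
    unfolding inner_capacity_def by (simp only:)
  then show "inner_capacity \<kappa> A = 0" by (simp add: top_ereal_def)
next
  assume cap: "inner_capacity \<kappa> A = 0"
  show "?S = {}"
  proof (rule ccontr)
    assume "?S \<noteq> {}"
    then obtain \<mu> where \<mu>: "\<mu> \<in> ?S" by blast
    let ?I = "INF \<mu>\<in>?S. energy \<kappa> \<mu> \<mu>"
    have fe: "\<nu> \<in> finite_energy \<kappa>" if "\<nu> \<in> ?S" for \<nu> using that EposD by blast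
    have "?I \<le> energy \<kappa> \<mu> \<mu>" using \<mu> by (rule INF_lower)
    also have "\<dots> = ereal (ip \<mu> \<mu>)" using fe[OF \<mu>] by (simp add: energy_inner)
    finally have "?I \<noteq> \<infinity>" by auto
    moreover have "0 \<le> ?I"
      using fe by (intro INF_greatest) (simp add: energy_inner ip_nonneg)
    ultimately have "inverse ?I \<noteq> 0" by (cases ?I) auto
    with cap show False by (simp add: inner_capacity_def)
  qed
qed

text \<open>
  A measure that charges a compact \<open>K \<subseteq> A\<close> can be restricted to \<open>K\<close> and normalised. Conversely a
  measure concentrated on \<open>A\<close> charges a compact subset of \<open>A\<close> by inner regularity.
\<close>

lemma inner_capacity_zero_iff: "inner_capacity \<kappa> A = 0 \<longleftrightarrow> energy_null A"
  unfolding inner_capacity_zero_iff_no_measure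
proof
  assume empty: "{\<mu>\<in>Epos. concentrated_on \<mu> A \<and> total_mass \<mu> = 1} = {}"
  show "energy_null A"
    unfolding energy_null_def
  proof (intro allI impI)
    fix K \<sigma> assume K: "compact K" "K \<subseteq> A" and \<sigma>: "\<sigma> \<in> Epos"
    obtain \<rho> where \<rho>: "\<rho> \<in> Epos" "carried_by \<rho> K" "\<rho> = 0 \<Longrightarrow> emeasure (radon_measure \<sigma>) K = 0"
      using restrict_Epos[OF \<sigma> K(1)] by blast
    note \<rho>p = EposD(1)[OF \<rho>(1)]
    let ?M = "radon_measure \<rho>"
    have "(indicator UNIV :: 'a \<Rightarrow> ennreal) = (\<lambda>_. 1)" by auto
    then have tm: "total_mass \<rho> = emeasure ?M UNIV"
      using emeasure_radon_open[OF \<rho>p, of UNIV] by (simp add: total_mass_def)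
    have AE_K: "AE x in ?M. x \<in> K" using \<rho>p K(1) \<rho>(2) by (rule AE_carried_by)
    have "emeasure ?M UNIV = emeasure ?M K"
      using AE_K K(1) by (intro emeasure_eq_AE) (auto simp: borel_compact)
    then have "emeasure ?M UNIV < top" using emeasure_radon_compact[OF \<rho>p K(1)] by simp
    then obtain t where t: "total_mass \<rho> = ennreal t" "0 \<le> t" unfolding tm by (cases "emeasure ?M UNIV") auto
    have "t = 0"
    proof (rule ccontr)
      assume "t \<noteq> 0"
      then have t0: "0 < t" using t(2) by simp
      define \<tau> where "\<tau> = (1 / t) *\<^sub>R \<rho>"
      have "\<tau> \<in> Epos" unfolding \<tau>_def using \<rho>(1) t0 by (intro Epos_scale) auto
      moreover have "total_mass \<tau> = 1"
        using t t0 \<rho>p unfolding \<tau>_def total_mass_def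
        by (simp add: lsc_integral_scale_measure ennreal_mult[symmetric])
      moreover have "concentrated_on \<tau> A"
        unfolding concentrated_on_def negligible_for_outer_mass
      proof (intro allI impI)
        fix C
        have "outer_mass \<tau> (- A \<inter> C) \<le> lsc_integral \<tau> (indicator (- K))"
          using K by (intro outer_mass_le) (auto simp: open_Compl compact_imp_closed)
        also have "\<dots> = 0" using \<rho>(2) \<rho>p t0 by (simp add: \<tau>_def lsc_integral_scale_measure carried_by_def)
        finally show "outer_mass \<tau> (- A \<inter> C) = 0" by simp
      qed
      ultimately show False using empty by blast
    qed
    then have "emeasure ?M UNIV = 0" using t tm by simp
    then have "AE x in ?M. False" by (intro AE_I'[of UNIV]) auto
    then show "emeasure (radon_measure \<sigma>) K = 0" using radon_zero_if_null[OF \<rho>p] \<rho>(3) by blast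
  qed
next
  assume null: "energy_null A"
  show "{\<mu>\<in>Epos. concentrated_on \<mu> A \<and> total_mass \<mu> = 1} = {}"
  proof (rule ccontr)
    assume "\<not> ?thesis"
    then obtain \<tau> where \<tau>: "\<tau> \<in> Epos" "concentrated_on \<tau> A" "total_mass \<tau> = 1" by blast
    note \<tau>p = EposD(1)[OF \<tau>(1)]
    have "(0::ennreal) < (SUP g\<in>minorants (\<lambda>_. 1). ennreal (integ \<tau> g))"
      using \<tau>(3) by (simp add: total_mass_def lsc_integral_minorants)
    then obtain g where g: "g \<in> minorants (\<lambda>_. 1)" "0 < ennreal (integ \<tau> g)"
      unfolding less_SUP_iff by blast
    obtain C where C: "compact C" "\<And>x. x \<notin> C \<Longrightarrow> g x = 0" using Cc_support[OF minorantsD(1)[OF g(1)]] by blast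
    have "ennreal (integ \<tau> g) = (\<integral>\<^sup>+x. ennreal (g x) \<partial>radon_measure \<tau>)"
      using nn_integral_radon_Cc[OF \<tau>p minorantsD(1,2)[OF g(1)]] by simp
    also have "\<dots> \<le> (\<integral>\<^sup>+x. indicator C x \<partial>radon_measure \<tau>)"
      using C(2) minorantsD(3)[OF g(1)] by (intro nn_integral_mono) (auto simp: indicator_def)
    also have "\<dots> = emeasure (radon_measure \<tau>) C" using C(1) by (simp add: borel_compact)
    finally have "0 < emeasure (radon_measure \<tau>) C" using g(2) by (rule order_less_le_trans[rotated])
    moreover have "C - A = - A \<inter> C" by auto
    then have "outer_mass \<tau> (C - A) = 0"
      using \<tau>(2) C(1) by (simp add: concentrated_on_def negligible_for_outer_mass)
    ultimately obtain K where "compact K" "K \<subseteq> A" "emeasure (radon_measure \<tau>) K \<noteq> 0"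
      using compact_subset_positive[OF \<tau>p C(1), of A] by metis
    then show False using null \<tau>(1) by (auto simp: energy_null_def)
  qed
qed

text \<open>If \<open>P\<close> charged \<open>K \<inter> N\<close>, it would charge a compact subset of it by inner regularity.\<close>

lemma energy_null_AE:
  assumes P: "P \<in> Epos" and K: "compact K" and c: "carried_by P K" and N: "N \<in> sets borel" "energy_null (K \<inter> N)"
  shows "AE x in radon_measure P. x \<notin> N"
proof -
  let ?M = "radon_measure P"
  note Pp = EposD(1)[OF P]
  have Ks: "K \<in> sets borel" using K by (rule borel_compact)
  have "emeasure ?M (K \<inter> N) = 0"
  proof (rule ccontr)
    assume "emeasure ?M (K \<inter> N) \<noteq> 0"
    moreover have "emeasure ?M K = emeasure ?M (K - (K \<inter> N)) + emeasure ?M (K \<inter> N)"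
      using Ks N(1) by (subst plus_emeasure) (auto simp: Un_absorb2)
    moreover have "emeasure ?M K < top" using Pp K by (rule emeasure_radon_compact)
    ultimately have "emeasure ?M (K - (K \<inter> N)) < emeasure ?M K"
      by (metis ennreal_add_left_cancel_less add.right_neutral zero_less_iff_neq_zero
          ennreal_add_less_top infinity_ennreal_def less_top)
    moreover have "emeasure ?M (K - (K \<inter> N)) = outer_mass P (K - (K \<inter> N))"
      using Pp Ks N(1) by (intro emeasure_radon_measure) auto
    ultimately obtain L where "compact L" "L \<subseteq> K \<inter> N" "emeasure ?M L \<noteq> 0"
      using compact_subset_positive[OF Pp K, of "K \<inter> N"] by metis
    then show False using N(2) P by (auto simp: energy_null_def)
  qed
  then have "AE x in ?M. x \<notin> K \<inter> N" using Ks N(1) by (intro AE_not_in null_setsI) auto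
  moreover have "AE x in ?M. x \<in> K" using Pp K c by (rule AE_carried_by)
  ultimately show ?thesis by eventually_elim auto
qed

lemma mutual_real_nn_integral:
  assumes "\<tau> \<in> Epos" "\<mu> \<in> Epos"
  shows "(\<integral>\<^sup>+x. pot \<kappa> \<mu> x \<partial>radon_measure \<tau>) = ennreal (mutual_real \<mu> \<tau>)"
proof -
  have p: "\<tau> \<in> positive_radon" "\<mu> \<in> positive_radon" using assms EposD by auto
  have "(\<integral>\<^sup>+x. pot \<kappa> \<mu> x \<partial>radon_measure \<tau>) = mutual \<kappa> \<tau> \<mu>"
    using p by (simp add: nn_integral_radon_measure lsc_pot mutual_pot)
  also have "\<dots> = mutual \<kappa> \<mu> \<tau>" using p by (rule mutual_commute)
  finally show ?thesis using mutual_finite[OF assms(2,1)] by (simp add: mutual_real_def)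
qed

lemma mutual_real_mono_pot:
  assumes "\<tau> \<in> Epos" "\<mu> \<in> Epos" "\<nu> \<in> Epos" "\<And>x. pot \<kappa> \<mu> x \<le> pot \<kappa> \<nu> x"
  shows "mutual_real \<mu> \<tau> \<le> mutual_real \<nu> \<tau>"
proof -
  have "ennreal (mutual_real \<mu> \<tau>) \<le> ennreal (mutual_real \<nu> \<tau>)"
    unfolding mutual_real_nn_integral[OF assms(1,2), symmetric] mutual_real_nn_integral[OF assms(1,3), symmetric]
    by (intro nn_integral_mono assms(4))
  then show ?thesis by (simp add: mutual_real_def ennreal_le_iff)
qed

text \<open>
  The variational inequality \<open>\<kappa>(\<mu> - P, \<tau>) \<le> 0\<close> on the cone forces \<open>\<kappa>P \<ge> \<kappa>\<mu>\<close> nearly everywhere on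
  \<open>A\<close>: otherwise test it with the restriction of a measure of finite energy to a compact set on
  which \<open>\<kappa>P < \<kappa>\<mu>\<close>.
\<close>

lemma variational_imp_null:
  assumes \<mu>: "\<mu> \<in> Epos" and P: "P \<in> Epos" and var: "\<And>\<tau>. \<tau> \<in> compact_cone A \<Longrightarrow> mutual_real \<mu> \<tau> \<le> mutual_real P \<tau>"
  shows "energy_null {x\<in>A. pot \<kappa> P x < pot \<kappa> \<mu> x}"
  unfolding energy_null_def
proof (intro allI impI)
  fix K \<sigma> assume K: "compact K" "K \<subseteq> {x\<in>A. pot \<kappa> P x < pot \<kappa> \<mu> x}" and \<sigma>: "\<sigma> \<in> Epos"
  obtain \<rho> where \<rho>: "\<rho> \<in> Epos" "carried_by \<rho> K" "\<rho> = 0 \<Longrightarrow> emeasure (radon_measure \<sigma>) K = 0"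
    using restrict_Epos[OF \<sigma> K(1)] by blast
  let ?M = "radon_measure \<rho>"
  have "\<rho> \<in> compact_cone A" using \<rho> K unfolding compact_cone_def by blast
  then have "mutual_real \<mu> \<rho> \<le> mutual_real P \<rho>" by (rule var)
  then have int: "(\<integral>\<^sup>+x. pot \<kappa> \<mu> x \<partial>?M) \<le> (\<integral>\<^sup>+x. pot \<kappa> P x \<partial>?M)" "(\<integral>\<^sup>+x. pot \<kappa> P x \<partial>?M) < top"
    using \<mu> P \<rho>(1) by (simp_all add: mutual_real_nn_integral ennreal_leI)
  have AE_K: "AE x in ?M. x \<in> K" using EposD(1)[OF \<rho>(1)] K(1) \<rho>(2) by (rule AE_carried_by)
  then have "AE x in ?M. pot \<kappa> P x \<le> pot \<kappa> \<mu> x"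
    by eventually_elim (use K(2) in \<open>auto intro: less_imp_le\<close>)
  then have "AE x in ?M. pot \<kappa> \<mu> x = pot \<kappa> P x"
    using int EposD(1)[OF \<mu>] EposD(1)[OF P]
    by (intro AE_eq_if_nn_integral_le lsc_borel_measurable_radon lsc_pot)
  with AE_K have "AE x in ?M. False" by eventually_elim (use K(2) in auto)
  then have "\<rho> = 0" by (rule radon_zero_if_null[OF EposD(1)[OF \<rho>(1)]])
  then show "emeasure (radon_measure \<sigma>) K = 0" by (rule \<rho>(3))
qed

end

context consistent_kernel
begin

lemma ip_diff_expand:
  assumes "\<mu> \<in> finite_energy \<kappa>" "\<nu> \<in> finite_energy \<kappa>"
  shows "ip (\<mu> - c *\<^sub>R \<nu>) (\<mu> - c *\<^sub>R \<nu>) = ip \<mu> \<mu> - 2 * c * ip \<nu> \<mu> + c\<^sup>2 * ip \<nu> \<nu>"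
  using assms by (simp add: ip_bilinear ip_commute[of \<mu> \<nu>] power2_eq_square algebra_simps)

lemma ip_self_tendsto:
  assumes s: "\<And>n. s n \<in> finite_energy \<kappa>" and P: "P \<in> finite_energy \<kappa>"
    and lim: "(\<lambda>n. energy_norm \<kappa> (s n - P)) \<longlonglongrightarrow> 0"
  shows "(\<lambda>n. ip (s n) (s n)) \<longlonglongrightarrow> ip P P"
proof -
  have eq: "ip (s n) (s n) = (energy_norm \<kappa> (s n - P))\<^sup>2 + 2 * ip (s n) P - ip P P" for n
    using s[of n] P by (simp add: energy_norm_power2 ip_bilinear ip_commute[of P "s n"])
  have "(\<lambda>n. (energy_norm \<kappa> (s n - P))\<^sup>2 + 2 * ip (s n) P - ip P P) \<longlonglongrightarrow> 0\<^sup>2 + 2 * ip P P - ip P P"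
    using ip_tendsto_left[OF s P P lim] lim by (intro tendsto_intros)
  then show ?thesis unfolding eq by simp
qed

text \<open>
  Minimizing sequences in a convex cone of \<open>\<E>\<^sup>+\<close> are strong Cauchy sequences by the parallelogram
  law. Their limit \<open>P\<close> is the orthogonal projection of \<open>\<mu>\<close> onto the closure of the cone, and is
  characterised by \<open>\<kappa>(\<mu> - P, \<tau>) \<le> 0\<close> on the cone together with \<open>\<kappa>(\<mu> - P, P) = 0\<close>.
\<close>

lemma cone_minimizing:
  assumes \<mu>: "\<mu> \<in> Epos" and s: "\<And>n. s n \<in> compact_cone A"
    and d: "\<And>\<tau>. \<tau> \<in> compact_cone A \<Longrightarrow> d \<le> ip (\<mu> - \<tau>) (\<mu> - \<tau>)"
    and lim: "(\<lambda>n. ip (\<mu> - s n) (\<mu> - s n)) \<longlonglongrightarrow> d"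
  obtains P where "P \<in> Epos" "(\<lambda>n. energy_norm \<kappa> (s n - P)) \<longlonglongrightarrow> 0"
    "\<forall>f c. (\<forall>n. lsc_integral (s n) f \<le> c) \<longrightarrow> lsc_integral P f \<le> c"
    "\<forall>\<tau>\<in>compact_cone A. ip (\<mu> - P) \<tau> \<le> 0" "ip (\<mu> - P) P = 0"
proof -
  have fe: "\<tau> \<in> finite_energy \<kappa>" if "\<tau> \<in> compact_cone A" for \<tau> using that coneD EposD by blast
  have sE: "s n \<in> finite_energy \<kappa>" for n using s fe by blast
  have \<mu>E: "\<mu> \<in> finite_energy \<kappa>" using \<mu> EposD by blast
  have par: "ip (s i - s j) (s i - s j) \<le> 2 * (ip (\<mu> - s i) (\<mu> - s i) - d) + 2 * (ip (\<mu> - s j) (\<mu> - s j) - d)" for i j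
  proof -
    \<comment> \<open>by convexity the midpoint is a competitor\<close>
    let ?c = "(1/2) *\<^sub>R (s i + s j)"
    have "?c \<in> compact_cone A" using s by (intro cone_scale cone_add) auto
    then have "d \<le> ip (\<mu> - ?c) (\<mu> - ?c)" by (rule d)
    moreover have "ip (s i - s j) (s i - s j) + 4 * ip (\<mu> - ?c) (\<mu> - ?c) =
        2 * ip (\<mu> - s i) (\<mu> - s i) + 2 * ip (\<mu> - s j) (\<mu> - s j)"
      using sE[of i] sE[of j] \<mu>E
      by (simp add: ip_bilinear ip_commute[of "s i" \<mu>] ip_commute[of "s j" \<mu>] ip_commute[of "s j" "s i"] algebra_simps)
    ultimately show ?thesis by simp
  qed
  have "\<exists>N. \<forall>i\<ge>N. \<forall>j\<ge>N. energy_norm \<kappa> (s i - s j) < e" if e: "0 < e" for e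
  proof -
    have "eventually (\<lambda>n. ip (\<mu> - s n) (\<mu> - s n) < d + e\<^sup>2 / 4) sequentially"
      using lim e by (intro order_tendstoD(2)) auto
    then obtain N where N: "\<And>n. N \<le> n \<Longrightarrow> ip (\<mu> - s n) (\<mu> - s n) < d + e\<^sup>2 / 4"
      unfolding eventually_sequentially by blast
    have "energy_norm \<kappa> (s i - s j) < e" if "N \<le> i" "N \<le> j" for i j
    proof (rule power2_less_imp_less)
      show "(energy_norm \<kappa> (s i - s j))\<^sup>2 < e\<^sup>2"
        using par[of i j] N[OF that(1)] N[OF that(2)] sE
        by (simp add: energy_norm_power2 finite_energy_minus)
    qed (use e in simp)
    then show ?thesis by blast
  qed
  then obtain P where P: "P \<in> Epos" "(\<lambda>n. energy_norm \<kappa> (s n - P)) \<longlonglongrightarrow> 0"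
    "\<And>f c. (\<And>n. lsc_integral (s n) f \<le> c) \<Longrightarrow> lsc_integral P f \<le> c"
    using Epos_complete[of s] coneD[OF s] by blast
  have PE: "P \<in> finite_energy \<kappa>" using P(1) EposD by blast
  note l1 = ip_tendsto_left[OF sE PE _ P(2)] and l2 = ip_self_tendsto[OF sE PE P(2)]
  have lim_gen: "(\<lambda>n. ip (z - r *\<^sub>R s n) (z - r *\<^sub>R s n)) \<longlonglongrightarrow> ip (z - r *\<^sub>R P) (z - r *\<^sub>R P)"
    if z: "z \<in> finite_energy \<kappa>" for z r
  proof -
    show ?thesis unfolding ip_diff_expand[OF z sE] ip_diff_expand[OF z PE] using l1[OF z] l2 by (intro tendsto_intros)
  qed
  have "(\<lambda>n. ip (\<mu> - s n) (\<mu> - s n)) \<longlonglongrightarrow> ip (\<mu> - P) (\<mu> - P)"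
    using lim_gen[OF \<mu>E, of 1] by simp
  then have dP: "ip (\<mu> - P) (\<mu> - P) = d" using lim by (rule LIMSEQ_unique)
  have var: "ip (\<mu> - P) \<tau> \<le> 0" if \<tau>: "\<tau> \<in> compact_cone A" for \<tau>
  proof -
    have "0 \<le> - ip (\<mu> - P) \<tau>"
    proof (rule linear_term_nonneg)
      fix t :: real assume t: "0 \<le> t" "t \<le> 1"
      have z: "\<mu> - t *\<^sub>R \<tau> \<in> finite_energy \<kappa>" using \<mu>E fe[OF \<tau>] by (intro ip_bilinear)
      have "d \<le> ip ((\<mu> - t *\<^sub>R \<tau>) - 1 *\<^sub>R s n) ((\<mu> - t *\<^sub>R \<tau>) - 1 *\<^sub>R s n)" for n
      proof -
        have "(\<mu> - t *\<^sub>R \<tau>) - 1 *\<^sub>R s n = \<mu> - (t *\<^sub>R \<tau> + s n)" by simp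
        then show ?thesis using d[OF cone_add[OF cone_scale[OF \<tau> t(1)] s]] by metis
      qed
      then have "d \<le> ip ((\<mu> - t *\<^sub>R \<tau>) - 1 *\<^sub>R P) ((\<mu> - t *\<^sub>R \<tau>) - 1 *\<^sub>R P)"
        by (intro LIMSEQ_le_const[OF lim_gen[OF z]]) blast
      also have "(\<mu> - t *\<^sub>R \<tau>) - 1 *\<^sub>R P = (\<mu> - P) - t *\<^sub>R \<tau>" by simp
      also have "ip ((\<mu> - P) - t *\<^sub>R \<tau>) ((\<mu> - P) - t *\<^sub>R \<tau>) = d - 2 * t * ip (\<mu> - P) \<tau> + t\<^sup>2 * ip \<tau> \<tau>"
        unfolding dP[symmetric] using finite_energy_minus(1)[OF \<mu>E PE] fe[OF \<tau>]
        by (subst ip_diff_expand) (simp_all add: ip_commute[of \<tau> "\<mu> - P"])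
      finally show "0 \<le> 2 * t * - ip (\<mu> - P) \<tau> + t\<^sup>2 * ip \<tau> \<tau>" by simp
    qed
    then show ?thesis by simp
  qed
  have "ip (\<mu> - P) P \<le> 0"
  proof -
    have "(\<lambda>n. ip (s n) (\<mu> - P)) \<longlonglongrightarrow> ip P (\<mu> - P)" using \<mu>E PE by (intro l1 ip_bilinear)
    moreover have "ip (s n) (\<mu> - P) \<le> 0" for n
      using var[OF s, of n] ip_commute[OF sE finite_energy_minus(1)[OF \<mu>E PE]] by simp
    ultimately have "ip P (\<mu> - P) \<le> 0" by (intro LIMSEQ_le_const2) blast+
    then show ?thesis using ip_commute[OF PE finite_energy_minus(1)[OF \<mu>E PE]] by simp
  qed
  moreover have "0 \<le> ip (\<mu> - P) P"
  proof (rule linear_term_nonneg)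
    fix t :: real assume t: "0 \<le> t" "t \<le> 1"
    have "d \<le> ip (\<mu> - (1 - t) *\<^sub>R s n) (\<mu> - (1 - t) *\<^sub>R s n)" for n
      using t by (intro d cone_scale s) auto
    then have "d \<le> ip (\<mu> - (1 - t) *\<^sub>R P) (\<mu> - (1 - t) *\<^sub>R P)"
      by (intro LIMSEQ_le_const[OF lim_gen[OF \<mu>E]]) blast
    also have "\<mu> - (1 - t) *\<^sub>R P = (\<mu> - P) - (- t) *\<^sub>R P" by (simp add: algebra_simps)
    also have "ip ((\<mu> - P) - (- t) *\<^sub>R P) ((\<mu> - P) - (- t) *\<^sub>R P) = d + 2 * t * ip (\<mu> - P) P + t\<^sup>2 * ip P P"
      unfolding dP[symmetric] using finite_energy_minus(1)[OF \<mu>E PE] PE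
      by (subst ip_diff_expand) (simp_all add: ip_commute[of P "\<mu> - P"])
    finally show "0 \<le> 2 * t * ip (\<mu> - P) P + t\<^sup>2 * ip P P" by simp
  qed
  ultimately have orth: "ip (\<mu> - P) P = 0" by simp
  show thesis
    by (rule that[OF P(1,2) _ _ orth]) (use P(3) var in blast)+
qed

lemma minimizing_sequence:
  assumes \<mu>: "\<mu> \<in> Epos"
  obtains s d where "\<And>n. s n \<in> compact_cone A" "\<And>\<tau>. \<tau> \<in> compact_cone A \<Longrightarrow> d \<le> ip (\<mu> - \<tau>) (\<mu> - \<tau>)"
    "(\<lambda>n. ip (\<mu> - s n) (\<mu> - s n)) \<longlonglongrightarrow> d"
proof -
  define d where "d = (INF \<tau>\<in>compact_cone A. ip (\<mu> - \<tau>) (\<mu> - \<tau>))"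
  have bdd: "bdd_below ((\<lambda>\<tau>. ip (\<mu> - \<tau>) (\<mu> - \<tau>)) ` compact_cone A)"
    using \<mu> coneD EposD(2) by (intro bdd_belowI[of _ 0]) (auto intro!: ip_nonneg finite_energy_minus)
  have low: "d \<le> ip (\<mu> - \<tau>) (\<mu> - \<tau>)" if "\<tau> \<in> compact_cone A" for \<tau>
    unfolding d_def using bdd that by (rule cINF_lower)
  have "\<exists>\<tau>\<in>compact_cone A. ip (\<mu> - \<tau>) (\<mu> - \<tau>) < d + 1 / real (Suc n)" for n
    using bdd cone_zero[of A] by (subst cINF_less_iff[symmetric]) (auto simp: d_def)
  then obtain s where s: "\<And>n. s n \<in> compact_cone A" "\<And>n. ip (\<mu> - s n) (\<mu> - s n) < d + 1 / real (Suc n)" by metis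
  have "(\<lambda>n. ip (\<mu> - s n) (\<mu> - s n)) \<longlonglongrightarrow> d"
  proof (rule tendsto_sandwich[OF _ _ tendsto_const])
    show "(\<lambda>n. d + 1 / real (Suc n)) \<longlonglongrightarrow> d"
      using tendsto_add[OF tendsto_const LIMSEQ_Suc[OF lim_1_over_n], of d] by simp
    show "eventually (\<lambda>n. ip (\<mu> - s n) (\<mu> - s n) \<le> d + 1 / real (Suc n)) sequentially"
      by (intro always_eventually allI less_imp_le s(2))
  qed (use s(1) low in auto)
  then show thesis using that s(1) low by blast
qed

lemma compact_projection:
  assumes \<mu>: "\<mu> \<in> Epos" and K: "compact K"
  obtains P where "P \<in> compact_cone K" "\<And>\<tau>. \<tau> \<in> compact_cone K \<Longrightarrow> ip (\<mu> - P) \<tau> \<le> 0" "ip (\<mu> - P) P = 0"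
    "\<And>\<tau>. \<tau> \<in> compact_cone K \<Longrightarrow> ip (\<mu> - P) (\<mu> - P) \<le> ip (\<mu> - \<tau>) (\<mu> - \<tau>)"
proof -
  obtain s d where s: "\<And>n. s n \<in> compact_cone K" "\<And>\<tau>. \<tau> \<in> compact_cone K \<Longrightarrow> d \<le> ip (\<mu> - \<tau>) (\<mu> - \<tau>)"
    "(\<lambda>n. ip (\<mu> - s n) (\<mu> - s n)) \<longlonglongrightarrow> d"
    using minimizing_sequence[OF \<mu>] by blast
  obtain P where P: "P \<in> Epos" "(\<lambda>n. energy_norm \<kappa> (s n - P)) \<longlonglongrightarrow> 0"
    "\<forall>f c. (\<forall>n. lsc_integral (s n) f \<le> c) \<longrightarrow> lsc_integral P f \<le> c"
    "\<forall>\<tau>\<in>compact_cone K. ip (\<mu> - P) \<tau> \<le> 0" "ip (\<mu> - P) P = 0"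
    by (rule cone_minimizing[OF \<mu> s])
  have "\<forall>n. lsc_integral (s n) (indicator (- K)) \<le> 0"
    using s(1) K by (simp add: cone_compact carried_by_def)
  then have "lsc_integral P (indicator (- K)) \<le> 0" using P(3) by blast
  then have "P \<in> compact_cone K" using P(1) K by (simp add: cone_compact carried_by_def)
  moreover have "ip (\<mu> - P) (\<mu> - P) \<le> ip (\<mu> - \<tau>) (\<mu> - \<tau>)" if \<tau>: "\<tau> \<in> compact_cone K" for \<tau>
  proof -
    have E: "\<mu> - P \<in> finite_energy \<kappa>" "P - \<tau> \<in> finite_energy \<kappa>" "P \<in> finite_energy \<kappa>" "\<tau> \<in> finite_energy \<kappa>"
      using \<mu> P(1) coneD[OF \<tau>] EposD by (auto intro!: finite_energy_minus)
    have "\<mu> - \<tau> = (\<mu> - P) + (P - \<tau>)" by simp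
    then have "ip (\<mu> - \<tau>) (\<mu> - \<tau>) = ip (\<mu> - P) (\<mu> - P) + 2 * ip (\<mu> - P) (P - \<tau>) + ip (P - \<tau>) (P - \<tau>)"
      using E finite_energy_add[OF E(1,2)] ip_right(1)[OF E(1,2)] ip_commute[OF E(2,1)] by simp
    moreover have "ip (\<mu> - P) (P - \<tau>) = ip (\<mu> - P) P - ip (\<mu> - P) \<tau>" using E by (intro ip_right)
    ultimately show ?thesis using bspec[OF P(4) \<tau>] P(5) ip_nonneg[OF E(2)] by simp
  qed
  ultimately show thesis using that[of P] P(4,5) by blast
qed

end

locale domination_kernel = consistent_kernel +
  assumes domination: "domination_principle \<kappa>"
begin

text \<open>
  For compact \<open>K\<close> the projection \<open>P\<close> is itself carried by \<open>K\<close>. Orthogonality and \<open>\<kappa>P \<ge> \<kappa>\<mu>\<close> nearly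
  everywhere on \<open>K\<close> give \<open>\<kappa>P = \<kappa>\<mu> \<le> \<kappa>\<nu>\<close> almost everywhere for \<open>P\<close>, and the domination principle
  extends the inequality to the whole space.
\<close>

lemma compact_projection_minimal:
  assumes \<mu>: "\<mu> \<in> Epos" and K: "compact K" and P: "P \<in> compact_cone K"
    and var: "\<And>\<tau>. \<tau> \<in> compact_cone K \<Longrightarrow> ip (\<mu> - P) \<tau> \<le> 0" and orth: "ip (\<mu> - P) P = 0"
    and \<nu>: "\<nu> \<in> Epos" and null: "energy_null {x\<in>K. pot \<kappa> \<nu> x < pot \<kappa> \<mu> x}"
  shows "pot \<kappa> P x \<le> pot \<kappa> \<nu> x"
proof -
  let ?M = "radon_measure P"
  have PE: "P \<in> Epos" and c: "carried_by P K" using P K by (auto simp: cone_compact)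
  note p = EposD(1)[OF \<mu>] EposD(1)[OF PE] EposD(1)[OF \<nu>]
  have meas: "{x. pot \<kappa> \<alpha> x < pot \<kappa> \<beta> x} \<in> sets borel"
    if "\<alpha> \<in> positive_radon" "\<beta> \<in> positive_radon" for \<alpha> \<beta>
  proof -
    have [measurable]: "pot \<kappa> \<alpha> \<in> borel_measurable borel" "pot \<kappa> \<beta> \<in> borel_measurable borel"
      using that by (auto intro: lsc_borel_measurable lsc_pot)
    have "{x \<in> space borel. pot \<kappa> \<alpha> x < pot \<kappa> \<beta> x} \<in> sets borel" by measurable
    then show ?thesis by simp
  qed
  have ipm: "ip (\<mu> - P) \<tau> = mutual_real \<mu> \<tau> - mutual_real P \<tau>" if "\<tau> \<in> Epos" for \<tau>
    using finite_energy_minus(2)[OF EposD(2)[OF \<mu>] EposD(2)[OF PE] EposD(2)[OF that]]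
      ip_Epos[OF \<mu> that] ip_Epos[OF PE that] by simp
  have "energy_null {x\<in>K. pot \<kappa> P x < pot \<kappa> \<mu> x}"
  proof (rule variational_imp_null[OF \<mu> PE])
    fix \<tau> assume "\<tau> \<in> compact_cone K"
    then show "mutual_real \<mu> \<tau> \<le> mutual_real P \<tau>" using var[of \<tau>] ipm[of \<tau>] coneD[of \<tau> K] by simp
  qed
  then have "AE x in ?M. x \<notin> {x. pot \<kappa> P x < pot \<kappa> \<mu> x}"
    by (intro energy_null_AE[OF PE K c] meas p) (simp add: Collect_conj_eq)
  then have le1: "AE x in ?M. pot \<kappa> \<mu> x \<le> pot \<kappa> P x" by (simp add: not_less)
  have "AE x in ?M. x \<notin> {x. pot \<kappa> \<nu> x < pot \<kappa> \<mu> x}"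
    using null by (intro energy_null_AE[OF PE K c] meas p) (simp add: Collect_conj_eq)
  then have le2: "AE x in ?M. pot \<kappa> \<mu> x \<le> pot \<kappa> \<nu> x" by (simp add: not_less)
  have "mutual_real \<mu> P = mutual_real P P" using orth ipm[OF PE] by simp
  then have "AE x in ?M. pot \<kappa> P x = pot \<kappa> \<mu> x"
    using le1 p \<mu> PE
    by (intro AE_eq_if_nn_integral_le lsc_borel_measurable_radon lsc_pot) (auto simp: mutual_real_nn_integral)
  with le2 have "AE x in ?M. \<not> pot \<kappa> \<nu> x < pot \<kappa> P x" by eventually_elim auto
  then have "emeasure ?M {x. pot \<kappa> \<nu> x < pot \<kappa> P x} = 0"
    using meas[OF p(3,2)] by (subst (asm) AE_iff_measurable[OF _ refl]) auto
  then have "outer_mass P {x. pot \<kappa> \<nu> x < pot \<kappa> P x} = 0"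
    using emeasure_radon_measure[OF p(2) meas[OF p(3,2)]] by simp
  moreover have "{x. \<not> potential \<kappa> P x \<le> potential \<kappa> \<nu> x} = {x. pot \<kappa> \<nu> x < pot \<kappa> P x}"
    using p by (simp add: potential_positive less_eq_ennreal.rep_eq[symmetric] not_le)
  ultimately have "negligible_for P {x. \<not> potential \<kappa> P x \<le> potential \<kappa> \<nu> x}"
    by (simp add: negligible_for_outer_mass)
  then have "potential \<kappa> P x \<le> potential \<kappa> \<nu> x"
    using domination PE \<nu> by (auto simp: domination_principle_def)
  then show ?thesis using p by (simp add: potential_positive less_eq_ennreal.rep_eq)
qed

text \<open>
  For arbitrary \<open>A\<close> the projection \<open>P\<close> need not be concentrated on \<open>A\<close>, and the previous argument
  does not apply to \<open>P\<close> directly. But \<open>P\<close> is the strong limit of the projections \<open>s n\<close> onto the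
  cones of compact sets \<open>K n \<subseteq> A\<close>, whose potentials are bounded by \<open>\<kappa>\<nu>\<close>, and this bound survives
  passage to the limit.
\<close>

lemma balayage_exists:
  assumes \<mu>: "\<mu> \<in> Epos"
  obtains P s where "P \<in> Epos" "\<And>n. s n \<in> compact_cone A" "(\<lambda>n. energy_norm \<kappa> (s n - P)) \<longlonglongrightarrow> 0"
    "energy_null {x\<in>A. pot \<kappa> P x < pot \<kappa> \<mu> x}"
    "\<And>\<nu> x. \<nu> \<in> Epos \<Longrightarrow> energy_null {x\<in>A. pot \<kappa> \<nu> x < pot \<kappa> \<mu> x} \<Longrightarrow> pot \<kappa> P x \<le> pot \<kappa> \<nu> x"
    "\<And>\<tau>. \<tau> \<in> compact_cone A \<Longrightarrow> ip P \<tau> = ip \<mu> \<tau>"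
proof -
  obtain t d where t: "\<And>n. t n \<in> compact_cone A" and d: "\<And>\<tau>. \<tau> \<in> compact_cone A \<Longrightarrow> d \<le> ip (\<mu> - \<tau>) (\<mu> - \<tau>)"
    and tlim: "(\<lambda>n. ip (\<mu> - t n) (\<mu> - t n)) \<longlonglongrightarrow> d"
    using minimizing_sequence[OF \<mu>] by blast
  have "\<exists>K. compact K \<and> K \<subseteq> A \<and> carried_by (t n) K" for n using t[of n] by (simp add: compact_cone_def)
  then obtain K where K: "\<And>n. compact (K n)" "\<And>n. K n \<subseteq> A" "\<And>n. carried_by (t n) (K n)" by metis
  have tK: "t n \<in> compact_cone (K n)" for n using K t[of n] coneD by (simp add: cone_compact)
  have "\<exists>P. P \<in> compact_cone (K n) \<and> (\<forall>\<tau>\<in>compact_cone (K n). ip (\<mu> - P) \<tau> \<le> 0) \<and> ip (\<mu> - P) P = 0 \<and>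
      (\<forall>\<tau>\<in>compact_cone (K n). ip (\<mu> - P) (\<mu> - P) \<le> ip (\<mu> - \<tau>) (\<mu> - \<tau>))" for n
    by (rule compact_projection[OF \<mu> K(1)[of n]]) blast
  then obtain s where s: "\<And>n. s n \<in> compact_cone (K n)" "\<And>n \<tau>. \<tau> \<in> compact_cone (K n) \<Longrightarrow> ip (\<mu> - s n) \<tau> \<le> 0"
    "\<And>n. ip (\<mu> - s n) (s n) = 0"
    "\<And>n \<tau>. \<tau> \<in> compact_cone (K n) \<Longrightarrow> ip (\<mu> - s n) (\<mu> - s n) \<le> ip (\<mu> - \<tau>) (\<mu> - \<tau>)" by metis
  have sA: "s n \<in> compact_cone A" for n using s(1) cone_mono[OF K(2)] by blast
  have slim: "(\<lambda>n. ip (\<mu> - s n) (\<mu> - s n)) \<longlonglongrightarrow> d"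
  proof (rule tendsto_sandwich[OF _ _ tendsto_const tlim])
    show "eventually (\<lambda>n. ip (\<mu> - s n) (\<mu> - s n) \<le> ip (\<mu> - t n) (\<mu> - t n)) sequentially"
      using s(4)[OF tK] by simp
  qed (use d[OF sA] in simp)
  obtain P where P: "P \<in> Epos" "(\<lambda>n. energy_norm \<kappa> (s n - P)) \<longlonglongrightarrow> 0"
    "\<forall>f c. (\<forall>n. lsc_integral (s n) f \<le> c) \<longrightarrow> lsc_integral P f \<le> c"
    "\<forall>\<tau>\<in>compact_cone A. ip (\<mu> - P) \<tau> \<le> 0" "ip (\<mu> - P) P = 0"
    by (rule cone_minimizing[OF \<mu> sA d slim])
  have ipm: "ip (\<mu> - P) \<tau> = mutual_real \<mu> \<tau> - mutual_real P \<tau>" if "\<tau> \<in> Epos" for \<tau>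
    using finite_energy_minus(2)[OF EposD(2)[OF \<mu>] EposD(2)[OF P(1)] EposD(2)[OF that]]
      ip_Epos[OF \<mu> that] ip_Epos[OF P(1) that] by simp
  have var: "mutual_real \<mu> \<tau> \<le> mutual_real P \<tau>" if "\<tau> \<in> compact_cone A" for \<tau>
    using bspec[OF P(4) that] ipm[OF coneD[OF that]] by simp
  have minimal: "pot \<kappa> P x \<le> pot \<kappa> \<nu> x"
    if \<nu>: "\<nu> \<in> Epos" and null: "energy_null {x\<in>A. pot \<kappa> \<nu> x < pot \<kappa> \<mu> x}" for \<nu> x
  proof -
    have "pot \<kappa> (s n) x \<le> pot \<kappa> \<nu> x" for n
    proof (rule compact_projection_minimal[OF \<mu> K(1) s(1) s(2) s(3) \<nu>])
      show "energy_null {x\<in>K n. pot \<kappa> \<nu> x < pot \<kappa> \<mu> x}"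
        using null K(2)[of n] by (auto elim!: energy_null_mono)
    qed
    then have "\<forall>n. lsc_integral (s n) (\<kappa> x) \<le> pot \<kappa> \<nu> x" by (simp add: pot_def)
    then show ?thesis unfolding pot_def[of \<kappa> P] using P(3) by blast
  qed
  have "pot \<kappa> P x \<le> pot \<kappa> \<mu> x" for x
  proof (rule minimal[OF \<mu>])
    show "energy_null {x\<in>A. pot \<kappa> \<mu> x < pot \<kappa> \<mu> x}" by (simp add: energy_null_def)
  qed
  then have "mutual_real P \<tau> \<le> mutual_real \<mu> \<tau>" if "\<tau> \<in> Epos" for \<tau> using that P(1) \<mu> by (intro mutual_real_mono_pot)
  then have "ip P \<tau> = ip \<mu> \<tau>" if "\<tau> \<in> compact_cone A" for \<tau>
    using var[OF that] coneD[OF that] P(1) \<mu> by (simp add: ip_Epos antisym)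
  moreover have "energy_null {x\<in>A. pot \<kappa> P x < pot \<kappa> \<mu> x}"
    using \<mu> P(1) var by (rule variational_imp_null)
  ultimately show thesis using that P(1,2) sA minimal by blast
qed

lemma balayage_class_iff:
  assumes "\<mu> \<in> positive_radon"
  shows "\<nu> \<in> balayage_class \<kappa> A \<mu> \<longleftrightarrow> \<nu> \<in> Epos \<and> energy_null {x\<in>A. pot \<kappa> \<nu> x < pot \<kappa> \<mu> x}"
proof -
  have "nearly_everywhere_on \<kappa> A (\<lambda>x. potential \<kappa> \<mu> x \<le> potential \<kappa> \<nu> x) \<longleftrightarrow>
      energy_null {x\<in>A. pot \<kappa> \<nu> x < pot \<kappa> \<mu> x}" if \<nu>: "\<nu> \<in> Epos"
  proof -
    have le: "potential \<kappa> \<mu> x \<le> potential \<kappa> \<nu> x \<longleftrightarrow> \<not> pot \<kappa> \<nu> x < pot \<kappa> \<mu> x" for x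
      using assms EposD(1)[OF \<nu>] by (simp add: potential_positive less_eq_ennreal.rep_eq[symmetric] not_less)
    show ?thesis
      unfolding nearly_everywhere_on_def le inner_capacity_zero_iff
    proof
      assume "\<exists>E\<subseteq>A. energy_null E \<and> (\<forall>x\<in>A - E. \<not> pot \<kappa> \<nu> x < pot \<kappa> \<mu> x)"
      then obtain E where "energy_null E" "\<forall>x\<in>A - E. \<not> pot \<kappa> \<nu> x < pot \<kappa> \<mu> x" by blast
      then show "energy_null {x\<in>A. pot \<kappa> \<nu> x < pot \<kappa> \<mu> x}" by (auto elim!: energy_null_mono)
    next
      assume "energy_null {x\<in>A. pot \<kappa> \<nu> x < pot \<kappa> \<mu> x}"
      then show "\<exists>E\<subseteq>A. energy_null E \<and> (\<forall>x\<in>A - E. \<not> pot \<kappa> \<nu> x < pot \<kappa> \<mu> x)"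
        by (intro exI[of _ "{x\<in>A. pot \<kappa> \<nu> x < pot \<kappa> \<mu> x}"]) auto
    qed
  qed
  then show ?thesis by (auto simp: balayage_class_def)
qed

text \<open>A measure in \<open>\<E>\<^sup>+\<close> is determined by its potential, since its mutual energies are.\<close>

lemma pot_injective:
  assumes "\<mu> \<in> Epos" "\<nu> \<in> Epos" "\<And>x. pot \<kappa> \<mu> x = pot \<kappa> \<nu> x"
  shows "\<mu> = \<nu>"
proof -
  have m: "mutual_real \<mu> \<tau> = mutual_real \<nu> \<tau>" if "\<tau> \<in> Epos" for \<tau>
    using mutual_real_mono_pot[OF that assms(1,2)] mutual_real_mono_pot[OF that assms(2,1)] assms(3) by (simp add: antisym)
  have "ip (\<mu> - \<nu>) (\<mu> - \<nu>) = 0"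
    using assms(1,2) m[OF assms(1)] m[OF assms(2)] by (simp add: ip_diff_eq)
  then have "\<mu> - \<nu> = 0" using assms by (intro ip_definite finite_energy_diff)
  then show ?thesis by simp
qed

lemma inner_balayage_pos:
  assumes \<mu>: "\<mu> \<in> Epos"
  shows inner_balayage_pos_Epos: "inner_balayage_pos \<kappa> A \<mu> \<in> Epos"
    and inner_balayage_pos_approx: "\<exists>s. (\<forall>n. s n \<in> compact_cone A) \<and> (\<lambda>n. energy_norm \<kappa> (s n - inner_balayage_pos \<kappa> A \<mu>)) \<longlonglongrightarrow> 0"
    and inner_balayage_pos_cone: "\<tau> \<in> compact_cone A \<Longrightarrow> ip (inner_balayage_pos \<kappa> A \<mu>) \<tau> = ip \<mu> \<tau>"
proof -
  obtain P s where P: "P \<in> Epos" "\<And>n. s n \<in> compact_cone A" "(\<lambda>n. energy_norm \<kappa> (s n - P)) \<longlonglongrightarrow> 0"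
    "energy_null {x\<in>A. pot \<kappa> P x < pot \<kappa> \<mu> x}"
    and minimal: "\<And>\<nu> x. \<nu> \<in> Epos \<Longrightarrow> energy_null {x\<in>A. pot \<kappa> \<nu> x < pot \<kappa> \<mu> x} \<Longrightarrow> pot \<kappa> P x \<le> pot \<kappa> \<nu> x"
    and cone_eq: "\<And>\<tau>. \<tau> \<in> compact_cone A \<Longrightarrow> ip P \<tau> = ip \<mu> \<tau>"
    using balayage_exists[OF \<mu>] by blast
  note bclass = balayage_class_iff[OF EposD(1)[OF \<mu>]]
  have le: "potential \<kappa> \<alpha> x \<le> potential \<kappa> \<beta> x \<longleftrightarrow> pot \<kappa> \<alpha> x \<le> pot \<kappa> \<beta> x"
    if "\<alpha> \<in> Epos" "\<beta> \<in> Epos" for \<alpha> \<beta> x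
    using that EposD(1) by (simp add: potential_positive less_eq_ennreal.rep_eq)
  have "inner_balayage_pos \<kappa> A \<mu> = P"
    unfolding inner_balayage_pos_def
  proof (rule the_equality)
    show "P \<in> balayage_class \<kappa> A \<mu> \<and> (\<forall>\<nu>\<in>balayage_class \<kappa> A \<mu>. \<forall>x. potential \<kappa> P x \<le> potential \<kappa> \<nu> x)"
      using P(1,4) minimal by (auto simp: bclass le)
  next
    fix \<beta> assume \<beta>: "\<beta> \<in> balayage_class \<kappa> A \<mu> \<and> (\<forall>\<nu>\<in>balayage_class \<kappa> A \<mu>. \<forall>x. potential \<kappa> \<beta> x \<le> potential \<kappa> \<nu> x)"
    then have \<beta>E: "\<beta> \<in> Epos" "energy_null {x\<in>A. pot \<kappa> \<beta> x < pot \<kappa> \<mu> x}" by (auto simp: bclass)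
    have "P \<in> balayage_class \<kappa> A \<mu>" using P(1,4) by (simp add: bclass)
    then have "pot \<kappa> \<beta> x \<le> pot \<kappa> P x" for x using \<beta> le[OF \<beta>E(1) P(1)] by blast
    then show "\<beta> = P" using minimal[OF \<beta>E] by (intro pot_injective \<beta>E P antisym)
  qed
  then show "inner_balayage_pos \<kappa> A \<mu> \<in> Epos"
    "\<exists>s. (\<forall>n. s n \<in> compact_cone A) \<and> (\<lambda>n. energy_norm \<kappa> (s n - inner_balayage_pos \<kappa> A \<mu>)) \<longlonglongrightarrow> 0"
    "\<tau> \<in> compact_cone A \<Longrightarrow> ip (inner_balayage_pos \<kappa> A \<mu>) \<tau> = ip \<mu> \<tau>"
    using P(1-3) cone_eq by auto
qed

text \<open>
  \<open>\<mu>\<^sup>A\<close> and \<open>\<mu>\<close> have the same mutual energy with the measures of the cone, hence with their strong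
  limit \<open>\<nu>\<^sup>A\<close>: \<open>\<kappa>(\<mu>\<^sup>A, \<nu>\<^sup>A) = \<kappa>(\<mu>, \<nu>\<^sup>A)\<close>. Exchange \<open>\<mu>\<close> and \<open>\<nu>\<close>.
\<close>

lemma inner_balayage_pos_sym:
  assumes \<mu>: "\<mu> \<in> Epos" and \<nu>: "\<nu> \<in> Epos"
  shows "ip (inner_balayage_pos \<kappa> A \<mu>) \<nu> = ip \<mu> (inner_balayage_pos \<kappa> A \<nu>)"
proof -
  have *: "ip (inner_balayage_pos \<kappa> A \<alpha>) (inner_balayage_pos \<kappa> A \<beta>) = ip \<alpha> (inner_balayage_pos \<kappa> A \<beta>)"
    if \<alpha>: "\<alpha> \<in> Epos" and \<beta>: "\<beta> \<in> Epos" for \<alpha> \<beta>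
  proof -
    let ?a = "inner_balayage_pos \<kappa> A \<alpha>" and ?b = "inner_balayage_pos \<kappa> A \<beta>"
    obtain s where s: "\<And>n. s n \<in> compact_cone A" "(\<lambda>n. energy_norm \<kappa> (s n - ?b)) \<longlonglongrightarrow> 0"
      using inner_balayage_pos_approx[OF \<beta>] by blast
    have E: "\<alpha> \<in> finite_energy \<kappa>" "?a \<in> finite_energy \<kappa>" "?b \<in> finite_energy \<kappa>" and sE: "\<And>n. s n \<in> finite_energy \<kappa>"
      using \<alpha> \<beta> inner_balayage_pos_Epos s(1) coneD EposD(2) by blast+
    have "ip (s n) ?a = ip (s n) \<alpha>" for n
      using inner_balayage_pos_cone[OF \<alpha> s(1)] ip_commute[OF sE E(2)] ip_commute[OF sE E(1)] by simp
    then have "(\<lambda>n. ip (s n) \<alpha>) \<longlonglongrightarrow> ip ?b ?a"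
      using ip_tendsto_left[OF sE E(3) E(2) s(2)] by simp
    then have "ip ?b ?a = ip ?b \<alpha>"
      using ip_tendsto_left[OF sE E(3) E(1) s(2)] by (rule LIMSEQ_unique)
    then show ?thesis using ip_commute[OF E(3,2)] ip_commute[OF E(3,1)] by simp
  qed
  let ?a = "inner_balayage_pos \<kappa> A \<mu>" and ?b = "inner_balayage_pos \<kappa> A \<nu>"
  have E: "\<mu> \<in> finite_energy \<kappa>" "\<nu> \<in> finite_energy \<kappa>" "?a \<in> finite_energy \<kappa>" "?b \<in> finite_energy \<kappa>"
    using \<mu> \<nu> inner_balayage_pos_Epos EposD(2) by blast+
  have "ip ?a \<nu> = ip \<nu> ?a" using E by (intro ip_commute)
  also have "\<dots> = ip ?b ?a" using *[OF \<nu> \<mu>] by simp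
  also have "\<dots> = ip ?a ?b" using E by (intro ip_commute)
  also have "\<dots> = ip \<mu> ?b" by (rule *[OF \<mu> \<nu>])
  finally show ?thesis .
qed

lemma inner_balayage_finite_energy: "\<mu> \<in> finite_energy \<kappa> \<Longrightarrow> inner_balayage \<kappa> A \<mu> \<in> finite_energy \<kappa>"
  unfolding inner_balayage_def by (intro finite_energy_diff inner_balayage_pos_Epos finite_energy_parts)

lemma inner_balayage_sym:
  assumes \<mu>: "\<mu> \<in> finite_energy \<kappa>" and \<nu>: "\<nu> \<in> finite_energy \<kappa>"
  shows "ip (inner_balayage \<kappa> A \<mu>) \<nu> = ip \<mu> (inner_balayage \<kappa> A \<nu>)"
proof -
  let ?B = "inner_balayage_pos \<kappa> A"
  let ?p = "pos_part \<mu>" and ?q = "neg_part \<mu>" and ?r = "pos_part \<nu>" and ?t = "neg_part \<nu>"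
  note parts = finite_energy_parts[OF \<mu>] finite_energy_parts[OF \<nu>]
  have B: "?B \<alpha> \<in> Epos" if "\<alpha> \<in> Epos" for \<alpha> using that by (rule inner_balayage_pos_Epos)
  have sym: "mutual_real (?B \<alpha>) \<beta> = mutual_real \<alpha> (?B \<beta>)" if "\<alpha> \<in> Epos" "\<beta> \<in> Epos" for \<alpha> \<beta>
    using inner_balayage_pos_sym[OF that, of A] that B by (simp add: ip_Epos)
  have "ip (?B ?p - ?B ?q) (?r - ?t) = ip (?p - ?q) (?B ?r - ?B ?t)"
    using parts B by (simp add: ip_diff_eq sym)
  then show ?thesis by (simp add: inner_balayage_def pos_part_minus_neg_part)
qed

end

theorem theorem3p2:
  fixes \<kappa> :: "'a::t2_space \<Rightarrow> 'a \<Rightarrow> ennreal"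
    and \<mu> :: "'a radon"
    and A :: "'a set"
  assumes "locally_compact_space (euclidean :: 'a topology)"
    and "is_kernel \<kappa>"
    and "energy_principle \<kappa>"
    and "consistency_principle \<kappa>"
    and "domination_principle \<kappa>"
    and "\<mu> \<in> finite_energy \<kappa>"
  shows "inner_balayage \<kappa> A \<mu> \<in> finite_energy \<kappa> \<and>
    (\<forall>\<nu>\<in>finite_energy \<kappa>.
       energy_defined \<kappa> (inner_balayage \<kappa> A \<mu>) \<nu> \<and>
       energy_defined \<kappa> \<mu> (inner_balayage \<kappa> A \<nu>) \<and>
       energy \<kappa> (inner_balayage \<kappa> A \<mu>) \<nu> = energy \<kappa> \<mu> (inner_balayage \<kappa> A \<nu>)) \<and>
    (\<forall>\<xi>\<in>finite_energy \<kappa>.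
       (\<forall>\<nu>\<in>finite_energy \<kappa>. energy \<kappa> \<xi> \<nu> = energy \<kappa> \<mu> (inner_balayage \<kappa> A \<nu>)) \<longrightarrow>
       \<xi> = inner_balayage \<kappa> A \<mu>)"
proof -
  interpret domination_kernel "TYPE('a)" \<kappa>
    by unfold_locales (use assms in auto)
  note \<mu> = assms(6)
  have B: "inner_balayage \<kappa> A \<nu> \<in> finite_energy \<kappa>" if "\<nu> \<in> finite_energy \<kappa>" for \<nu>
    using that by (rule inner_balayage_finite_energy)
  \<comment> \<open>the relation is tested with \<open>\<xi> - \<mu>\<^sup>A\<close> itself\<close>
  have unique: "\<xi> = inner_balayage \<kappa> A \<mu>"
    if \<xi>: "\<xi> \<in> finite_energy \<kappa>"
      and eq: "\<forall>\<nu>\<in>finite_energy \<kappa>. energy \<kappa> \<xi> \<nu> = energy \<kappa> \<mu> (inner_balayage \<kappa> A \<nu>)" for \<xi>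
  proof -
    let ?\<delta> = "\<xi> - inner_balayage \<kappa> A \<mu>"
    have \<delta>: "?\<delta> \<in> finite_energy \<kappa>" using \<xi> B[OF \<mu>] by (rule finite_energy_minus)
    have "ip \<xi> ?\<delta> = ip \<mu> (inner_balayage \<kappa> A ?\<delta>)"
      using eq \<delta> by (simp add: inner_energy_def)
    also have "\<dots> = ip (inner_balayage \<kappa> A \<mu>) ?\<delta>"
      using inner_balayage_sym[OF \<mu> \<delta>] by simp
    finally have "ip ?\<delta> ?\<delta> = 0"
      using finite_energy_minus(2)[OF \<xi> B[OF \<mu>] \<delta>] by simp
    then have "?\<delta> = 0" by (rule ip_definite[OF \<delta>])
    then show ?thesis by simp
  qed
  show ?thesis
    using \<mu> B unique by (auto simp: energy_inner inner_balayage_sym)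
qed

end
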